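(* If $L\subseteq\{0,1\}^*$ is a language decided by a $\mathrm{polylog}(n)$-time randomized Turing machine (allowing for two-sided error), then $L$ is also decided by a $\mathrm{polylog}(n)$-time deterministic Turing machine with a $\mathrm{quasipoly}(n)$-time preprocessing step, a one-time cost for all inputs of length $n$.
   Context: Turing machines are random access Turing machines (they can read any chosen input coordinate, so sublinear running times are meaningful); $n$ denotes the input length. Two-sided error means that on every input the randomized machine answers correctly with probability at least $2/3$. $\mathrm{polylog}(n)=(\log n)^{O(1)}$ and $\mathrm{quasipoly}(n)=2^{\mathrm{polylog}(n)}$. A preprocessing step is a deterministic computation that depends only on the input length $n$ (not on the input itself), is performed once for each $n$, and whose output is available (with random access) to the deterministic machine when it is run on any input of length $n$. *)

theory Defs
  imports "HOL-Probability.Probability_Mass_Function"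
begin

section \<open>Random access Turing machines\<close>

text \<open>
  States and tape symbols are initial segments of the naturals.  Symbol 0 is the blank, and the
  symbols 1 and 2 stand for the bits 0 and 1.  State 0 is the initial state; the two halting states
  are \<open>accept\<close> and \<open>reject\<close>.  Tapes are infinite to the right only, and moving left
  from cell 0 leaves the head in place.
\<close>

datatype move = Move_Left | Stay | Move_Right

type_synonym tape = "(nat \<Rightarrow> nat) \<times> nat"
type_synonym config = "nat \<times> tape list"

abbreviation (input) accept :: nat where "accept \<equiv> 1"
abbreviation (input) reject :: nat where "reject \<equiv> 2"

text \<open>
  The type parameter \<open>'c\<close> is the type of the coin tossed in each step: a machine of type
  \<open>unit ratm\<close> has a single transition function and is deterministic, a machine of type
  \<open>bool ratm\<close> has two transition functions, chosen between by a fair coin, and is randomized.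

  Besides its read/write tapes a machine has random access to a list of read-only words (the input,
  and possibly the result of the preprocessing).  Tape \<open>i\<close> doubles as the address tape of
  word \<open>i\<close>: in each step the transition function sees the letter of word \<open>i\<close> at the
  position whose binary numeral is currently written on tape \<open>i\<close>, or \<open>None\<close> if that
  position is beyond the end of the word.  Hence reading a chosen letter costs as much as writing
  down its address, and the length of a word can be found by binary search.
\<close>

record 'c ratm =
  num_states :: nat
  num_symbols :: nat
  num_tapes :: nat
  transition :: "'c \<Rightarrow> nat \<Rightarrow> bool option list \<Rightarrow> nat list \<Rightarrow> nat \<times> (nat \<times> move) list"

definition well_formed :: "nat \<Rightarrow> 'c ratm \<Rightarrow> bool" where
  "well_formed m M \<longleftrightarrow>
     3 \<le> num_states M \<and> 3 \<le> num_symbols M \<and> 1 \<le> num_tapes M \<and> m \<le> num_tapes M \<and>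
     (\<forall>c q rs ss. q < num_states M \<and> length rs = m \<and> length ss = num_tapes M \<and>
          set ss \<subseteq> {..<num_symbols M} \<longrightarrow>
        (let (q', acts) = transition M c q rs ss in
           q' < num_states M \<and> length acts = num_tapes M \<and>
           fst ` set acts \<subseteq> {..<num_symbols M}))"

text \<open>
  The word on a tape is its longest prefix of bits.  Only finitely many cells are nonblank in any
  reachable configuration, so the least index below exists.
\<close>

definition tape_word :: "tape \<Rightarrow> bool list" where
  "tape_word tp = map (\<lambda>i. fst tp i = 2) [0..<(LEAST i. fst tp i \<notin> {1, 2})]"

text \<open>Addresses are written with the least significant bit in cell 0; the empty numeral is 0.\<close>

definition address :: "tape \<Rightarrow> nat" where
  "address tp = horner_sum of_bool 2 (tape_word tp)"

definition fetch :: "bool list \<Rightarrow> tape \<Rightarrow> bool option" where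
  "fetch w tp = (if address tp < length w then Some (w ! address tp) else None)"

fun move_head :: "move \<Rightarrow> nat \<Rightarrow> nat" where
  "move_head Move_Left h = h - 1"
| "move_head Stay h = h"
| "move_head Move_Right h = h + 1"

fun act :: "nat \<times> move \<Rightarrow> tape \<Rightarrow> tape" where
  "act (s, d) (f, h) = (f(h := s), move_head d h)"

definition halted :: "config \<Rightarrow> bool" where
  "halted cf \<longleftrightarrow> fst cf = accept \<or> fst cf = reject"

definition initial :: "'c ratm \<Rightarrow> config" where
  "initial M = (0, replicate (num_tapes M) (\<lambda>_. 0, 0))"

text \<open>In \<^term>\<open>map2 fetch ws tps\<close> the address tapes are the first \<^term>\<open>length ws\<close> tapes.\<close>

definition step :: "'c ratm \<Rightarrow> bool list list \<Rightarrow> 'c \<Rightarrow> config \<Rightarrow> config" where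
  "step M ws c cf =
     (if halted cf then cf
      else let (q, tps) = cf;
               (q', acts) = transition M c q (map2 fetch ws tps) (map (\<lambda>(f, h). f h) tps)
           in (q', map2 act acts tps))"

definition det_run :: "unit ratm \<Rightarrow> bool list list \<Rightarrow> nat \<Rightarrow> config" where
  "det_run M ws t = (step M ws () ^^ t) (initial M)"

primrec rand_run :: "bool ratm \<Rightarrow> bool list list \<Rightarrow> nat \<Rightarrow> config pmf" where
  "rand_run M ws 0 = return_pmf (initial M)"
| "rand_run M ws (Suc t) =
     bind_pmf (rand_run M ws t) (\<lambda>cf. map_pmf (\<lambda>c. step M ws c cf) (bernoulli_pmf (1/2)))"


section \<open>Resource bounds and decision\<close>

definition polylog :: "(nat \<Rightarrow> nat) \<Rightarrow> bool" where
  "polylog T \<longleftrightarrow> (\<exists>k::nat. \<forall>\<^sub>F n in sequentially. real (T n) \<le> log 2 (real n) ^ k)"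

definition quasipoly :: "(nat \<Rightarrow> nat) \<Rightarrow> bool" where
  "quasipoly T \<longleftrightarrow> (\<exists>p. polylog p \<and> (\<forall>n. T n \<le> 2 ^ p n))"

definition verdict :: "bool list set \<Rightarrow> bool list \<Rightarrow> nat" where
  "verdict L x = (if x \<in> L then accept else reject)"

text \<open>The time bound holds for all outcomes of the coin tosses.\<close>

definition rand_decides :: "bool ratm \<Rightarrow> (nat \<Rightarrow> nat) \<Rightarrow> bool list set \<Rightarrow> bool" where
  "rand_decides M T L \<longleftrightarrow>
     (\<forall>x. (\<forall>cf \<in> set_pmf (rand_run M [x] (T (length x))). halted cf) \<and>
          measure_pmf.prob (rand_run M [x] (T (length x))) {cf. fst cf = verdict L x} \<ge> 2/3)"

text \<open>
  A preprocessing machine is run on the word \<open>1\<^sup>n\<close>; its output, the word on its last tape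
  when it has halted, depends on \<open>n\<close> only.
\<close>

definition preprocesses :: "unit ratm \<Rightarrow> (nat \<Rightarrow> nat) \<Rightarrow> (nat \<Rightarrow> bool list) \<Rightarrow> bool" where
  "preprocesses P S A \<longleftrightarrow>
     (\<forall>n. let cf = det_run P [replicate n True] (S n)
          in halted cf \<and> A n = tape_word (last (snd cf)))"

definition det_decides_with ::
    "unit ratm \<Rightarrow> (nat \<Rightarrow> bool list) \<Rightarrow> (nat \<Rightarrow> nat) \<Rightarrow> bool list set \<Rightarrow> bool" where
  "det_decides_with D A T L \<longleftrightarrow>
     (\<forall>x. fst (det_run D [x, A (length x)] (T (length x))) = verdict L x)"

end

theory Submission
  imports Defs
begin

text \<open>
  Let the randomized machine toss \<open>t\<close> coins and let the weight of a position on an input be the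
  number of coin sequences (counted with multiplicity) for which the position is read.  The weights on an
  input add up to at most \<open>t 2\<^sup>t\<close>, and two inputs with different verdicts differ at positions
  of total weight at least \<open>2\<^sup>t / 3\<close>.  It follows that the positions of weight at least
  \<open>2\<^sup>t / (9 t)\<close>, of which there are at most \<open>9 t\<^sup>2\<close>, form a certificate for the
  verdict.  Starting from the all-zero guess, a deterministic machine repeatedly reads the heavy
  positions of the current guess and adds the ones that it finds to the guess.  The sets
  at which guess and input turn out to differ are disjoint, and the input or the last guess is
  sensitive to them, so after \<open>6 t + 1\<close> rounds the guess has the same verdict as the input.

  The sequence of positions read is determined by the answers, so it can be tabulated for all
  sequences of polylogarithmically many answers.  A table entry is found by running the randomized
  machine on sparse inputs for all coin sequences, which takes quasipolynomial time even when numbers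
  are represented in unary, as by the counters of the preprocessing machine.
\<close>

section \<open>Programs for multitape machines\<close>

text \<open>Fixing one list of coin sequences that serves all 2^n inputs is no way out: the usual
  union bound asks for about n of them, too many to try in polylogarithmic time. The proof rests
  instead on a fact about query complexity: for total functions the deterministic one is at most of
  the order of the cube of the bounded-error randomized one. The cube is the product of the number
  of heavy positions and the number of rounds. Totality matters because the input is compared with
  guesses and with inputs obtained by flipping sets of positions, and each of these must have a
  clear verdict. The fraction 1/3 is the gap between acceptance probabilities of at least 2/3 and at
  most 1/3. It is used twice, for the size of a minimal sensitive block and for the weight inside
  it, whence 9 = 3 * 3. A bound on the number of queries says nothing about the time for choosing
  them; this choice is what the table takes over. Since a table entry is a single bit, and the
  deterministic machine knows neither the length of an address nor the number of rounds, the table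
  also has to tell it where an address ends and when to stop asking.\<close>

type_synonym view = "bool option list \<times> nat list"

datatype prog =
    Skip
  | Act "view \<Rightarrow> (nat \<times> move) list"
  | Seq prog prog (infixr ";;" 60)
  | If_then_else "view \<Rightarrow> bool" prog prog
  | While "view \<Rightarrow> bool" prog

definition view_of :: "bool list list \<Rightarrow> tape list \<Rightarrow> view" where
  "view_of ws tps = (map2 fetch ws tps, map (\<lambda>(f, h). f h) tps)"

definition idle :: "view \<Rightarrow> (nat \<times> move) list" where
  "idle v = map (\<lambda>s. (s, Stay)) (snd v)"

text \<open>Tests and the passage from \<open>Skip ;; q\<close> to \<open>q\<close> take an idle
  step of their own, so that a step of a program becomes one transition of the compiled
  machine.\<close>

fun small_step :: "prog \<Rightarrow> view \<Rightarrow> prog \<times> (nat \<times> move) list" where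
  "small_step Skip v = (Skip, idle v)"
| "small_step (Act f) v = (Skip, f v)"
| "small_step (p ;; q) v =
     (if p = Skip then (q, idle v) else let (p', a) = small_step p v in (p' ;; q, a))"
| "small_step (If_then_else c p q) v = (if c v then p else q, idle v)"
| "small_step (While c p) v = (if c v then p ;; While c p else Skip, idle v)"

definition prog_step :: "bool list list \<Rightarrow> prog \<times> tape list \<Rightarrow> prog \<times> tape list" where
  "prog_step ws = (\<lambda>(p, tps). let (p', a) = small_step p (view_of ws tps) in (p', map2 act a tps))"

text \<open>Since \<open>Skip\<close> loops, this means that \<open>p\<close> ends within
  \<open>t\<close> steps, so time bounds can be rounded up freely.\<close>

definition exec :: "bool list list \<Rightarrow> prog \<Rightarrow> nat \<Rightarrow> tape list \<Rightarrow> tape list \<Rightarrow> bool" where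
  "exec ws p t tps tps' \<longleftrightarrow> (prog_step ws ^^ t) (p, tps) = (Skip, tps')"

lemma act_idle [simp]: "map2 act (idle (view_of ws tps)) tps = tps"
  by (rule nth_equalityI) (auto simp: idle_def view_of_def split: prod.splits)

lemma prog_step_Skip [simp]: "prog_step ws (Skip, tps) = (Skip, tps)"
  by (simp add: prog_step_def)

lemma funpow_prog_step_Skip [simp]: "(prog_step ws ^^ t) (Skip, tps) = (Skip, tps)"
  by (induction t) auto

lemma exec_mono: "exec ws p t tps tps' \<Longrightarrow> t \<le> t' \<Longrightarrow> exec ws p t' tps tps'"
  unfolding exec_def using funpow_add[of "t' - t" t "prog_step ws"] by simp

lemma exec_Skip: "exec ws Skip t tps tps"
  by (simp add: exec_def)

lemma exec_Act: "map2 act (f (view_of ws tps)) tps = tps' \<Longrightarrow> exec ws (Act f) 1 tps tps'"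
  by (simp add: exec_def prog_step_def)

lemma prog_step_Seq:
  assumes "p \<noteq> Skip"
  shows "prog_step ws (p ;; q, tps) = (case prog_step ws (p, tps) of (p', tps') \<Rightarrow> (p' ;; q, tps'))"
  using assms by (auto simp: prog_step_def split: prod.splits)

lemma prog_step_Skip_Seq [simp]: "prog_step ws (Skip ;; q, tps) = (q, tps)"
  by (simp add: prog_step_def)

text \<open>The first program may end before its time bound, so only some
  \<open>t' \<le> t + 1\<close> is available; the extra step is the passage to
  \<open>q\<close>.\<close>

lemma funpow_Seq:
  assumes "exec ws p t tps tps'"
  shows "\<exists>t'\<le>t+1. (prog_step ws ^^ t') (p ;; q, tps) = (q, tps')"
  using assms
proof (induction t arbitrary: p tps)
  case 0
  then have "(prog_step ws ^^ 1) (p ;; q, tps) = (q, tps')"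
    by (simp add: exec_def)
  then show ?case by (intro exI[of _ 1]) simp
next
  case (Suc t)
  show ?case
  proof (cases "p = Skip")
    case True
    then have "exec ws Skip (Suc t) tps tps'" using Suc.prems by simp
    then have "tps = tps'" unfolding exec_def funpow_prog_step_Skip by simp
    then have "(prog_step ws ^^ 1) (p ;; q, tps) = (q, tps')"
      using True by simp
    then show ?thesis by (intro exI[of _ 1]) simp
  next
    case False
    obtain p1 tps1 where 1: "prog_step ws (p, tps) = (p1, tps1)" by force
    have "exec ws p1 t tps1 tps'"
      using Suc.prems unfolding exec_def by (simp add: funpow_Suc_right 1 del: funpow.simps)
    then obtain t' where "t' \<le> t + 1" "(prog_step ws ^^ t') (p1 ;; q, tps1) = (q, tps')"
      using Suc.IH by blast
    then have "(prog_step ws ^^ Suc t') (p ;; q, tps) = (q, tps')"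
      by (simp add: funpow_Suc_right prog_step_Seq[OF False] 1 del: funpow.simps)
    then show ?thesis using \<open>t' \<le> t + 1\<close> by (intro exI[of _ "Suc t'"]) simp
  qed
qed

lemma exec_trans:
  assumes "(prog_step ws ^^ t) (p, tps) = (q, tps1)" "exec ws q t' tps1 tps2"
  shows "exec ws p (t + t') tps tps2"
  using assms unfolding exec_def by (subst add.commute) (simp add: funpow_add)

lemma exec_Seq:
  assumes "exec ws p t tps tps1" "exec ws q t' tps1 tps2"
  shows "exec ws (p ;; q) (t + t' + 1) tps tps2"
proof -
  obtain u where "u \<le> t + 1" "(prog_step ws ^^ u) (p ;; q, tps) = (q, tps1)"
    using funpow_Seq[OF assms(1)] by blast
  then have "exec ws (p ;; q) (u + t') tps tps2" by (intro exec_trans[OF _ assms(2)])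
  then show ?thesis using \<open>u \<le> t + 1\<close> by (auto intro: exec_mono)
qed

lemma exec_If:
  assumes "exec ws (if c (view_of ws tps) then p else q) t tps tps'"
  shows "exec ws (If_then_else c p q) (t + 1) tps tps'"
  using exec_trans[where t = 1, OF _ assms] by (simp add: prog_step_def)

lemma exec_While_False: "\<not> c (view_of ws tps) \<Longrightarrow> exec ws (While c p) 1 tps tps"
  by (simp add: exec_def prog_step_def)

lemma exec_While_True:
  assumes "c (view_of ws tps)" "exec ws p t tps tps1" "exec ws (While c p) t' tps1 tps2"
  shows "exec ws (While c p) (t + t' + 2) tps tps2"
proof -
  have "prog_step ws (While c p, tps) = (p ;; While c p, tps)"
    using assms(1) by (simp add: prog_step_def)
  then show ?thesis
    using exec_trans[where t = 1, OF _ exec_Seq[OF assms(2,3)]] by simp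
qed

text \<open>The invariant is the sequence of tape states at the loop head. Each round adds one step
  for the test and one for leaving the body; the final 1 is the last test.\<close>

lemma exec_While:
  assumes "\<And>j. j < N \<Longrightarrow> c (view_of ws (\<sigma> j))" "\<not> c (view_of ws (\<sigma> N))"
    and "\<And>j. j < N \<Longrightarrow> exec ws p t (\<sigma> j) (\<sigma> (Suc j))"
  shows "exec ws (While c p) (N * (t + 2) + 1) (\<sigma> 0) (\<sigma> N)"
  using assms
proof (induction N arbitrary: \<sigma>)
  case 0
  then have "exec ws (While c p) 1 (\<sigma> 0) (\<sigma> 0)" by (intro exec_While_False) simp
  then show ?case by simp
next
  case (Suc N)
  have "exec ws (While c p) (N * (t + 2) + 1) (\<sigma> (Suc 0)) (\<sigma> (Suc N))"
    using Suc.IH[of "\<lambda>j. \<sigma> (Suc j)"] Suc.prems by auto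
  from exec_While_True[OF _ _ this, of "\<sigma> 0" t] Suc.prems(1,3)[of 0]
  have "exec ws (While c p) (t + (N * (t + 2) + 1) + 2) (\<sigma> 0) (\<sigma> (Suc N))" by simp
  then show ?case by (rule exec_mono) simp
qed

section \<open>Compilation of programs into machines\<close>

fun valid_prog :: "nat \<Rightarrow> prog \<Rightarrow> bool" where
  "valid_prog k Skip \<longleftrightarrow> True"
| "valid_prog k (Act f) \<longleftrightarrow>
     (\<forall>rs ss. length ss = k \<and> set ss \<subseteq> {..<3} \<longrightarrow>
        length (f (rs, ss)) = k \<and> fst ` set (f (rs, ss)) \<subseteq> {..<3})"
| "valid_prog k (p ;; q) \<longleftrightarrow> valid_prog k p \<and> valid_prog k q"
| "valid_prog k (If_then_else c p q) \<longleftrightarrow> valid_prog k p \<and> valid_prog k q"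
| "valid_prog k (While c p) \<longleftrightarrow> valid_prog k p"

text \<open>A set that contains \<open>p\<close> and is closed under \<open>small_step\<close>. It
  is finite because unfolding a loop leaves a rest of the body followed by the very same
  loop.\<close>

fun continuations :: "prog \<Rightarrow> prog set" where
  "continuations Skip = {Skip}"
| "continuations (Act f) = {Act f, Skip}"
| "continuations (p ;; q) = (\<lambda>p'. p' ;; q) ` continuations p \<union> continuations q"
| "continuations (If_then_else c p q) = {If_then_else c p q} \<union> continuations p \<union> continuations q"
| "continuations (While c p) =
     {While c p, Skip} \<union> (\<lambda>p'. p' ;; While c p) ` continuations p"

lemma finite_continuations: "finite (continuations p)"
  by (induction p) auto

lemma self_in_continuations [simp]: "p \<in> continuations p"
  by (induction p) auto

lemma small_step_closed:
  "q \<in> continuations p \<Longrightarrow> small_step q v = (q', a) \<Longrightarrow> q' \<in> continuations p"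
proof (induction p arbitrary: q q' a)
  case (Seq p1 p2)
  show ?case
  proof (cases "q \<in> continuations p2")
    case True
    then show ?thesis using Seq by auto
  next
    case False
    then obtain p' where p': "p' \<in> continuations p1" "q = p' ;; p2" using Seq.prems by auto
    obtain p'' a' where s: "small_step p' v = (p'', a')" by force
    show ?thesis using p' Seq.IH(1)[OF p'(1) s] Seq.prems s by (auto split: if_splits)
  qed
next
  case (If_then_else c p1 p2)
  show ?case
  proof (cases "q \<in> continuations p1 \<union> continuations p2")
    case True
    then show ?thesis using If_then_else by auto
  next
    case False
    then show ?thesis using If_then_else.prems by (auto split: if_splits)
  qed
next
  case (While c p)
  show ?case
  proof (cases "q \<in> (\<lambda>p'. p' ;; While c p) ` continuations p")
    case True
    then obtain p' where p': "p' \<in> continuations p" "q = p' ;; While c p" by auto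
    obtain p'' a' where s: "small_step p' v = (p'', a')" by force
    show ?thesis using p' While.IH[OF p'(1) s] While.prems s by (auto split: if_splits)
  next
    case False
    then show ?thesis using While.prems by (auto split: if_splits)
  qed
qed auto

lemma idle_valid:
  "length ss = k \<Longrightarrow> set ss \<subseteq> {..<3} \<Longrightarrow>
     length (idle (rs, ss)) = k \<and> fst ` set (idle (rs, ss)) \<subseteq> {..<3}"
  by (auto simp: idle_def)

lemma small_step_valid:
  fixes ss :: "nat list"
  assumes "valid_prog k p" "q \<in> continuations p" "length ss = k" "set ss \<subseteq> {..<3}"
    and "small_step q (rs, ss) = (q', a)"
  shows "length a = k \<and> fst ` set a \<subseteq> {..<3}"
  using assms
proof (induction p arbitrary: q q' a)
  case Skip
  then show ?case by (auto simp: idle_def)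
next
  case (Act f)
  then have "q = Act f \<or> q = Skip" by simp
  then show ?case
  proof
    assume "q = Act f"
    then have "a = f (rs, ss)" using Act.prems(5) by simp
    then show ?thesis using Act.prems(1,3,4) by (simp only: valid_prog.simps)
  next
    assume "q = Skip"
    then show ?thesis using Act.prems(3-5) by (auto simp: idle_def)
  qed
next
  case (Seq p1 p2)
  show ?case
  proof (cases "q \<in> continuations p2")
    case True
    then show ?thesis using Seq.IH(2)[of q] Seq.prems by simp
  next
    case False
    then obtain p' where p': "p' \<in> continuations p1" "q = p' ;; p2" using Seq.prems by auto
    show ?thesis
    proof (cases "p' = Skip")
      case True
      then have "a = idle (rs, ss)" using p' Seq.prems(5) by simp
      then show ?thesis using idle_valid[OF Seq.prems(3,4)] by simp
    next
      case False
      obtain p'' a' where "small_step p' (rs, ss) = (p'', a')" by force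
      then show ?thesis using p' Seq.IH(1)[of p' p'' a'] Seq.prems False by simp
    qed
  qed
next
  case (If_then_else c p1 p2)
  show ?case
  proof (cases "q \<in> continuations p1 \<union> continuations p2")
    case True
    then show ?thesis
    proof
      assume "q \<in> continuations p1"
      then show ?thesis using If_then_else.IH(1)[of q] If_then_else.prems by simp
    next
      assume "q \<in> continuations p2"
      then show ?thesis using If_then_else.IH(2)[of q] If_then_else.prems by simp
    qed
  next
    case False
    then have "q = If_then_else c p1 p2" using If_then_else.prems(2) by simp
    then have "a = idle (rs, ss)" using If_then_else.prems(5) by simp
    then show ?thesis using idle_valid[OF If_then_else.prems(3,4)] by simp
  qed
next
  case (While c p)
  show ?case
  proof (cases "q \<in> (\<lambda>p'. p' ;; While c p) ` continuations p")
    case True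
    then obtain p' where p': "p' \<in> continuations p" "q = p' ;; While c p" by auto
    show ?thesis
    proof (cases "p' = Skip")
      case True
      then have "a = idle (rs, ss)" using p' While.prems(5) by simp
      then show ?thesis using idle_valid[OF While.prems(3,4)] by simp
    next
      case False
      obtain p'' a' where "small_step p' (rs, ss) = (p'', a')" by force
      then show ?thesis using p' While.IH[of p' p'' a'] While.prems False by simp
    qed
  next
    case False
    then have "q = While c p \<or> q = Skip" using While.prems(2) by simp
    then have "a = idle (rs, ss)" using While.prems(5) by (auto split: if_splits)
    then show ?thesis using idle_valid[OF While.prems(3,4)] by simp
  qed
qed

text \<open>The offset 3 keeps the labels apart from the initial state 0 and the halting states 1
  and 2.\<close>

definition label :: "prog \<Rightarrow> prog \<Rightarrow> nat" where
  "label p = (\<lambda>q. 3 + (SOME g. bij_betw g (continuations p) {..<card (continuations p)}) q)"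

lemma label_bij:
  "bij_betw (label p) (continuations p) {3..<3 + card (continuations p)}"
proof -
  obtain h where "bij_betw h (continuations p) {0..<card (continuations p)}"
    using ex_bij_betw_finite_nat[OF finite_continuations] by blast
  then have "\<exists>g. bij_betw g (continuations p) {..<card (continuations p)}"
    by (metis lessThan_atLeast0)
  then have "bij_betw (SOME g. bij_betw g (continuations p) {..<card (continuations p)})
      (continuations p) {..<card (continuations p)}"
    by (rule someI_ex)
  moreover have "bij_betw (\<lambda>x. 3 + x) {..<card (continuations p)} {3..<3 + card (continuations p)}"
    by (rule bij_betw_byWitness[where f' = "\<lambda>x. x - 3"]) auto
  ultimately show ?thesis
    unfolding label_def by (rule bij_betw_trans[unfolded comp_def])
qed

definition unlabel :: "prog \<Rightarrow> nat \<Rightarrow> prog" where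
  "unlabel p q = (if q = 0 then p else inv_into (continuations p) (label p) q)"

text \<open>Taking the finitely many continuations of a program as states avoids jump addresses.
  State 0 stands for the whole program, which also has a label of its own.\<close>

definition compile :: "nat \<Rightarrow> prog \<Rightarrow> (view \<Rightarrow> bool) \<Rightarrow> unit ratm" where
  "compile k p fin =
     \<lparr>num_states = 3 + card (continuations p), num_symbols = 3, num_tapes = k,
      transition = (\<lambda>_ q rs ss.
        if q = accept \<or> q = reject then (q, idle (rs, ss))
        else if unlabel p q = Skip then (if fin (rs, ss) then accept else reject, idle (rs, ss))
        else let (p', a) = small_step (unlabel p q) (rs, ss) in (label p p', a))\<rparr>"

lemma label_props:
  assumes "q \<in> continuations p"
  shows "3 \<le> label p q" "label p q < 3 + card (continuations p)" "unlabel p (label p q) = q"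
proof -
  show 1: "3 \<le> label p q" "label p q < 3 + card (continuations p)"
    using bij_betwE[OF label_bij] assms by auto
  show "unlabel p (label p q) = q"
    unfolding unlabel_def using 1 inv_into_f_f[OF bij_betw_imp_inj_on[OF label_bij] assms] by simp
qed

lemma unlabel_in:
  assumes "q < 3 + card (continuations p)" "q \<noteq> 1" "q \<noteq> 2"
  shows "unlabel p q \<in> continuations p"
proof (cases "q = 0")
  case False
  with assms have "q \<in> label p ` continuations p"
    using bij_betw_imp_surj_on[OF label_bij, of p] by auto
  then show ?thesis using False by (simp add: unlabel_def inv_into_into)
qed (simp add: unlabel_def)

lemma well_formed_compile:
  assumes "valid_prog k p" "m \<le> k" "1 \<le> k"
  shows "well_formed m (compile k p fin)"
  unfolding well_formed_def
proof (intro conjI allI impI)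
  fix c :: unit and q :: nat and rs :: "bool option list" and ss :: "nat list"
  assume "q < num_states (compile k p fin) \<and> length rs = m \<and>
          length ss = num_tapes (compile k p fin) \<and> set ss \<subseteq> {..<num_symbols (compile k p fin)}"
  then have a: "q < 3 + card (continuations p)" "length ss = k" "set ss \<subseteq> {..<3}"
    by (simp_all add: compile_def)
  show "let (q', acts) = transition (compile k p fin) c q rs ss
          in q' < num_states (compile k p fin) \<and> length acts = num_tapes (compile k p fin) \<and>
             fst ` set acts \<subseteq> {..<num_symbols (compile k p fin)}"
  proof (cases "q = 1 \<or> q = 2")
    case True
    then show ?thesis using a idle_valid[OF a(2,3), of rs] by (simp add: compile_def)
  next
    case False
    then have u: "unlabel p q \<in> continuations p"
      using unlabel_in[of q p] a by simp
    obtain p' b where s: "small_step (unlabel p q) (rs, ss) = (p', b)" by force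
    have l: "label p p' < 3 + card (continuations p)"
      using small_step_closed[OF u s] label_props by blast
    have "length b = k \<and> fst ` set b \<subseteq> {..<3}"
      using small_step_valid[OF assms(1) u _ _ s] a by simp
    then show ?thesis using a s False l idle_valid[OF a(2,3), of rs] by (simp add: compile_def)
  qed
qed (use assms in \<open>simp_all add: compile_def\<close>)

lemma det_run_compile:
  assumes "exec ws p t (snd (initial (compile k p fin))) tps"
  shows "det_run (compile k p fin) ws (t + 1) =
     (if fin (view_of ws tps) then accept else reject, tps)"
proof -
  define M where "M = compile k p fin"
  \<comment> \<open>At \<open>Skip\<close> the program loops, while the machine would go on to a
    halting state. The machine is therefore stopped there, and its step count \<open>j\<close> may
    lag behind \<open>i\<close>.\<close>
  have inv: "\<exists>j\<le>i. \<exists>q p' tps'. (step M ws () ^^ j) (0, s) = (q, tps') \<and> (prog_step ws ^^ i) (p, s) = (p', tps')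
      \<and> q \<noteq> 1 \<and> q \<noteq> 2 \<and> unlabel p q = p' \<and> p' \<in> continuations p" for i s
  proof (induction i)
    case 0
    then show ?case by (auto simp: unlabel_def)
  next
    case (Suc i)
    then obtain j q p' tps' where *: "j \<le> i" "(step M ws () ^^ j) (0, s) = (q, tps')"
      "(prog_step ws ^^ i) (p, s) = (p', tps')" "q \<noteq> 1" "q \<noteq> 2" "unlabel p q = p'" "p' \<in> continuations p"
      by blast
    show ?case
    proof (cases "p' = Skip")
      case True
      then show ?thesis using * by (intro exI[of _ j]) auto
    next
      case False
      obtain p2 a where s: "small_step p' (view_of ws tps') = (p2, a)" by force
      have "p2 \<in> continuations p" using small_step_closed[OF *(7) s] .
      moreover have "step M ws () (q, tps') = (label p p2, map2 act a tps')"
        using * s False by (auto simp: step_def halted_def M_def compile_def view_of_def)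
      moreover have "prog_step ws (p', tps') = (p2, map2 act a tps')"
        using s by (simp add: prog_step_def)
      ultimately show ?thesis using * label_props[of p2 p]
        by (intro exI[of _ "Suc j"]) auto
    qed
  qed
  obtain j q where j: "j \<le> t" "(step M ws () ^^ j) (initial M) = (q, tps)" "q \<noteq> 1" "q \<noteq> 2" "unlabel p q = Skip"
    using inv[of t "snd (initial M)"] assms by (auto simp: exec_def M_def initial_def)
  have 1: "(step M ws () ^^ Suc j) (initial M) = (if fin (view_of ws tps) then 1 else 2, tps)"
    using j act_idle[of ws tps]
    by (auto simp: step_def halted_def M_def compile_def view_of_def)
  have "halted cf \<Longrightarrow> (step M ws () ^^ i) cf = cf" for i cf
    by (induction i) (auto simp: step_def)
  then have "(step M ws () ^^ (t - j + Suc j)) (initial M) = (if fin (view_of ws tps) then 1 else 2, tps)"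
    unfolding funpow_add comp_apply 1 by (auto simp: halted_def)
  then show ?thesis using j(1) by (simp add: det_run_def M_def)
qed

section \<open>Quasipolynomial bounds\<close>

definition bitlen :: "nat \<Rightarrow> nat" where
  "bitlen x = (LEAST k. x < 2 ^ k)"

lemma less_bitlen: "x < 2 ^ bitlen x"
  unfolding bitlen_def by (rule LeastI[of _ x]) simp

lemma bitlen_le_iff: "bitlen x \<le> k \<longleftrightarrow> x < 2 ^ k"
proof
  assume "bitlen x \<le> k"
  then have "(2::nat) ^ bitlen x \<le> 2 ^ k" by simp
  with less_bitlen[of x] show "x < 2 ^ k" by linarith
qed (simp add: bitlen_def Least_le)

lemma less_bitlen_iff: "k < bitlen x \<longleftrightarrow> 2 ^ k \<le> x"
  using bitlen_le_iff[of x k] by auto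

lemma bitlen_mono: "x \<le> y \<Longrightarrow> bitlen x \<le> bitlen y"
  using less_bitlen[of y] by (simp add: bitlen_le_iff)

lemma bitlen_0 [simp]: "bitlen 0 = 0"
  using bitlen_le_iff[of 0 0] by simp

lemma bitlen_pow2 [simp]: "bitlen (2 ^ k) = Suc k"
  by (rule antisym) (auto simp: bitlen_le_iff Suc_le_eq less_bitlen_iff)

lemma bitlen_le_self: "bitlen x \<le> x"
  by (simp add: bitlen_le_iff)

text \<open>One parameter serves both as additive constant and as exponent, so these bounds are
  linearly ordered by \<open>C\<close> and finitely many of them have a common one.\<close>

definition quasi :: "nat \<Rightarrow> nat \<Rightarrow> nat" where
  "quasi C x = 2 ^ ((C + bitlen x) ^ C)"

definition qbounded :: "(nat \<Rightarrow> nat) \<Rightarrow> bool" where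
  "qbounded h \<longleftrightarrow> (\<exists>C. \<forall>x. h x \<le> quasi C x)"

definition plog :: "(nat \<Rightarrow> nat) \<Rightarrow> bool" where
  "plog h \<longleftrightarrow> (\<exists>C. \<forall>x. h x \<le> (C + bitlen x) ^ C)"

lemma power_mono_both:
  fixes a b :: nat
  assumes "a \<le> b" "m \<le> n" "0 < b"
  shows "a ^ m \<le> b ^ n"
proof -
  have "a ^ m \<le> b ^ m" using assms by (simp add: power_mono)
  also have "\<dots> \<le> b ^ n" using assms by (simp add: power_increasing)
  finally show ?thesis .
qed

lemma plogI: "(\<And>x. h x \<le> (C + bitlen x) ^ D) \<Longrightarrow> plog h"
proof -
  assume *: "\<And>x. h x \<le> (C + bitlen x) ^ D"
  have "h x \<le> ((C + D + 1) + bitlen x) ^ (C + D + 1)" for x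
    by (rule order.trans[OF *]) (rule power_mono_both, auto)
  then show "plog h" unfolding plog_def by blast
qed

lemma plog_mono: "plog h \<Longrightarrow> (\<And>x. g x \<le> h x) \<Longrightarrow> plog g"
  unfolding plog_def by (meson order.trans)

lemma plog_const: "plog (\<lambda>_. c)"
  by (rule plogI[of _ c 1]) simp

lemma plog_bitlen: "plog bitlen"
  by (rule plogI[of _ 0 1]) simp

lemma plog_mult:
  assumes "plog f" "plog g"
  shows "plog (\<lambda>x. f x * g x)"
proof -
  obtain C D where *: "\<And>x. f x \<le> (C + bitlen x) ^ C" "\<And>x. g x \<le> (D + bitlen x) ^ D"
    using assms unfolding plog_def by auto
  have "f x * g x \<le> (C + D + 1 + bitlen x) ^ (C + D)" for x
    unfolding power_add
    by (rule mult_le_mono; (rule order.trans, rule *, rule power_mono_both)) auto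
  then show ?thesis by (rule plogI)
qed

lemma plog_add:
  assumes "plog f" "plog g"
  shows "plog (\<lambda>x. f x + g x)"
proof -
  obtain C D where *: "\<And>x. f x \<le> (C + bitlen x) ^ C" "\<And>x. g x \<le> (D + bitlen x) ^ D"
    using assms unfolding plog_def by auto
  have "f x + g x \<le> (C + D + 2 + bitlen x) ^ (C + D + 1)" for x
  proof -
    have "f x \<le> (C + D + 2 + bitlen x) ^ (C + D)" "g x \<le> (C + D + 2 + bitlen x) ^ (C + D)"
      by (rule order.trans, rule *, rule power_mono_both; simp)+
    then have "f x + g x \<le> 2 * (C + D + 2 + bitlen x) ^ (C + D)" by simp
    also have "\<dots> \<le> (C + D + 2 + bitlen x) * (C + D + 2 + bitlen x) ^ (C + D)"
      by (rule mult_le_mono1) simp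
    finally show ?thesis by simp
  qed
  then show ?thesis by (rule plogI)
qed

lemma plog_power:
  assumes "plog f"
  shows "plog (\<lambda>x. f x ^ k)"
  by (induction k) (auto intro: plog_const plog_mult assms)

lemma qbounded_mono: "qbounded h \<Longrightarrow> (\<And>x. g x \<le> h x) \<Longrightarrow> qbounded g"
  unfolding qbounded_def by (meson order.trans)

lemma qbounded_pow2: "plog h \<Longrightarrow> qbounded (\<lambda>x. 2 ^ h x)"
  unfolding qbounded_def plog_def quasi_def by simp

lemma qbounded_quasi: "qbounded (quasi C)"
  unfolding qbounded_def by blast

lemma plog_bitlen_qbounded:
  assumes "qbounded h"
  shows "plog (\<lambda>x. bitlen (h x))"
proof -
  obtain C where "\<And>x. h x \<le> quasi C x" using assms unfolding qbounded_def by auto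
  then have "bitlen (h x) \<le> Suc ((C + bitlen x) ^ C)" for x
    using bitlen_mono[of "h x" "quasi C x"] by (simp add: quasi_def)
  moreover have "plog (\<lambda>x. (C + bitlen x) ^ C + 1)"
    by (intro plog_add plog_power plog_const plog_bitlen)
  ultimately show ?thesis by (auto intro: plog_mono)
qed

lemma qbounded_iff: "qbounded h \<longleftrightarrow> (\<exists>p. plog p \<and> (\<forall>x. h x \<le> 2 ^ p x))"
proof
  assume "qbounded h"
  then have "plog (\<lambda>x. bitlen (h x))" by (rule plog_bitlen_qbounded)
  then show "\<exists>p. plog p \<and> (\<forall>x. h x \<le> 2 ^ p x)"
    using less_bitlen less_imp_le by blast
qed (auto intro: qbounded_mono qbounded_pow2)

lemma qbounded_mult:
  assumes "qbounded f" "qbounded g"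
  shows "qbounded (\<lambda>x. f x * g x)"
proof -
  obtain p q where *: "plog p" "\<And>x. f x \<le> 2 ^ p x" "plog q" "\<And>x. g x \<le> 2 ^ q x"
    using assms unfolding qbounded_iff by auto
  have "f x * g x \<le> 2 ^ (p x + q x)" for x
    unfolding power_add by (rule mult_le_mono) (rule *)+
  then show ?thesis using plog_add[OF *(1,3)] unfolding qbounded_iff by blast
qed

lemma qbounded_const: "qbounded (\<lambda>_. c)"
  by (rule qbounded_mono[OF qbounded_pow2[OF plog_const[of c]]]) simp

lemma qbounded_id: "qbounded (\<lambda>x. x)"
  by (rule qbounded_mono[OF qbounded_pow2[OF plog_bitlen]]) (simp add: less_bitlen less_imp_le)

lemma qbounded_add:
  assumes "qbounded f" "qbounded g"
  shows "qbounded (\<lambda>x. f x + g x)"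
proof -
  obtain p q where *: "plog p" "\<And>x. f x \<le> 2 ^ p x" "plog q" "\<And>x. g x \<le> 2 ^ q x"
    using assms unfolding qbounded_iff by auto
  have "f x + g x \<le> 2 ^ (p x + q x + 1)" for x
  proof -
    have "2 ^ p x \<le> (2::nat) ^ (p x + q x)" "2 ^ q x \<le> (2::nat) ^ (p x + q x)" by auto
    with *(2,4)[of x] have "f x + g x \<le> 2 ^ (p x + q x) + 2 ^ (p x + q x)" by linarith
    then show ?thesis by simp
  qed
  moreover have "plog (\<lambda>x. p x + q x + 1)" using * by (intro plog_add plog_const)
  ultimately show ?thesis unfolding qbounded_iff by blast
qed

text \<open>The binary length of a quasipolynomial value is still polylogarithmic. This is what
  makes quasipolynomial bounds closed under composition.\<close>

lemma plog_comp:
  assumes "plog f" "qbounded g"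
  shows "plog (\<lambda>x. f (g x))"
proof -
  obtain C where *: "\<And>x. f x \<le> (C + bitlen x) ^ C" using assms unfolding plog_def by auto
  have "plog (\<lambda>x. (C + bitlen (g x)) ^ C)"
    by (intro plog_add plog_power plog_const plog_bitlen_qbounded assms)
  then show ?thesis by (rule plog_mono) (rule *)
qed

lemma qbounded_comp:
  assumes "qbounded f" "qbounded g"
  shows "qbounded (\<lambda>x. f (g x))"
proof -
  obtain p where "plog p" "\<And>x. f x \<le> 2 ^ p x" using assms(1) unfolding qbounded_iff by auto
  then show ?thesis using plog_comp[OF _ assms(2)] unfolding qbounded_iff by blast
qed

lemma quasi_mono: "C \<le> D \<Longrightarrow> x \<le> y \<Longrightarrow> quasi C x \<le> quasi D y"
proof (cases "C = 0 \<and> D = 0")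
  case False
  assume "C \<le> D" "x \<le> y"
  then show ?thesis unfolding quasi_def using False
    by (intro power_increasing power_mono_both) (auto simp: bitlen_mono add_mono)
qed (auto simp: quasi_def)

section \<open>Counters\<close>

text \<open>Counter \<open>r\<close> is the head position of tape \<open>r + 1\<close>, whose cell 0 carries a marker.
  Tape 0 and the last tape are left to other purposes.\<close>

definition counter :: "nat \<Rightarrow> tape" where
  "counter c = ((\<lambda>i. if i = 0 then 1 else 0), c)"

definition counters :: "nat \<Rightarrow> tape \<Rightarrow> (nat \<Rightarrow> nat) \<Rightarrow> tape \<Rightarrow> tape list" where
  "counters K tp s tp' = tp # map (\<lambda>r. counter (s r)) [0..<K] @ [tp']"

definition move_counter :: "move \<Rightarrow> nat \<Rightarrow> view \<Rightarrow> (nat \<times> move) list" where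
  "move_counter d r v = (idle v)[r + 1 := (snd v ! (r + 1), d)]"

text \<open>Only cell 0 is marked, so a blank under the head means that the counter is
  positive.\<close>

definition nonzero :: "nat \<Rightarrow> view \<Rightarrow> bool" where
  "nonzero r v \<longleftrightarrow> snd v ! (r + 1) = 0"

abbreviation "Inc r \<equiv> Act (move_counter Move_Right r)"
abbreviation "Dec r \<equiv> Act (move_counter Move_Left r)"

text \<open>The number \<open>K\<close> of counters and the two outer tapes are arbitrary, so
  programs can be combined before the final number of tapes is known. \<open>h\<close> is the number
  of counters that the program may touch.\<close>

definition cexec :: "nat \<Rightarrow> prog \<Rightarrow> nat \<Rightarrow> (nat \<Rightarrow> nat) \<Rightarrow> (nat \<Rightarrow> nat) \<Rightarrow> bool" where
  "cexec h p t s s' \<longleftrightarrow>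
     (\<forall>ws K tp tp'. h \<le> K \<longrightarrow> exec ws p t (counters K tp s tp') (counters K tp s' tp'))"

definition cvalid :: "nat \<Rightarrow> prog \<Rightarrow> bool" where
  "cvalid h p \<longleftrightarrow> (\<forall>K\<ge>h. valid_prog (K + 2) p)"

lemma counter_symbol: "(case counter c of (f, h) \<Rightarrow> f h) = (if c = 0 then 1 else 0)"
  by (simp add: counter_def)

lemma view_counters:
  "snd (view_of ws (counters K tp s tp')) =
     (case tp of (f, h) \<Rightarrow> f h) # map (\<lambda>r. if s r = 0 then 1 else 0) [0..<K] @ [case tp' of (f, h) \<Rightarrow> f h]"
  by (simp add: view_of_def counters_def counter_symbol comp_def)

lemma nth_view_counter:
  "r < K \<Longrightarrow> snd (view_of ws (counters K tp s tp')) ! Suc r = (if s r = 0 then 1 else 0)"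
  by (simp add: view_counters nth_append)

lemma nonzero_counters [simp]:
  "r < K \<Longrightarrow> nonzero r (view_of ws (counters K tp s tp')) \<longleftrightarrow> s r \<noteq> 0"
  by (simp add: nonzero_def nth_view_counter)

lemma length_counters [simp]: "length (counters K tp s tp') = K + 2"
  by (simp add: counters_def)

lemma counters_upd:
  "r < K \<Longrightarrow> (counters K tp s tp')[Suc r := counter c] = counters K tp (s(r := c)) tp'"
  by (auto simp: counters_def list_update_append intro!: nth_equalityI simp: nth_list_update)

lemma length_idle [simp]: "length (idle v) = length (snd v)"
  by (simp add: idle_def)

lemma length_view [simp]: "length (snd (view_of ws tps)) = length tps"
  by (simp add: view_of_def)

lemma act_update:
  assumes "j < length tps"
  shows "map2 act ((idle (view_of ws tps))[j := a]) tps = tps[j := act a (tps ! j)]"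
proof (rule nth_equalityI)
  fix i assume i: "i < length (map2 act ((idle (view_of ws tps))[j := a]) tps)"
  then have "i < length tps" by simp
  moreover from this have "act (idle (view_of ws tps) ! i) (tps ! i) = map2 act (idle (view_of ws tps)) tps ! i"
    by (simp del: act_idle)
  ultimately show "map2 act ((idle (view_of ws tps))[j := a]) tps ! i = tps[j := act a (tps ! j)] ! i"
    using assms by (cases "i = j") simp_all
qed (use assms in simp)

lemma nth_counters: "r < K \<Longrightarrow> counters K tp s tp' ! Suc r = counter (s r)"
  by (simp add: counters_def nth_append)

lemma move_counter_counters:
  assumes "r < K"
  shows "map2 act (move_counter d r (view_of ws (counters K tp s tp'))) (counters K tp s tp') =
    counters K tp (s(r := move_head d (s r))) tp'"
proof -
  have "act (if s r = 0 then 1 else 0, d) (counter (s r)) = counter (move_head d (s r))"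
    by (auto simp: counter_def fun_eq_iff)
  then show ?thesis
    unfolding move_counter_def using assms
    by (simp add: act_update nth_counters nth_view_counter counters_upd)
qed

lemma cexecI:
  "(\<And>ws K tp tp'. h \<le> K \<Longrightarrow> exec ws p t (counters K tp s tp') (counters K tp s' tp')) \<Longrightarrow> cexec h p t s s'"
  unfolding cexec_def by blast

lemma cexecD:
  "cexec h p t s s' \<Longrightarrow> h \<le> K \<Longrightarrow> exec ws p t (counters K tp s tp') (counters K tp s' tp')"
  unfolding cexec_def by blast

lemma cexec_Inc: "r < h \<Longrightarrow> cexec h (Inc r) 1 s (s(r := Suc (s r)))"
  by (intro cexecI exec_Act) (simp add: move_counter_counters)

lemma cexec_Dec: "r < h \<Longrightarrow> cexec h (Dec r) 1 s (s(r := s r - 1))"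
  by (intro cexecI exec_Act) (simp add: move_counter_counters)

lemma cexec_Skip: "cexec h Skip t s s"
  unfolding cexec_def by (auto intro!: exec_Skip)

lemma cexec_mono: "cexec h p t s s' \<Longrightarrow> h \<le> h' \<Longrightarrow> t \<le> t' \<Longrightarrow> cexec h' p t' s s'"
  unfolding cexec_def by (meson exec_mono order.trans)

lemma cexec_Seq: "cexec h p t s s' \<Longrightarrow> cexec h q t' s' s'' \<Longrightarrow> cexec h (p ;; q) (t + t' + 1) s s''"
  unfolding cexec_def by (blast intro: exec_Seq)

lemma cexec_While:
  assumes "r < h" "\<And>j. j < N \<Longrightarrow> \<sigma> j r \<noteq> 0" "\<sigma> N r = 0"
    and "\<And>j. j < N \<Longrightarrow> cexec h p t (\<sigma> j) (\<sigma> (Suc j))"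
  shows "cexec h (While (nonzero r) p) (N * (t + 2) + 1) (\<sigma> 0) (\<sigma> N)"
proof (rule cexecI)
  fix ws K tp tp'
  assume "h \<le> K"
  then show "exec ws (While (nonzero r) p) (N * (t + 2) + 1) (counters K tp (\<sigma> 0) tp')
      (counters K tp (\<sigma> N) tp')"
    using assms by (intro exec_While[of N _ _ "\<lambda>j. counters K tp (\<sigma> j) tp'"]) (auto intro: cexecD)
qed

lemma cvalid_simps [simp]:
  "cvalid h Skip"
  "cvalid h (p ;; q) \<longleftrightarrow> cvalid h p \<and> cvalid h q"
  "cvalid h (While c p) \<longleftrightarrow> cvalid h p"
  by (auto simp: cvalid_def)

lemma cvalid_mono: "cvalid h p \<Longrightarrow> h \<le> h' \<Longrightarrow> cvalid h' p"
  by (auto simp: cvalid_def)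

lemma idle_update_valid:
  assumes "length ss = k" "set ss \<subseteq> {..<3}" "a < 3"
  shows "length ((idle (rs, ss))[j := (a, d)]) = k \<and> fst ` set ((idle (rs, ss))[j := (a, d)]) \<subseteq> {..<3}"
proof -
  have "fst ` set ((idle (rs, ss))[j := (a, d)]) \<subseteq> fst ` insert (a, d) (set (idle (rs, ss)))"
    by (rule image_mono) (rule set_update_subset_insert)
  then show ?thesis using idle_valid[OF assms(1,2), of rs] assms(3) by fastforce
qed

lemma cvalid_move_counter [simp]:
  assumes "r < h"
  shows "cvalid h (Act (move_counter d r))"
  unfolding cvalid_def valid_prog.simps
proof (intro allI impI)
  fix K rs and ss :: "nat list"
  assume a: "h \<le> K" "length ss = K + 2 \<and> set ss \<subseteq> {..<3}"
  then have "ss ! (r + 1) \<in> set ss" using assms by (intro nth_mem) simp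
  then have "ss ! (r + 1) < 3" using a by blast
  then show "length (move_counter d r (rs, ss)) = K + 2 \<and>
      fst ` set (move_counter d r (rs, ss)) \<subseteq> {..<3}"
    unfolding move_counter_def using a by (intro idle_update_valid) auto
qed

section \<open>Counter macros\<close>

definition transfer :: "nat \<Rightarrow> nat \<Rightarrow> prog" where
  "transfer r r' = While (nonzero r) (Dec r ;; Inc r')"

definition clear :: "nat \<Rightarrow> prog" where
  "clear r = While (nonzero r) (Dec r)"

text \<open>Reading out a counter destroys it. So its value is moved to \<open>r'\<close> and
  \<open>z\<close> simultaneously and then brought back from \<open>z\<close>.\<close>

definition copy :: "nat \<Rightarrow> nat \<Rightarrow> nat \<Rightarrow> prog" where
  "copy r r' z = While (nonzero r) (Dec r ;; Inc r' ;; Inc z) ;; transfer z r"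

lemma cexec_transfer:
  assumes "r < h" "r' < h" "r \<noteq> r'" "s r \<le> N"
  shows "cexec h (transfer r r') (5 * N + 1) s (s(r := 0, r' := s r' + s r))"
proof -
  define \<sigma> where "\<sigma> j = s(r := s r - j, r' := s r' + j)" for j
  have "cexec h (transfer r r') (s r * (3 + 2) + 1) (\<sigma> 0) (\<sigma> (s r))"
    unfolding transfer_def
  proof (rule cexec_While)
    fix j assume "j < s r"
    have "cexec h (Dec r ;; Inc r') (1 + 1 + 1) (\<sigma> j) ((\<sigma> j)(r := \<sigma> j r - 1, r' := Suc (((\<sigma> j)(r := \<sigma> j r - 1)) r')))"
      by (rule cexec_Seq[OF cexec_Dec cexec_Inc]) (use assms in auto)
    also have "(\<sigma> j)(r := \<sigma> j r - 1, r' := Suc (((\<sigma> j)(r := \<sigma> j r - 1)) r')) = \<sigma> (Suc j)"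
      using \<open>j < s r\<close> assms(3) by (auto simp: \<sigma>_def fun_eq_iff)
    finally show "cexec h (Dec r ;; Inc r') 3 (\<sigma> j) (\<sigma> (Suc j))" by (simp add: numeral_3_eq_3)
  qed (use assms in \<open>auto simp: \<sigma>_def\<close>)
  moreover have "\<sigma> 0 = s" "\<sigma> (s r) = s(r := 0, r' := s r' + s r)" by (auto simp: \<sigma>_def)
  ultimately show ?thesis using assms(4) by (auto intro: cexec_mono)
qed

lemma cexec_clear:
  assumes "r < h" "s r \<le> N"
  shows "cexec h (clear r) (3 * N + 1) s (s(r := 0))"
proof -
  define \<sigma> where "\<sigma> j = s(r := s r - j)" for j
  have "cexec h (clear r) (s r * (1 + 2) + 1) (\<sigma> 0) (\<sigma> (s r))"
    unfolding clear_def
  proof (rule cexec_While)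
    fix j assume "j < s r"
    have "cexec h (Dec r) 1 (\<sigma> j) ((\<sigma> j)(r := \<sigma> j r - 1))"
      by (rule cexec_Dec) (use assms in auto)
    also have "(\<sigma> j)(r := \<sigma> j r - 1) = \<sigma> (Suc j)"
      by (auto simp: \<sigma>_def fun_eq_iff)
    finally show "cexec h (Dec r) 1 (\<sigma> j) (\<sigma> (Suc j))" .
  qed (use assms in \<open>auto simp: \<sigma>_def\<close>)
  moreover have "\<sigma> 0 = s" "\<sigma> (s r) = s(r := 0)" by (auto simp: \<sigma>_def)
  ultimately show ?thesis using assms by (auto intro: cexec_mono)
qed

lemma cexec_copy:
  assumes "r < h" "r' < h" "z < h" "r \<noteq> r'" "r \<noteq> z" "z \<noteq> r'" "s z = 0" "s r \<le> N"
  shows "cexec h (copy r r' z) (12 * N + 3) s (s(r' := s r' + s r))"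
proof -
  define \<sigma> where "\<sigma> j = s(r := s r - j, r' := s r' + j, z := j)" for j
  have "cexec h (While (nonzero r) (Dec r ;; Inc r' ;; Inc z)) (s r * (5 + 2) + 1) (\<sigma> 0) (\<sigma> (s r))"
  proof (rule cexec_While)
    fix j assume "j < s r"
    define a where "a = (\<sigma> j)(r := \<sigma> j r - 1)"
    define b where "b = a(r' := Suc (a r'))"
    have "cexec h (Dec r ;; Inc r' ;; Inc z) (1 + (1 + 1 + 1) + 1) (\<sigma> j) (b(z := Suc (b z)))"
      unfolding b_def a_def by (rule cexec_Seq[OF cexec_Dec cexec_Seq[OF cexec_Inc cexec_Inc]]) (use assms in auto)
    also have "b(z := Suc (b z)) = \<sigma> (Suc j)"
      using \<open>j < s r\<close> assms by (auto simp: \<sigma>_def a_def b_def fun_eq_iff)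
    finally show "cexec h (Dec r ;; Inc r' ;; Inc z) 5 (\<sigma> j) (\<sigma> (Suc j))" by (simp add: eval_nat_numeral)
  qed (use assms in \<open>auto simp: \<sigma>_def\<close>)
  moreover have "cexec h (transfer z r) (5 * s r + 1) (\<sigma> (s r)) ((\<sigma> (s r))(z := 0, r := \<sigma> (s r) r + \<sigma> (s r) z))"
    by (rule cexec_transfer) (use assms in \<open>auto simp: \<sigma>_def\<close>)
  ultimately have "cexec h (copy r r' z) ((s r * (5 + 2) + 1) + (5 * s r + 1) + 1) (\<sigma> 0)
      ((\<sigma> (s r))(z := 0, r := \<sigma> (s r) r + \<sigma> (s r) z))"
    unfolding copy_def by (rule cexec_Seq)
  moreover have "\<sigma> 0 = s" "(\<sigma> (s r))(z := 0, r := \<sigma> (s r) r + \<sigma> (s r) z) = s(r' := s r' + s r)"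
    using assms by (auto simp: \<sigma>_def fun_eq_iff)
  ultimately show ?thesis using assms by (auto intro: cexec_mono)
qed

lemma cvalid_macros [simp]:
  "r < h \<Longrightarrow> r' < h \<Longrightarrow> cvalid h (transfer r r')"
  "r < h \<Longrightarrow> cvalid h (clear r)"
  "r < h \<Longrightarrow> r' < h \<Longrightarrow> z < h \<Longrightarrow> cvalid h (copy r r' z)"
  by (auto simp: transfer_def clear_def copy_def)

primrec seqs :: "(nat \<Rightarrow> prog) \<Rightarrow> nat \<Rightarrow> prog" where
  "seqs P 0 = Skip"
| "seqs P (Suc m) = seqs P m ;; P m"

lemma cexec_seqs:
  assumes "\<And>j. j < m \<Longrightarrow> cexec h (P j) t (\<sigma> j) (\<sigma> (Suc j))"
  shows "cexec h (seqs P m) (m * (t + 1)) (\<sigma> 0) (\<sigma> m)"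
  using assms
proof (induction m)
  case (Suc m)
  then have "cexec h (seqs P m ;; P m) (m * (t + 1) + t + 1) (\<sigma> 0) (\<sigma> (Suc m))"
    by (intro cexec_Seq) auto
  then show ?case by (simp add: algebra_simps)
qed (simp add: cexec_Skip)

lemma cvalid_seqs: "(\<And>j. j < m \<Longrightarrow> cvalid h (P j)) \<Longrightarrow> cvalid h (seqs P m)"
  by (induction m) auto

section \<open>Functions computable in quasipolynomial time\<close>

text \<open>Functions are applied to an assignment of numbers to variables.  Numbers are held in
  counters, so time is measured in terms of their values, not of their binary lengths.\<close>

type_synonym env = "nat \<Rightarrow> nat"

definition esum :: "nat \<Rightarrow> env \<Rightarrow> nat" where
  "esum k e = (\<Sum>i<k. e i)"

definition depends :: "nat \<Rightarrow> (env \<Rightarrow> nat) \<Rightarrow> bool" where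
  "depends k f \<longleftrightarrow> (\<forall>e e'. (\<forall>i<k. e i = e' i) \<longrightarrow> f e = f e')"

text \<open>Variable \<open>i\<close> resides in counter \<open>\<rho> i\<close>; the counters from \<open>b\<close> on
  are free for scratch work.\<close>

definition computes :: "nat \<Rightarrow> (nat \<Rightarrow> nat) \<Rightarrow> (env \<Rightarrow> nat) \<Rightarrow> (nat \<Rightarrow> nat) \<Rightarrow> nat \<Rightarrow> bool" where
  "computes k t f \<rho> b \<longleftrightarrow> (\<exists>p h. cvalid h p \<and>
     (\<forall>s. (\<forall>r\<ge>b. s r = 0) \<longrightarrow> cexec h p (t (esum k (s \<circ> \<rho>))) s (s(b := f (s \<circ> \<rho>)))))"

text \<open>The placement \<open>\<rho>\<close> and the first free counter \<open>b\<close> are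
  arbitrary, so that a function can be called as a subprogram anywhere. A single \<open>C\<close>
  bounds both values and running time, so merging several functions only requires maxima.\<close>

definition realizable :: "nat \<Rightarrow> nat \<Rightarrow> (env \<Rightarrow> nat) \<Rightarrow> bool" where
  "realizable k C f \<longleftrightarrow> depends k f \<and> (\<forall>e. f e \<le> quasi C (esum k e)) \<and>
     (\<forall>\<rho> b. (\<forall>i<k. \<rho> i < b) \<longrightarrow> computes k (quasi C) f \<rho> b)"

definition qcomp :: "(env \<Rightarrow> nat) \<Rightarrow> bool" where
  "qcomp f \<longleftrightarrow> (\<exists>k C. realizable k C f)"

lemma esum_mono: "k \<le> k' \<Longrightarrow> esum k e \<le> esum k' e"
  unfolding esum_def by (rule sum_mono2) auto

lemma esum_cong: "(\<And>i. i < k \<Longrightarrow> e i = e' i) \<Longrightarrow> esum k e = esum k e'"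
  unfolding esum_def by (rule sum.cong) auto

lemma dependsD: "depends k f \<Longrightarrow> (\<And>i. i < k \<Longrightarrow> e i = e' i) \<Longrightarrow> f e = f e'"
  unfolding depends_def by blast

lemma computesI:
  assumes "cvalid h p"
    and "\<And>s. (\<And>r. r \<ge> b \<Longrightarrow> s r = 0) \<Longrightarrow> cexec h p (t (esum k (s \<circ> \<rho>))) s (s(b := f (s \<circ> \<rho>)))"
  shows "computes k t f \<rho> b"
  unfolding computes_def using assms by blast

lemma computes_mono:
  assumes "computes k t f \<rho> b" "\<And>x y. x \<le> y \<Longrightarrow> t x \<le> t' y" "k \<le> k'"
  shows "computes k' t' f \<rho> b"
proof -
  obtain p h where p: "cvalid h p"
    "\<And>s. (\<forall>r\<ge>b. s r = 0) \<Longrightarrow> cexec h p (t (esum k (s \<circ> \<rho>))) s (s(b := f (s \<circ> \<rho>)))"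
    using assms(1) unfolding computes_def by blast
  show ?thesis
  proof (rule computesI[OF p(1)])
    fix s :: "nat \<Rightarrow> nat"
    assume "\<And>r. r \<ge> b \<Longrightarrow> s r = 0"
    then have "cexec h p (t (esum k (s \<circ> \<rho>))) s (s(b := f (s \<circ> \<rho>)))" using p(2) by simp
    then show "cexec h p (t' (esum k' (s \<circ> \<rho>))) s (s(b := f (s \<circ> \<rho>)))"
      by (rule cexec_mono[OF _ order_refl assms(2)[OF esum_mono[OF assms(3)]]])
  qed
qed

lemma realizable_cong: "realizable k C f \<Longrightarrow> (\<And>i. i < k \<Longrightarrow> e i = e' i) \<Longrightarrow> f e = f e'"
  unfolding realizable_def using dependsD by blast

lemma realizable_mono:
  assumes "realizable k C f" "k \<le> k'" "C \<le> C'"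
  shows "realizable k' C' f"
  unfolding realizable_def
proof (intro conjI allI impI)
  have r: "depends k f" "\<And>e. f e \<le> quasi C (esum k e)"
    "\<And>\<rho> b. (\<forall>i<k. \<rho> i < b) \<Longrightarrow> computes k (quasi C) f \<rho> b"
    using assms(1) unfolding realizable_def by blast+
  show "depends k' f" using r(1) assms(2) unfolding depends_def by auto
  show "f e \<le> quasi C' (esum k' e)" for e
    using r(2)[of e] quasi_mono[OF assms(3) esum_mono[OF assms(2)], of e] by (rule order.trans)
  show "computes k' (quasi C') f \<rho> b" if "\<forall>i<k'. \<rho> i < b" for \<rho> b
  proof (rule computes_mono[OF r(3)])
    show "\<forall>i<k. \<rho> i < b" using that assms(2) by simp
  qed (use assms in \<open>auto intro: quasi_mono\<close>)
qed

lemma qcompI: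
  assumes "qbounded t" "depends k f" "\<And>e. f e \<le> t (esum k e)"
    and "\<And>\<rho> b. (\<And>i. i < k \<Longrightarrow> \<rho> i < b) \<Longrightarrow> computes k t f \<rho> b"
  shows "qcomp f"
proof -
  obtain C where C: "\<And>x. t x \<le> quasi C x" using assms(1) unfolding qbounded_def by blast
  have "realizable k C f"
    unfolding realizable_def
  proof (intro conjI allI impI)
    show "f e \<le> quasi C (esum k e)" for e by (rule order.trans[OF assms(3) C])
    show "computes k (quasi C) f \<rho> b" if "\<forall>i<k. \<rho> i < b" for \<rho> b
    proof (rule computes_mono[OF assms(4)])
      show "t x \<le> quasi C y" if "x \<le> y" for x y
        by (rule order.trans[OF C quasi_mono[OF order_refl that]])
    qed (use that in auto)
  qed (rule assms(2))
  then show ?thesis unfolding qcomp_def by blast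
qed

lemma common_realizable:
  fixes m :: nat
  assumes "\<And>i. i < m \<Longrightarrow> qcomp (g i)"
  shows "\<exists>k C. \<forall>i<m. realizable k C (g i)"
  using assms
proof (induction m)
  case (Suc m)
  then obtain k C where 1: "\<forall>i<m. realizable k C (g i)" by auto
  from Suc.prems[of m] obtain k' C' where "realizable k' C' (g m)"
    unfolding qcomp_def by blast
  with 1 have "\<forall>i<Suc m. realizable (max k k') (max C C') (g i)"
    by (auto simp: less_Suc_eq intro: realizable_mono)
  then show ?case by blast
qed auto

section \<open>Closure under composition and simultaneous recursion\<close>

lemma qcomp_var: "qcomp (\<lambda>e. e i)"
proof (rule qcompI[of "\<lambda>x. 12 * x + 3" "Suc i"])
  show "qbounded (\<lambda>x. 12 * x + 3)" by (intro qbounded_const qbounded_id qbounded_add qbounded_mult)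
  show "depends (Suc i) (\<lambda>e. e i)" by (auto simp: depends_def)
  have le: "e i \<le> esum (Suc i) e" for e :: env unfolding esum_def by simp
  then show "e i \<le> 12 * esum (Suc i) e + 3" for e using le[of e] by linarith
  fix \<rho> :: "nat \<Rightarrow> nat" and b :: nat assume \<rho>: "\<And>j. j < Suc i \<Longrightarrow> \<rho> j < b"
  show "computes (Suc i) (\<lambda>x. 12 * x + 3) (\<lambda>e. e i) \<rho> b"
  proof (rule computesI[of "b + 2" "copy (\<rho> i) b (b + 1)"])
    fix s :: "nat \<Rightarrow> nat" assume "\<And>r. b \<le> r \<Longrightarrow> s r = 0"
    then show "cexec (b + 2) (copy (\<rho> i) b (b + 1)) (12 * esum (Suc i) (s \<circ> \<rho>) + 3) s (s(b := (s \<circ> \<rho>) i))"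
      using cexec_copy[of "\<rho> i" "b + 2" b "b + 1" s "esum (Suc i) (s \<circ> \<rho>)"] le[of "s \<circ> \<rho>"] \<rho>[of i]
      by (auto simp: fun_upd_def)
  qed (use \<rho>[of i] in auto)
qed

lemma qcomp_zero: "qcomp (\<lambda>_. 0)"
proof (rule qcompI[of "\<lambda>_. 0" 0])
  fix \<rho> :: "nat \<Rightarrow> nat" and b :: nat
  show "computes 0 (\<lambda>_. 0) (\<lambda>_. 0) \<rho> b"
    by (rule computesI[of 0 Skip]) (auto simp: fun_upd_idem intro: cexec_Skip)
qed (auto simp: depends_def intro: qbounded_const)

lemma qcomp_Suc:
  assumes "qcomp f"
  shows "qcomp (\<lambda>e. Suc (f e))"
proof -
  obtain k C where f: "realizable k C f" using assms unfolding qcomp_def by blast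
  show ?thesis
  proof (rule qcompI[of "\<lambda>x. quasi C x + 2" k])
    show "qbounded (\<lambda>x. quasi C x + 2)" by (intro qbounded_const qbounded_id qbounded_add qbounded_mult qbounded_quasi)
    have "depends k f" using f unfolding realizable_def by blast
    then show "depends k (\<lambda>e. Suc (f e))" unfolding depends_def by simp
    show "Suc (f e) \<le> quasi C (esum k e) + 2" for e
      using f unfolding realizable_def by (simp add: le_SucI)
    fix \<rho> :: "nat \<Rightarrow> nat" and b :: nat assume "\<And>i. i < k \<Longrightarrow> \<rho> i < b"
    then obtain p h where p: "cvalid h p"
      "\<And>s. (\<forall>r\<ge>b. s r = 0) \<Longrightarrow> cexec h p (quasi C (esum k (s \<circ> \<rho>))) s (s(b := f (s \<circ> \<rho>)))"
      using f unfolding realizable_def computes_def by (metis (no_types, lifting))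
    show "computes k (\<lambda>x. quasi C x + 2) (\<lambda>e. Suc (f e)) \<rho> b"
    proof (rule computesI[of "max h (Suc b)" "p ;; Inc b"])
      fix s :: "nat \<Rightarrow> nat" assume "\<And>r. b \<le> r \<Longrightarrow> s r = 0"
      then have "cexec (max h (Suc b)) p (quasi C (esum k (s \<circ> \<rho>))) s (s(b := f (s \<circ> \<rho>)))"
        using cexec_mono[OF p(2)] by simp
      from cexec_Seq[OF this cexec_Inc[of b]]
      show "cexec (max h (Suc b)) (p ;; Inc b) (quasi C (esum k (s \<circ> \<rho>)) + 2) s (s(b := Suc (f (s \<circ> \<rho>))))"
        by simp
    qed (use p(1) in \<open>auto intro: cvalid_mono\<close>)
  qed
qed

definition store :: "nat \<Rightarrow> nat \<Rightarrow> (nat \<Rightarrow> nat) \<Rightarrow> (nat \<Rightarrow> nat) \<Rightarrow> nat \<Rightarrow> nat" where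
  "store b m v s = (\<lambda>r. if b \<le> r \<and> r < b + m then v (r - b) else s r)"

lemma store_0 [simp]: "store b 0 v s = s"
  by (auto simp: store_def)

lemma store_Suc: "store b (Suc m) v s = (store b m v s)(b + m := v m)"
  by (auto simp: store_def fun_eq_iff)

lemma store_cong: "(\<And>i. i < m \<Longrightarrow> v i = v' i) \<Longrightarrow> store b m v s = store b m v' s"
  by (auto simp: store_def fun_eq_iff)

text \<open>The j-th value goes to counter \<open>b + j\<close>. Earlier results do not disturb
  later ones, because all variables lie below \<open>b\<close> and scratch work happens above the
  results.\<close>

lemma compute_vector:
  assumes "\<And>j. j < m \<Longrightarrow> realizable k C (g j)" "\<And>i. i < k \<Longrightarrow> \<rho> i < b"
  shows "\<exists>p h. cvalid h p \<and> (\<forall>s. (\<forall>r\<ge>b. s r = 0) \<longrightarrow>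
     cexec h p (m * (quasi C (esum k (s \<circ> \<rho>)) + 1)) s (store b m (\<lambda>j. g j (s \<circ> \<rho>)) s))"
  using assms(1)
proof (induction m)
  case 0
  show ?case by (rule exI[of _ Skip], rule exI[of _ 0]) (auto intro: cexec_Skip)
next
  case (Suc m)
  then obtain p h where p: "cvalid h p" "\<And>s. (\<forall>r\<ge>b. s r = 0) \<Longrightarrow>
     cexec h p (m * (quasi C (esum k (s \<circ> \<rho>)) + 1)) s (store b m (\<lambda>j. g j (s \<circ> \<rho>)) s)"
    by (metis less_Suc_eq)
  have gm: "realizable k C (g m)" using Suc.prems by simp
  moreover have "\<forall>i<k. \<rho> i < b + m" using assms(2) by (simp add: trans_less_add1)
  ultimately obtain q h' where q: "cvalid h' q" "\<And>s. (\<forall>r\<ge>b+m. s r = 0) \<Longrightarrow>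
      cexec h' q (quasi C (esum k (s \<circ> \<rho>))) s (s(b + m := g m (s \<circ> \<rho>)))"
    unfolding realizable_def computes_def by meson
  show ?case
  proof (intro exI[of _ "p ;; q"] exI[of _ "max h h'"] conjI allI impI)
    show "cvalid (max h h') (p ;; q)" using p(1) q(1) by (auto intro: cvalid_mono)
    fix s :: "nat \<Rightarrow> nat" assume s: "\<forall>r\<ge>b. s r = 0"
    define s1 where "s1 = store b m (\<lambda>j. g j (s \<circ> \<rho>)) s"
    have agree: "(s1 \<circ> \<rho>) i = (s \<circ> \<rho>) i" if "i < k" for i
      using assms(2)[OF that] by (simp add: s1_def store_def)
    have e: "esum k (s1 \<circ> \<rho>) = esum k (s \<circ> \<rho>)" "g m (s1 \<circ> \<rho>) = g m (s \<circ> \<rho>)"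
      by (rule esum_cong, erule agree, rule realizable_cong[OF gm], erule agree)
    have 1: "cexec (max h h') p (m * (quasi C (esum k (s \<circ> \<rho>)) + 1)) s s1"
      using p(2)[OF s] unfolding s1_def by (rule cexec_mono) auto
    have "\<forall>r\<ge>b+m. s1 r = 0" using s by (simp add: s1_def store_def)
    from q(2)[OF this] have 2: "cexec (max h h') q (quasi C (esum k (s \<circ> \<rho>))) s1 (s1(b + m := g m (s \<circ> \<rho>)))"
      unfolding e by (rule cexec_mono) auto
    from cexec_Seq[OF 1 2]
    show "cexec (max h h') (p ;; q) (Suc m * (quasi C (esum k (s \<circ> \<rho>)) + 1)) s
            (store b (Suc m) (\<lambda>j. g j (s \<circ> \<rho>)) s)"
      unfolding s1_def store_Suc by (simp add: algebra_simps)
  qed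
qed

lemma cexec_clears:
  assumes "b + m \<le> h" "\<And>r. b \<le> r \<Longrightarrow> r < b + m \<Longrightarrow> s r \<le> N"
  shows "cexec h (seqs (\<lambda>j. clear (b + j)) m) (m * (3 * N + 2)) s (store b m (\<lambda>_. 0) s)"
proof -
  have "cexec h (seqs (\<lambda>j. clear (b + j)) m) (m * (3 * N + 1 + 1)) (store b 0 (\<lambda>_. 0) s) (store b m (\<lambda>_. 0) s)"
  proof (rule cexec_seqs)
    fix j assume j: "j < m"
    show "cexec h (clear (b + j)) (3 * N + 1) (store b j (\<lambda>_. 0) s) (store b (Suc j) (\<lambda>_. 0) s)"
      unfolding store_Suc by (rule cexec_clear) (use j assms in \<open>auto simp: store_def\<close>)
  qed
  then show ?thesis by simp
qed

lemma esum_le: "(\<And>i. i < k \<Longrightarrow> e i \<le> N) \<Longrightarrow> esum k e \<le> k * N"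
  unfolding esum_def using sum_bounded_above[of "{..<k}" e N] by simp

text \<open>The arguments are computed into the counters from \<open>b\<close> on, where
  \<open>f\<close> takes them as its variables and puts its value at \<open>b + m\<close>. Then the
  arguments are cleared and the value is moved down to \<open>b\<close>.\<close>

lemma qcomp_comp:
  assumes "qcomp f" "\<And>i. qcomp (g i)"
  shows "qcomp (\<lambda>e. f (\<lambda>i. g i e))"
proof -
  obtain m0 D where "realizable m0 D f" using assms(1) unfolding qcomp_def by blast
  \<comment> \<open>A positive \<open>m\<close> keeps \<open>b + m\<close> different from
    \<open>b\<close>, as the final \<open>transfer\<close> requires.\<close>
  define m where "m = Suc m0"
  have f: "realizable m D f" unfolding m_def by (rule realizable_mono[OF \<open>realizable m0 D f\<close>]) auto
  obtain k C where g: "\<And>i. i < m \<Longrightarrow> realizable k C (g i)"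
    using common_realizable[of m g] assms(2) by blast
  have gle: "g i e \<le> quasi C (esum k e)" if "i < m" for i e
    using g[OF that] unfolding realizable_def by blast
  have fle: "f e \<le> quasi D (esum m e)" for e using f unfolding realizable_def by blast
  have fgle: "f (\<lambda>i. g i e) \<le> quasi D (m * quasi C (esum k e))" for e
    by (rule order.trans[OF fle quasi_mono[OF order_refl esum_le]]) (rule gle)
  define t where "t x = m * (quasi C x + 1) + quasi D (m * quasi C x) + m * (3 * quasi C x + 2)
    + (5 * quasi D (m * quasi C x) + 1) + 3" for x
  show ?thesis
  proof (rule qcompI[of t k])
    show "qbounded t" unfolding t_def
      by (intro qbounded_add qbounded_mult qbounded_const qbounded_quasi qbounded_comp[OF qbounded_quasi[of D]])
    show "depends k (\<lambda>e. f (\<lambda>i. g i e))"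
      unfolding depends_def
    proof (intro allI impI)
      fix e e' :: env assume "\<forall>i<k. e i = e' i"
      then have "g i e = g i e'" if "i < m" for i
        by (intro realizable_cong[OF g[OF that]]) simp
      then show "f (\<lambda>i. g i e) = f (\<lambda>i. g i e')"
        by (rule realizable_cong[OF f])
    qed
    show "f (\<lambda>i. g i e) \<le> t (esum k e)" for e
      using fgle[of e] unfolding t_def by linarith
    fix \<rho> :: "nat \<Rightarrow> nat" and b :: nat assume \<rho>: "\<And>i. i < k \<Longrightarrow> \<rho> i < b"
    obtain p h where p: "cvalid h p" "\<And>s. (\<forall>r\<ge>b. s r = 0) \<Longrightarrow>
       cexec h p (m * (quasi C (esum k (s \<circ> \<rho>)) + 1)) s (store b m (\<lambda>j. g j (s \<circ> \<rho>)) s)"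
      using compute_vector[of m k C g \<rho> b, OF g \<rho>] by metis
    have "\<forall>i<m. (\<lambda>i. b + i) i < b + m" by simp
    then have "computes m (quasi D) f (\<lambda>i. b + i) (b + m)"
      using f unfolding realizable_def by blast
    then obtain q h' where q: "cvalid h' q" "\<And>s. (\<forall>r\<ge>b+m. s r = 0) \<Longrightarrow>
       cexec h' q (quasi D (esum m (s \<circ> (\<lambda>i. b + i)))) s (s(b + m := f (s \<circ> (\<lambda>i. b + i))))"
      unfolding computes_def by blast
    define h0 where "h0 = max h h' + (b + m + 1)"
    show "computes k t (\<lambda>e. f (\<lambda>i. g i e)) \<rho> b"
    proof (rule computesI[of h0 "p ;; q ;; seqs (\<lambda>j. clear (b + j)) m ;; transfer (b + m) b"])
      show "cvalid h0 (p ;; q ;; seqs (\<lambda>j. clear (b + j)) m ;; transfer (b + m) b)"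
        using p(1) q(1) by (auto simp: h0_def m_def intro: cvalid_mono intro!: cvalid_seqs)
      fix s :: "nat \<Rightarrow> nat" assume s: "\<And>r. b \<le> r \<Longrightarrow> s r = 0"
      define X where "X = esum k (s \<circ> \<rho>)"
      define v where "v = f (\<lambda>i. g i (s \<circ> \<rho>))"
      define s1 where "s1 = store b m (\<lambda>j. g j (s \<circ> \<rho>)) s"
      define s2 where "s2 = s1(b + m := v)"
      have 1: "cexec h0 p (m * (quasi C X + 1)) s s1"
        unfolding s1_def X_def by (rule cexec_mono[OF p(2)]) (use s in \<open>auto simp: h0_def\<close>)
      have a: "(s1 \<circ> (\<lambda>i. b + i)) i = g i (s \<circ> \<rho>)" if "i < m" for i
        using that by (simp add: s1_def store_def)
      have fv: "f (s1 \<circ> (\<lambda>i. b + i)) = v"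
        unfolding v_def by (rule realizable_cong[OF f]) (erule a)
      have "esum m (s1 \<circ> (\<lambda>i. b + i)) \<le> m * quasi C X"
        using a gle[of _ "s \<circ> \<rho>"] unfolding X_def by (intro esum_le) simp
      then have le: "quasi D (esum m (s1 \<circ> (\<lambda>i. b + i))) \<le> quasi D (m * quasi C X)"
        by (rule quasi_mono[OF order_refl])
      have 2: "cexec h0 q (quasi D (m * quasi C X)) s1 s2"
        unfolding s2_def fv[symmetric]
        by (rule cexec_mono[OF q(2) _ le]) (use s in \<open>auto simp: h0_def s1_def store_def\<close>)
      have 3: "cexec h0 (seqs (\<lambda>j. clear (b + j)) m) (m * (3 * quasi C X + 2)) s2 (store b m (\<lambda>_. 0) s2)"
      proof (rule cexec_clears)
        fix r assume "b \<le> r" "r < b + m"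
        then show "s2 r \<le> quasi C X"
          using gle[of "r - b" "s \<circ> \<rho>"] by (simp add: s2_def s1_def store_def X_def)
      qed (simp add: h0_def)
      have eq: "store b m (\<lambda>_. 0) s2 = s(b + m := v)"
        using s by (auto simp: store_def s2_def s1_def fun_eq_iff)
      have 4: "cexec h0 (transfer (b + m) b) (5 * quasi D (m * quasi C X) + 1) (s(b + m := v))
          ((s(b + m := v))(b + m := 0, b := (s(b + m := v)) b + (s(b + m := v)) (b + m)))"
        by (rule cexec_transfer) (use fgle[of "s \<circ> \<rho>"] in \<open>auto simp: h0_def m_def v_def X_def\<close>)
      have eq2: "(s(b + m := v))(b + m := 0, b := (s(b + m := v)) b + (s(b + m := v)) (b + m)) = s(b := v)"
        using s by (auto simp: fun_eq_iff m_def)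
      show "cexec h0 (p ;; q ;; seqs (\<lambda>j. clear (b + j)) m ;; transfer (b + m) b)
          (t (esum k (s \<circ> \<rho>))) s (s(b := f (\<lambda>i. g i (s \<circ> \<rho>))))"
        using cexec_Seq[OF 1 cexec_Seq[OF 2 cexec_Seq[OF 3[unfolded eq] 4[unfolded eq2]]]]
        unfolding t_def X_def[symmetric] v_def[symmetric] by (rule cexec_mono) auto
    qed
  qed
qed

text \<open>Calling convention for the step functions of a recursion: the index comes first, then
  the old values, then the parameters.\<close>

definition pack :: "nat \<Rightarrow> env \<Rightarrow> nat \<Rightarrow> (nat \<Rightarrow> nat) \<Rightarrow> env" where
  "pack m e x v = (\<lambda>j. if j = 0 then x else if j \<le> m then v (j - 1) else e (j - m - 1))"

lemma esum_pack: "esum (k + m + 1) (pack m e x v) = x + esum m v + esum k e"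
proof -
  have "esum (m + 1) (pack m e x v) = x + esum m v"
    unfolding esum_def pack_def by (simp add: sum.lessThan_Suc_shift del: sum.lessThan_Suc)
  moreover have "esum (m + 1 + k) (pack m e x v) = esum (m + 1) (pack m e x v) + esum k e" for k
    by (induction k) (auto simp: esum_def pack_def)
  ultimately show ?thesis by (metis add.assoc add.commute)
qed

text \<open>Several values are computed simultaneously because state, tapes and heads of a simulated
  machine advance together. All intermediate values must obey the bound \<open>H\<close>, since
  iteration alone can leave the quasipolynomial range. Every \<open>G i\<close> needs all old
  values, so the new ones are first collected in a second block of counters.\<close>

lemma qcomp_vector_rec:
  assumes a: "qcomp a" and z: "\<And>i. i < m \<Longrightarrow> qcomp (z i)" and G: "\<And>i. i < m \<Longrightarrow> qcomp (G i)"
    and R0: "\<And>e i. i < m \<Longrightarrow> R e 0 i = z i e"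
    and RS: "\<And>e x i. i < m \<Longrightarrow> x < a e \<Longrightarrow> R e (Suc x) i = G i (pack m e x (R e x))"
    and H: "qbounded H" "\<And>e x i. i < m \<Longrightarrow> x \<le> a e \<Longrightarrow> R e x i \<le> H (esum kH e)"
    and i0: "i0 < m"
  shows "qcomp (\<lambda>e. R e (a e) i0)"
proof -
  obtain k1 C1 where 1: "realizable k1 C1 a" using a unfolding qcomp_def by blast
  obtain k2 C2 where 2: "\<And>i. i < m \<Longrightarrow> realizable k2 C2 (z i)"
    using common_realizable[of m z] z by blast
  obtain k3 C3 where 3: "\<And>i. i < m \<Longrightarrow> realizable k3 C3 (G i)"
    using common_realizable[of m G] G by blast
  define k where "k = k1 + k2 + k3 + kH"
  define C where "C = C1 + C2 + C3"
  have ra: "realizable k C a" by (rule realizable_mono[OF 1]) (auto simp: k_def C_def)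
  have rz: "realizable k C (z i)" if "i < m" for i
    by (rule realizable_mono[OF 2[OF that]]) (auto simp: k_def C_def)
  have rG: "realizable (k + m + 1) C (G i)" if "i < m" for i
    by (rule realizable_mono[OF 3[OF that]]) (auto simp: k_def C_def)
  obtain CH where CH: "\<And>x. H x \<le> quasi CH x" using H(1) unfolding qbounded_def by blast
  define B where "B = quasi CH"
  have RB: "R e x i \<le> B (esum k e)" if "i < m" "x \<le> a e" for e x i
  proof -
    have "H (esum kH e) \<le> B (esum k e)"
      unfolding B_def by (rule order.trans[OF CH]) (intro quasi_mono esum_mono; simp add: k_def)
    then show ?thesis using H(2)[OF that] by (rule order.trans[rotated])
  qed
  have ale: "a e \<le> quasi C (esum k e)" for e using ra unfolding realizable_def by blast
  have dep: "R e x i = R e' x i" if "\<And>j. j < k \<Longrightarrow> e j = e' j" "i < m" "x \<le> a e" for e e' x i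
    using that(2,3)
  proof (induction x arbitrary: i)
    case 0
    have "z i e = z i e'" by (rule realizable_cong[OF rz[OF 0(1)]]) (erule that(1))
    then show ?case using 0 by (simp add: R0)
  next
    case (Suc x)
    have ae: "a e = a e'" by (rule realizable_cong[OF ra]) (erule that(1))
    have "pack m e x (R e x) j = pack m e' x (R e' x) j" if "j < k + m + 1" for j
      using that Suc \<open>\<And>j. j < k \<Longrightarrow> e j = e' j\<close> by (auto simp: pack_def)
    then have "G i (pack m e x (R e x)) = G i (pack m e' x (R e' x))"
      by (rule realizable_cong[OF rG[OF Suc.prems(1)]])
    then show ?case using Suc.prems ae by (simp add: RS)
  qed
  \<comment> \<open>\<open>Y\<close> bounds the sum of the arguments passed to the step functions,
    \<open>tb\<close> the time of one round and \<open>t\<close> the whole time.\<close>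
  define Y where "Y x = quasi C x + m * B x + x" for x
  define tb where "tb x = 1 + m * (quasi C (Y x) + 1) + m * (8 * B x + 4) + 1 + 3" for x
  define t where "t x = quasi C x + m * (quasi C x + 1) + (quasi C x * (tb x + 2) + 1)
     + (3 * quasi C x + 1) + (5 * B x + 1) + m * (3 * B x + 2) + 5" for x
  show ?thesis
  proof (rule qcompI[of t k])
    show "qbounded t" unfolding t_def tb_def Y_def B_def
      by (intro qbounded_add qbounded_mult qbounded_const qbounded_quasi qbounded_id
          qbounded_comp[OF qbounded_quasi[of C]])
    show "depends k (\<lambda>e. R e (a e) i0)"
      unfolding depends_def
    proof (intro allI impI)
      fix e e' :: env assume e: "\<forall>i<k. e i = e' i"
      then have "a e = a e'" by (intro realizable_cong[OF ra]) simp
      then show "R e (a e) i0 = R e' (a e') i0" using dep[of e e' i0 "a e"] e i0 by simp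
    qed
    show "R e (a e) i0 \<le> t (esum k e)" for e
      using RB[OF i0, of "a e" e] unfolding t_def by simp
    fix \<rho> :: "nat \<Rightarrow> nat" and b :: nat assume \<rho>: "\<And>i. i < k \<Longrightarrow> \<rho> i < b"
    have "computes k (quasi C) a \<rho> b" using ra \<rho> unfolding realizable_def by blast
    then obtain pa ha where pa: "cvalid ha pa" "\<And>s. (\<forall>r\<ge>b. s r = 0) \<Longrightarrow>
       cexec ha pa (quasi C (esum k (s \<circ> \<rho>))) s (s(b := a (s \<circ> \<rho>)))"
      unfolding computes_def by blast
    have "\<And>i. i < k \<Longrightarrow> \<rho> i < b + 2" using \<rho> trans_less_add1 by blast
    from compute_vector[of m k C z \<rho> "b + 2", OF rz this]
    obtain pz hz where pz: "cvalid hz pz" "\<And>s. (\<forall>r\<ge>b+2. s r = 0) \<Longrightarrow>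
       cexec hz pz (m * (quasi C (esum k (s \<circ> \<rho>)) + 1)) s (store (b + 2) m (\<lambda>j. z j (s \<circ> \<rho>)) s)"
      by metis
    \<comment> \<open>The step functions find everything in place: the index in
      \<open>b + 1\<close>, the old values from \<open>b + 2\<close> on, the parameters in their
      original counters.\<close>
    define \<rho>' where "\<rho>' = pack m \<rho> (b + 1) (\<lambda>i. b + 2 + i)"
    have \<rho>b: "\<rho> i < Suc (Suc (b + m))" if "i < k" for i
      using \<rho>[OF that] by simp
    have "\<And>i. i < k + m + 1 \<Longrightarrow> \<rho>' i < b + 2 + m"
      using \<rho>b by (auto simp: \<rho>'_def pack_def)
    from compute_vector[of m "k + m + 1" C G \<rho>' "b + 2 + m", OF rG this]
    obtain pG hG where pG: "cvalid hG pG" "\<And>s. (\<forall>r\<ge>b+2+m. s r = 0) \<Longrightarrow>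
       cexec hG pG (m * (quasi C (esum (k + m + 1) (s \<circ> \<rho>')) + 1)) s (store (b + 2 + m) m (\<lambda>j. G j (s \<circ> \<rho>')) s)"
      by metis
    define pm where "pm = (\<lambda>i. clear (b + 2 + i) ;; transfer (b + 2 + m + i) (b + 2 + i))"
    define body where "body = Dec b ;; pG ;; seqs pm m ;; Inc (b + 1)"
    define prg where "prg = pa ;; pz ;; While (nonzero b) body ;; clear (b + 1) ;;
      transfer (b + 2 + i0) b ;; seqs (\<lambda>j. clear (b + 2 + j)) m"
    define h where "h = ha + hz + hG + b + 2 + m + m"
    show "computes k t (\<lambda>e. R e (a e) i0) \<rho> b"
    proof (rule computesI[of h prg])
      have "cvalid h pa" "cvalid h pz" "cvalid h pG"
        using pa(1) pz(1) pG(1) by (auto simp: h_def intro: cvalid_mono)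
      moreover have "cvalid h (pm i)" if "i < m" for i
        using that unfolding pm_def by (simp add: h_def)
      ultimately show "cvalid h prg"
        using i0 by (auto simp: prg_def body_def intro!: cvalid_seqs) (auto simp: h_def)
      fix s :: "nat \<Rightarrow> nat" assume s: "\<And>r. b \<le> r \<Longrightarrow> s r = 0"
      define E where "E = s \<circ> \<rho>"
      define X where "X = esum k E"
      define A where "A = a E"
      have AX: "A \<le> quasi C X" unfolding A_def X_def by (rule ale)
      \<comment> \<open>State after \<open>x\<close> rounds: counter \<open>b\<close> holds the
        number of rounds left, \<open>b + 1\<close> the index, and the block from
        \<open>b + 2\<close> on the current values.\<close>
      define \<sigma> where "\<sigma> x = store (b + 2) m (R E x) (s(b := A - x, b + 1 := x))" for x
      have 1: "cexec h pa (quasi C X) s (s(b := A))"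
        unfolding A_def X_def E_def by (rule cexec_mono[OF pa(2)]) (use s in \<open>auto simp: h_def\<close>)
      define sA where "sA = s(b := A)"
      have agree: "(sA \<circ> \<rho>) i = E i" if "i < k" for i
        using \<rho>[OF that] by (simp add: sA_def E_def)
      have e: "esum k (sA \<circ> \<rho>) = X" unfolding X_def by (rule esum_cong) (rule agree)
      have zE: "z i (sA \<circ> \<rho>) = R E 0 i" if "i < m" for i
        unfolding R0[OF that] by (rule realizable_cong[OF rz[OF that]]) (erule agree)
      have "store (b + 2) m (\<lambda>j. z j (sA \<circ> \<rho>)) sA = \<sigma> 0"
        unfolding \<sigma>_def using zE s[of "b + 1"] by (auto simp: store_def fun_eq_iff sA_def)
      then have 2: "cexec h pz (m * (quasi C X + 1)) sA (\<sigma> 0)"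
        using cexec_mono[OF pz(2)[of sA], of h] s unfolding e by (auto simp: h_def sA_def)
      have "cexec h (While (nonzero b) body) (A * (tb X + 2) + 1) (\<sigma> 0) (\<sigma> A)"
      proof (rule cexec_While)
        fix x assume x: "x < A"
        define s1 where "s1 = (\<sigma> x)(b := A - Suc x)"
        have B1: "cexec h (Dec b) 1 (\<sigma> x) s1"
          unfolding s1_def using cexec_Dec[of b h "\<sigma> x"] by (simp add: h_def \<sigma>_def store_def)
        have ag: "(s1 \<circ> \<rho>') j = pack m E x (R E x) j" if "j < k + m + 1" for j
        proof (cases "j \<le> m")
          case True
          then show ?thesis by (auto simp: s1_def \<sigma>_def \<rho>'_def pack_def store_def)
        next
          case False
          then have "\<rho> (j - m - 1) < b" using that by (intro \<rho>) simp
          with False show ?thesis by (simp add: s1_def \<sigma>_def \<rho>'_def pack_def store_def E_def)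
        qed
        have GR: "G i (s1 \<circ> \<rho>') = R E (Suc x) i" if "i < m" for i
        proof -
          have "G i (s1 \<circ> \<rho>') = G i (pack m E x (R E x))"
            by (rule realizable_cong[OF rG[OF that]]) (erule ag)
          then show ?thesis using RS[OF that, of x E] x unfolding A_def by simp
        qed
        have "esum (k + m + 1) (s1 \<circ> \<rho>') = x + esum m (R E x) + X"
          unfolding X_def esum_pack[symmetric] by (rule esum_cong) (rule ag)
        also have "\<dots> \<le> Y X"
        proof -
          have "esum m (R E x) \<le> m * B X"
            using RB[of _ x E] x unfolding X_def A_def by (intro esum_le) simp
          then show ?thesis using x AX unfolding Y_def by linarith
        qed
        finally have le: "quasi C (esum (k + m + 1) (s1 \<circ> \<rho>')) \<le> quasi C (Y X)"
          by (rule quasi_mono[OF order_refl])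
        define s2 where "s2 = store (b + 2 + m) m (R E (Suc x)) s1"
        have "store (b + 2 + m) m (\<lambda>j. G j (s1 \<circ> \<rho>')) s1 = s2"
          unfolding s2_def by (rule store_cong) (rule GR)
        moreover have "\<forall>r\<ge>b+2+m. s1 r = 0" using s by (simp add: s1_def \<sigma>_def store_def)
        ultimately have B2: "cexec h pG (m * (quasi C (Y X) + 1)) s1 s2"
          using cexec_mono[OF pG(2)[of s1], of h] le by (auto simp: h_def)
        \<comment> \<open>The first \<open>j\<close> new values have been moved over the old ones
          and their places in the second block are empty again.\<close>
        define \<tau> where "\<tau> j = store (b + 2 + m) j (\<lambda>_. 0) (store (b + 2) j (R E (Suc x)) s2)" for j
        have "cexec h (seqs pm m) (m * (8 * B X + 3 + 1)) (\<tau> 0) (\<tau> m)"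
        proof (rule cexec_seqs)
          fix j assume j: "j < m"
          let ?c = "b + 2 + j" and ?d = "b + 2 + m + j"
          have c: "\<tau> j ?c = R E x j" "\<tau> j ?d = R E (Suc x) j"
            using j by (auto simp: \<tau>_def s2_def s1_def \<sigma>_def store_def)
          have "R E x j \<le> B X" "R E (Suc x) j \<le> B X"
            using RB[OF j] x unfolding A_def X_def by auto
          with c j have "cexec h (clear ?c) (3 * B X + 1) (\<tau> j) ((\<tau> j)(?c := 0))"
            by (intro cexec_clear) (simp_all add: h_def)
          moreover have "cexec h (transfer ?d ?c) (5 * B X + 1) ((\<tau> j)(?c := 0))
              (((\<tau> j)(?c := 0))(?d := 0, ?c := ((\<tau> j)(?c := 0)) ?c + ((\<tau> j)(?c := 0)) ?d))"
            using \<open>R E (Suc x) j \<le> B X\<close> c j by (intro cexec_transfer) (simp_all add: h_def)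
          ultimately have "cexec h (pm j) (8 * B X + 3) (\<tau> j)
              (((\<tau> j)(?c := 0))(?d := 0, ?c := ((\<tau> j)(?c := 0)) ?c + ((\<tau> j)(?c := 0)) ?d))"
            unfolding pm_def by (rule cexec_mono[OF cexec_Seq]) auto
          also have "((\<tau> j)(?c := 0))(?d := 0, ?c := ((\<tau> j)(?c := 0)) ?c + ((\<tau> j)(?c := 0)) ?d) =
             (\<tau> j)(?d := 0, ?c := R E (Suc x) j)"
            using c j by (auto simp: fun_eq_iff)
          also have "\<dots> = \<tau> (Suc j)"
            using j by (auto simp: \<tau>_def store_def fun_eq_iff less_Suc_eq)
          finally show "cexec h (pm j) (8 * B X + 3) (\<tau> j) (\<tau> (Suc j))" .
        qed
        moreover have "\<tau> 0 = s2" by (simp add: \<tau>_def)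
        ultimately have B3: "cexec h (seqs pm m) (m * (8 * B X + 4)) s2 (\<tau> m)"
          by (simp add: add.commute)
        have B4: "cexec h (Inc (b + 1)) 1 (\<tau> m) ((\<tau> m)(b + 1 := Suc (\<tau> m (b + 1))))"
          by (rule cexec_Inc) (simp add: h_def)
        have "(\<tau> m)(b + 1 := Suc (\<tau> m (b + 1))) = \<sigma> (Suc x)"
          using s by (auto simp: \<tau>_def s2_def s1_def \<sigma>_def store_def fun_eq_iff)
        with cexec_Seq[OF B1 cexec_Seq[OF B2 cexec_Seq[OF B3 B4]]]
        show "cexec h body (tb X) (\<sigma> x) (\<sigma> (Suc x))"
          unfolding body_def tb_def by (auto intro: cexec_mono)
      qed (auto simp: h_def \<sigma>_def store_def)
      then have 3: "cexec h (While (nonzero b) body) (quasi C X * (tb X + 2) + 1) (\<sigma> 0) (\<sigma> A)"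
        by (rule cexec_mono) (simp_all only: order_refl add_le_mono1 mult_le_mono1[OF AX])
      have RA: "R E A i \<le> B X" if "i < m" for i
        using RB[OF that, of A E] unfolding A_def X_def by simp
      define u1 where "u1 = (\<sigma> A)(b + 1 := 0)"
      have 4: "cexec h (clear (b + 1)) (3 * quasi C X + 1) (\<sigma> A) u1"
        unfolding u1_def by (rule cexec_clear) (use AX in \<open>auto simp: h_def \<sigma>_def store_def\<close>)
      define u2 where "u2 = u1(b + 2 + i0 := 0, b := u1 b + u1 (b + 2 + i0))"
      have 5: "cexec h (transfer (b + 2 + i0) b) (5 * B X + 1) u1 u2"
        unfolding u2_def by (rule cexec_transfer)
          (use i0 RA[OF i0] in \<open>auto simp: h_def u1_def \<sigma>_def store_def\<close>)
      have 6: "cexec h (seqs (\<lambda>j. clear (b + 2 + j)) m) (m * (3 * B X + 2)) u2 (store (b + 2) m (\<lambda>_. 0) u2)"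
      proof (rule cexec_clears)
        fix r assume "b + 2 \<le> r" "r < b + 2 + m"
        then show "u2 r \<le> B X"
          using RA[of "r - (b + 2)"] by (auto simp: u2_def u1_def \<sigma>_def store_def)
      qed (simp add: h_def)
      have eq: "store (b + 2) m (\<lambda>_. 0) u2 = s(b := R E A i0)"
        using s i0 by (auto simp: u2_def u1_def \<sigma>_def store_def fun_eq_iff)
      show "cexec h prg (t (esum k (s \<circ> \<rho>))) s (s(b := R (s \<circ> \<rho>) (a (s \<circ> \<rho>)) i0))"
        using cexec_Seq[OF 1[folded sA_def] cexec_Seq[OF 2 cexec_Seq[OF 3 cexec_Seq[OF 4 cexec_Seq[OF 5 6[unfolded eq]]]]]]
        unfolding prg_def t_def E_def[symmetric] A_def[symmetric] X_def[symmetric]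
        by (rule cexec_mono) auto
    qed
  qed
qed

section \<open>Arithmetic in quasipolynomial time\<close>

definition ebounded :: "(env \<Rightarrow> nat) \<Rightarrow> bool" where
  "ebounded f \<longleftrightarrow> (\<exists>C k. \<forall>e. f e \<le> quasi C (esum k e))"

text \<open>Monotonicity of \<open>p\<close> allows passing to more variables, which is how two
  bounds are brought to a common \<open>k\<close>.\<close>

definition eplog :: "(env \<Rightarrow> nat) \<Rightarrow> bool" where
  "eplog f \<longleftrightarrow> (\<exists>p k. plog p \<and> mono p \<and> (\<forall>e. f e \<le> p (esum k e)))"

lemma eplogI: "plog p \<Longrightarrow> mono p \<Longrightarrow> (\<And>e. f e \<le> p (esum k e)) \<Longrightarrow> eplog f"
  unfolding eplog_def by blast

lemma eplog_mono: "eplog g \<Longrightarrow> (\<And>e. f e \<le> g e) \<Longrightarrow> eplog f"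
  unfolding eplog_def by (meson order.trans)

lemma eplog_const: "eplog (\<lambda>_. c)"
  by (rule eplogI[OF plog_const[of c]]) (auto simp: mono_def)

lemma eplog_add:
  assumes "eplog f" "eplog g"
  shows "eplog (\<lambda>e. f e + g e)"
proof -
  obtain p k q l where *: "plog p" "mono p" "\<And>e. f e \<le> p (esum k e)"
    "plog q" "mono q" "\<And>e. g e \<le> q (esum l e)"
    using assms unfolding eplog_def by blast
  show ?thesis
  proof (rule eplogI[OF plog_add[OF *(1,4)]])
    show "mono (\<lambda>x. p x + q x)" using *(2,5) by (simp add: mono_def add_mono)
    show "f e + g e \<le> p (esum (max k l) e) + q (esum (max k l) e)" for e
      using *(3)[of e] *(6)[of e] monoD[OF *(2) esum_mono[of k "max k l" e]]
        monoD[OF *(5) esum_mono[of l "max k l" e]] by simp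
  qed
qed

lemma eplog_mult:
  assumes "eplog f" "eplog g"
  shows "eplog (\<lambda>e. f e * g e)"
proof -
  obtain p k q l where *: "plog p" "mono p" "\<And>e. f e \<le> p (esum k e)"
    "plog q" "mono q" "\<And>e. g e \<le> q (esum l e)"
    using assms unfolding eplog_def by blast
  show ?thesis
  proof (rule eplogI[OF plog_mult[OF *(1,4)]])
    show "mono (\<lambda>x. p x * q x)" using *(2,5) by (simp add: mono_def mult_le_mono)
    show "f e * g e \<le> p (esum (max k l) e) * q (esum (max k l) e)" for e
      using *(3)[of e] *(6)[of e] monoD[OF *(2) esum_mono[of k "max k l" e]]
        monoD[OF *(5) esum_mono[of l "max k l" e]] by (intro mult_le_mono) simp_all
  qed
qed

lemma eplog_power: "eplog f \<Longrightarrow> eplog (\<lambda>e. f e ^ c)"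
  by (induction c) (auto intro: eplog_const eplog_mult)

lemma eplog_min: "eplog g \<Longrightarrow> eplog (\<lambda>e. min (f e) (g e))"
  by (erule eplog_mono) simp

lemma eplog_bitlen_esum: "eplog (\<lambda>e. bitlen (esum k e))"
  by (rule eplogI[OF plog_bitlen]) (auto simp: mono_def bitlen_mono)

lemma ebounded_iff: "ebounded f \<longleftrightarrow> (\<exists>p. eplog p \<and> (\<forall>e. f e \<le> 2 ^ p e))"
proof
  assume "ebounded f"
  then obtain C k where "\<And>e. f e \<le> quasi C (esum k e)" unfolding ebounded_def by blast
  moreover have "eplog (\<lambda>e. (C + bitlen (esum k e)) ^ C)"
    by (intro eplog_power eplog_add eplog_const eplog_bitlen_esum)
  ultimately show "\<exists>p. eplog p \<and> (\<forall>e. f e \<le> 2 ^ p e)" unfolding quasi_def by blast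
next
  assume "\<exists>p. eplog p \<and> (\<forall>e. f e \<le> 2 ^ p e)"
  then obtain p q k where *: "\<And>e. f e \<le> 2 ^ p e" "plog q" "\<And>e. p e \<le> q (esum k e)"
    unfolding eplog_def by blast
  obtain C where "\<And>x. q x \<le> (C + bitlen x) ^ C" using *(2) unfolding plog_def by blast
  then have "p e \<le> (C + bitlen (esum k e)) ^ C" for e using *(3) order.trans by blast
  then have "2 ^ p e \<le> quasi C (esum k e)" for e unfolding quasi_def by simp
  then show "ebounded f" unfolding ebounded_def using *(1) order.trans by blast
qed

lemma ebounded_mono: "ebounded g \<Longrightarrow> (\<And>e. f e \<le> g e) \<Longrightarrow> ebounded f"
  unfolding ebounded_def by (meson order.trans)

lemma eplog_bitlen:
  assumes "ebounded f"
  shows "eplog (\<lambda>e. bitlen (f e))"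
proof -
  obtain p where p: "eplog p" "\<And>e. f e \<le> 2 ^ p e" using assms unfolding ebounded_iff by blast
  have "bitlen (f e) \<le> p e + 1" for e using bitlen_mono[OF p(2)[of e]] by simp
  then show ?thesis by (rule eplog_mono[OF eplog_add[OF p(1) eplog_const[of 1]]])
qed

text \<open>A quasipolynomial base tolerates a polylogarithmic exponent, as
  \<open>f e < 2 ^ bitlen (f e)\<close>. This is the source of the \<open>eplog\<close> conditions
  on exponents below.\<close>

lemma ebounded_power:
  assumes "ebounded f" "eplog g"
  shows "ebounded (\<lambda>e. f e ^ g e)"
  unfolding ebounded_iff
proof (intro exI conjI allI)
  show "eplog (\<lambda>e. bitlen (f e) * g e)" by (intro eplog_mult eplog_bitlen assms)
  show "f e ^ g e \<le> 2 ^ (bitlen (f e) * g e)" for e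
    unfolding power_mult using less_bitlen[of "f e"] by (intro power_mono) auto
qed

lemma ebounded_mult:
  assumes "ebounded f" "ebounded g"
  shows "ebounded (\<lambda>e. f e * g e)"
  unfolding ebounded_iff
proof (intro exI conjI allI)
  show "eplog (\<lambda>e. bitlen (f e) + bitlen (g e))" by (intro eplog_add eplog_bitlen assms)
  show "f e * g e \<le> 2 ^ (bitlen (f e) + bitlen (g e))" for e
    unfolding power_add using less_bitlen[of "f e"] less_bitlen[of "g e"] by (intro mult_le_mono) auto
qed

lemma ebounded_const: "ebounded (\<lambda>_. c)"
  unfolding ebounded_iff by (intro exI[of _ "\<lambda>_. c"]) (auto intro: eplog_const)

lemma ebounded_add:
  assumes "ebounded f" "ebounded g"
  shows "ebounded (\<lambda>e. f e + g e)"
proof (rule ebounded_mono)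
  show "ebounded (\<lambda>e. 2 ^ bitlen (f e) * 2 ^ bitlen (g e) * 2)"
    by (intro ebounded_mult ebounded_power ebounded_const eplog_bitlen assms)
  show "f e + g e \<le> 2 ^ bitlen (f e) * 2 ^ bitlen (g e) * 2" for e
  proof -
    have "f e \<le> 2 ^ bitlen (f e) * 1" "g e \<le> 1 * 2 ^ bitlen (g e)"
      using less_bitlen[of "f e"] less_bitlen[of "g e"] by auto
    moreover have "2 ^ bitlen (f e) * (1::nat) \<le> 2 ^ bitlen (f e) * 2 ^ bitlen (g e)"
      "(1::nat) * 2 ^ bitlen (g e) \<le> 2 ^ bitlen (f e) * 2 ^ bitlen (g e)"
      by (rule mult_le_mono, auto)+
    ultimately show ?thesis by linarith
  qed
qed

lemma ebounded_esum: "ebounded (esum k)"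
  unfolding ebounded_iff
  by (intro exI[of _ "\<lambda>e. bitlen (esum k e)"]) (auto intro: eplog_bitlen_esum less_imp_le less_bitlen)

lemma qcomp_ebounded: "qcomp f \<Longrightarrow> ebounded f"
  unfolding qcomp_def realizable_def ebounded_def by blast

lemma ebounded_quasi:
  assumes "ebounded f"
  shows "ebounded (\<lambda>e. quasi C (f e))"
  unfolding quasi_def by (intro ebounded_power ebounded_const eplog_power eplog_add eplog_const eplog_bitlen assms)

lemma eplog_ebounded: "eplog f \<Longrightarrow> ebounded f"
  unfolding ebounded_iff by (rule exI[of _ f]) auto

lemma ebounded_quasiE:
  assumes "ebounded f"
  obtains H k where "qbounded H" "\<And>e. f e \<le> H (esum k e)"
proof -
  obtain C k where "\<And>e. f e \<le> quasi C (esum k e)" using assms unfolding ebounded_def by blast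
  then show ?thesis by (rule that[OF qbounded_quasi])
qed

lemma qcomp_rename: "qcomp f \<Longrightarrow> qcomp (\<lambda>e. f (\<lambda>i. e (\<sigma> i)))"
  by (rule qcomp_comp[where g = "\<lambda>i e. e (\<sigma> i)"]) (auto intro: qcomp_var)

lemma qcomp_shift: "qcomp f \<Longrightarrow> qcomp (\<lambda>e. f (\<lambda>i. e (Suc i)))"
  by (rule qcomp_rename)

lemma qcomp_shift2: "qcomp f \<Longrightarrow> qcomp (\<lambda>e. f (\<lambda>i. e (Suc (Suc i))))"
  by (rule qcomp_rename)

lemma qcomp_comp1: "qcomp (\<lambda>e. F (e 0)) \<Longrightarrow> qcomp a \<Longrightarrow> qcomp (\<lambda>e. F (a e))"
  by (rule qcomp_comp[of "\<lambda>e. F (e 0)" "\<lambda>_. a"])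

lemma qcomp_comp2:
  assumes "qcomp (\<lambda>e. F (e 0) (e (Suc 0)))" "qcomp a" "qcomp b"
  shows "qcomp (\<lambda>e. F (a e) (b e))"
  using qcomp_comp[OF assms(1), of "\<lambda>i. if i = 0 then a else b"] assms(2,3) by simp

lemma qcomp_comp3:
  assumes "qcomp (\<lambda>e. F (e 0) (e (Suc 0)) (e (Suc (Suc 0))))" "qcomp a" "qcomp b" "qcomp c"
  shows "qcomp (\<lambda>e. F (a e) (b e) (c e))"
  using qcomp_comp[OF assms(1), of "\<lambda>i. if i = 0 then a else if i = 1 then b else c"] assms(2-) by simp

lemma qcomp_comp4:
  assumes "qcomp (\<lambda>e. F (e 0) (e (Suc 0)) (e (Suc (Suc 0))) (e (Suc (Suc (Suc 0)))))"
    "qcomp a" "qcomp b" "qcomp c" "qcomp d"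
  shows "qcomp (\<lambda>e. F (a e) (b e) (c e) (d e))"
  using qcomp_comp[OF assms(1), of "\<lambda>i. if i = 0 then a else if i = 1 then b else if i = 2 then c else d"]
    assms(2-) by simp

lemma qcomp_rec:
  assumes "qcomp a" "qcomp z" "qcomp (\<lambda>e. st (\<lambda>j. e (Suc (Suc j))) (e 0) (e (Suc 0)))"
    and "ebounded g" "\<And>e x. x \<le> a e \<Longrightarrow> rec_nat (z e) (st e) x \<le> g e"
  shows "qcomp (\<lambda>e. rec_nat (z e) (st e) (a e))"
proof -
  obtain H k where H: "qbounded H" "\<And>e. g e \<le> H (esum k e)" by (rule ebounded_quasiE[OF assms(4)]) blast
  show ?thesis
  proof (rule qcomp_vector_rec[where R = "\<lambda>e x i. rec_nat (z e) (st e) x" and m = 1 and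
        z = "\<lambda>_. z" and G = "\<lambda>_ e. st (\<lambda>j. e (Suc (Suc j))) (e 0) (e (Suc 0))" and H = H and kH = k and ?i0.0 = 0])
    show "rec_nat (z e) (st e) x \<le> H (esum k e)" if "x \<le> a e" for e x
      using assms(5)[OF that] H(2)[of e] by (rule order.trans)
  qed (use assms H in \<open>auto simp: pack_def\<close>)
qed

section \<open>Elementary functions, predicates and bounded quantifiers\<close>

lemma qcomp_const: "qcomp (\<lambda>_. c)"
  by (induction c) (auto intro: qcomp_zero qcomp_Suc)

lemma qcomp_add:
  assumes "qcomp f" "qcomp g"
  shows "qcomp (\<lambda>e. f e + g e)"
proof -
  have r: "rec_nat x (\<lambda>_. Suc) y = x + y" for x y by (induction y) auto
  have "qcomp (\<lambda>e. rec_nat (f e) (\<lambda>_. Suc) (g e))"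
    by (rule qcomp_rec[where st = "\<lambda>_ _. Suc" and g = "\<lambda>e. f e + g e"])
      (auto simp: r intro: assms qcomp_Suc qcomp_var ebounded_add qcomp_ebounded)
  then show ?thesis unfolding r .
qed

lemma qcomp_mult:
  assumes "qcomp f" "qcomp g"
  shows "qcomp (\<lambda>e. f e * g e)"
proof -
  have r: "rec_nat 0 (\<lambda>_ r. r + x) y = x * y" for x y :: nat by (induction y) auto
  have "qcomp (\<lambda>e. rec_nat 0 (\<lambda>_ r. r + f e) (g e))"
    by (rule qcomp_rec[where st = "\<lambda>e _ r. r + f e" and g = "\<lambda>e. f e * g e"])
      (auto simp: r intro: assms(2) qcomp_zero ebounded_mult qcomp_ebounded
        intro!: qcomp_add qcomp_var qcomp_shift2[OF assms(1)] ebounded_mult qcomp_ebounded[OF assms(1)])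
  then show ?thesis unfolding r .
qed

lemma qcomp_pred:
  assumes "qcomp f"
  shows "qcomp (\<lambda>e. f e - Suc 0)"
proof -
  have r: "rec_nat 0 (\<lambda>j _. j) y = y - Suc 0" for y by (cases y) auto
  have "qcomp (\<lambda>e. rec_nat 0 (\<lambda>j _. j) (f e))"
    by (rule qcomp_rec[where st = "\<lambda>_ j _. j" and g = "\<lambda>e. f e"])
      (auto simp: r intro: assms qcomp_var qcomp_zero qcomp_ebounded)
  then show ?thesis unfolding r .
qed

lemma qcomp_diff:
  assumes "qcomp f" "qcomp g"
  shows "qcomp (\<lambda>e. f e - g e)"
proof -
  have r: "rec_nat x (\<lambda>_ r. r - Suc 0) y = x - y" for x y :: nat by (induction y) auto
  have "qcomp (\<lambda>e. rec_nat (f e) (\<lambda>_ r. r - Suc 0) (g e))"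
    by (rule qcomp_rec[where st = "\<lambda>_ _ r. r - Suc 0" and g = "\<lambda>e. f e"])
      (auto simp: r intro: assms qcomp_pred qcomp_var qcomp_ebounded)
  then show ?thesis unfolding r .
qed

definition qdec :: "(env \<Rightarrow> bool) \<Rightarrow> bool" where
  "qdec P \<longleftrightarrow> qcomp (\<lambda>e. of_bool (P e))"

lemma qdec_le:
  assumes "qcomp f" "qcomp g"
  shows "qdec (\<lambda>e. f e \<le> g e)"
proof -
  have "qcomp (\<lambda>e. 1 - (f e - g e))" by (intro qcomp_diff qcomp_const assms)
  moreover have "(1::nat) - (x - y) = of_bool (x \<le> y)" for x y by simp
  ultimately show ?thesis unfolding qdec_def by simp
qed

lemma qdec_not:
  assumes "qdec P"
  shows "qdec (\<lambda>e. \<not> P e)"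
proof -
  have "qcomp (\<lambda>e. 1 - of_bool (P e))" using assms unfolding qdec_def by (intro qcomp_diff qcomp_const)
  moreover have "(1::nat) - of_bool b = of_bool (\<not> b)" for b by simp
  ultimately show ?thesis unfolding qdec_def by simp
qed

lemma qdec_conj:
  assumes "qdec P" "qdec Q"
  shows "qdec (\<lambda>e. P e \<and> Q e)"
proof -
  have "qcomp (\<lambda>e. of_bool (P e) * of_bool (Q e))" using assms unfolding qdec_def by (intro qcomp_mult)
  then show ?thesis unfolding qdec_def by (simp add: of_bool_conj)
qed

lemma qdec_less: "qcomp f \<Longrightarrow> qcomp g \<Longrightarrow> qdec (\<lambda>e. f e < g e)"
  using qdec_not[OF qdec_le[of g f]] by (simp add: not_le)

lemma qdec_eq: "qcomp f \<Longrightarrow> qcomp g \<Longrightarrow> qdec (\<lambda>e. f e = g e)"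
  using qdec_conj[OF qdec_le[of f g] qdec_le[of g f]] by (simp add: eq_iff)

lemma qdec_disj: "qdec P \<Longrightarrow> qdec Q \<Longrightarrow> qdec (\<lambda>e. P e \<or> Q e)"
  using qdec_not[OF qdec_conj[OF qdec_not[of P] qdec_not[of Q]]] by simp

lemma qcomp_of_bool: "qdec P \<Longrightarrow> qcomp (\<lambda>e. of_bool (P e))"
  by (simp add: qdec_def)

lemma qcomp_if:
  assumes "qdec P" "qcomp f" "qcomp g"
  shows "qcomp (\<lambda>e. if P e then f e else g e)"
proof -
  have "qcomp (\<lambda>e. of_bool (P e) * f e + of_bool (\<not> P e) * g e)"
    by (intro qcomp_add qcomp_mult qcomp_of_bool qdec_not assms)
  moreover have "of_bool b * x + of_bool (\<not> b) * y = (if b then x else y)" for b and x y :: nat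
    by simp
  ultimately show ?thesis by simp
qed

lemma qcomp_min: "qcomp f \<Longrightarrow> qcomp g \<Longrightarrow> qcomp (\<lambda>e. min (f e) (g e))"
  unfolding min_def by (intro qcomp_if qdec_le)

lemma qcomp_sum:
  assumes "qcomp a" "qcomp (\<lambda>e. s (\<lambda>j. e (Suc j)) (e 0))"
  shows "qcomp (\<lambda>e. \<Sum>i<a e. s e i)"
proof -
  have r: "rec_nat 0 (\<lambda>i r. r + s e i) y = (\<Sum>i<y. s e i)" for e y by (induction y) auto
  obtain C k where Ck: "\<And>e. s (\<lambda>j. e (Suc j)) (e 0) \<le> quasi C (esum k e)"
    using qcomp_ebounded[OF assms(2)] unfolding ebounded_def by blast
  \<comment> \<open>With \<open>m = 0\<close>, \<open>pack\<close> merely puts \<open>i\<close> in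
    front of \<open>e\<close>; this turns the bound on the summand into one in terms of
    \<open>i\<close> and \<open>e\<close>.\<close>
  have le: "s e i \<le> quasi C (i + esum k e)" for e i
  proof -
    have "esum k (pack 0 e i v) \<le> i + esum k e" for v
      using esum_mono[of k "k + 0 + 1" "pack 0 e i v"] unfolding esum_pack by (simp add: esum_def)
    then have "quasi C (esum k (pack 0 e i v)) \<le> quasi C (i + esum k e)" for v
      by (intro quasi_mono) auto
    with Ck[of "pack 0 e i (\<lambda>_. 0)"]
    have "s (\<lambda>j. pack 0 e i (\<lambda>_. 0) (Suc j)) (pack 0 e i (\<lambda>_. 0) 0) \<le> quasi C (i + esum k e)"
      by (rule order.trans)
    then show ?thesis by (simp add: pack_def)
  qed
  have "qcomp (\<lambda>e. rec_nat 0 (\<lambda>i r. r + s e i) (a e))"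
  proof (rule qcomp_rec[where st = "\<lambda>e i r. r + s e i" and g = "\<lambda>e. a e * quasi C (a e + esum k e)"])
    show "qcomp (\<lambda>e. e (Suc 0) + s (\<lambda>j. e (Suc (Suc j))) (e 0))"
      \<comment> \<open>In the step function variable 1 is the accumulator, which the summand has to
        skip.\<close>
      using qcomp_rename[OF assms(2), of "\<lambda>i. if i = 0 then 0 else Suc i"]
      by (intro qcomp_add qcomp_var) simp
    show "ebounded (\<lambda>e. a e * quasi C (a e + esum k e))"
      by (intro ebounded_mult ebounded_quasi ebounded_add ebounded_esum qcomp_ebounded assms)
    fix e x assume x: "x \<le> a e"
    have "(\<Sum>i<x. s e i) \<le> (\<Sum>i<x. quasi C (a e + esum k e))"
      using x by (intro sum_mono order.trans[OF le] quasi_mono) auto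
    also have "\<dots> \<le> a e * quasi C (a e + esum k e)" using x by simp
    finally show "rec_nat 0 (\<lambda>i r. r + s e i) x \<le> a e * quasi C (a e + esum k e)" unfolding r .
  qed (intro assms qcomp_zero)+
  then show ?thesis unfolding r .
qed

lemma qdec_ex:
  assumes "qcomp a" "qdec (\<lambda>e. P (\<lambda>j. e (Suc j)) (e 0))"
  shows "qdec (\<lambda>e. \<exists>i<a e. P e i)"
proof -
  have "qdec (\<lambda>e. 0 < (\<Sum>i<a e. of_bool (P e i) :: nat))"
    by (intro qdec_less qcomp_zero qcomp_sum[where s = "\<lambda>e i. of_bool (P e i)"] qcomp_of_bool assms)
  moreover have "0 < (\<Sum>i<y. of_bool (Q i) :: nat) \<longleftrightarrow> (\<exists>i<y. Q i)" for y :: nat and Q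
    by (induction y) (auto simp: less_Suc_eq)
  ultimately show ?thesis by simp
qed

lemma qdec_all:
  assumes "qcomp a" "qdec (\<lambda>e. P (\<lambda>j. e (Suc j)) (e 0))"
  shows "qdec (\<lambda>e. \<forall>i<a e. P e i)"
  using qdec_not[OF qdec_ex[OF assms(1), of "\<lambda>e i. \<not> P e i", OF qdec_not[OF assms(2)]]] by simp

text \<open>The quotient is the number of positive multiples of the divisor up to the dividend. The
  conjunct \<open>y \<noteq> 0\<close> reproduces the convention that division by 0 gives 0.\<close>

lemma qcomp_div:
  assumes "qcomp f" "qcomp g"
  shows "qcomp (\<lambda>e. f e div g e)"
proof -
  have r: "(\<Sum>i<x. of_bool (y \<noteq> 0 \<and> Suc i * y \<le> x)) = x div y" for x y :: nat
  proof (cases "y = 0")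
    case False
    have "(\<Sum>i<x. of_bool (Suc i * y \<le> x)) = card {i \<in> {..<x}. Suc i * y \<le> x}"
      by (simp add: sum.inter_filter[symmetric] of_bool_def)
    also have "{i \<in> {..<x}. Suc i * y \<le> x} = {..<x div y}"
    proof -
      have "i < x" if "Suc i * y \<le> x" for i
      proof -
        have "Suc i * 1 \<le> Suc i * y" using False by (intro mult_le_mono2) simp
        from order.trans[OF this that] show ?thesis by simp
      qed
      moreover have "Suc i * y \<le> x \<longleftrightarrow> i < x div y" for i
        using False less_eq_div_iff_mult_less_eq[of y "Suc i" x] by (simp add: Suc_le_eq)
      ultimately show ?thesis by blast
    qed
    finally show ?thesis using False by simp
  qed simp
  have "qcomp (\<lambda>e. \<Sum>i<f e. of_bool (g e \<noteq> 0 \<and> Suc i * g e \<le> f e))"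
    by (rule qcomp_sum[where s = "\<lambda>e i. of_bool (g e \<noteq> 0 \<and> Suc i * g e \<le> f e)"])
      (intro assms qcomp_of_bool qdec_conj qdec_not qdec_eq qdec_le qcomp_mult qcomp_Suc qcomp_var
        qcomp_zero qcomp_shift[OF assms(1)] qcomp_shift[OF assms(2)])+
  then show ?thesis unfolding r .
qed

lemma qcomp_mod:
  assumes "qcomp f" "qcomp g"
  shows "qcomp (\<lambda>e. f e mod g e)"
  using qcomp_diff[OF assms(1) qcomp_mult[OF qcomp_div[OF assms] assms(2)]]
  by (simp add: minus_div_mult_eq_mod)

lemma qcomp_power:
  assumes "qcomp f" "qcomp g" "eplog g"
  shows "qcomp (\<lambda>e. f e ^ g e)"
proof -
  have r: "rec_nat 1 (\<lambda>_ r. r * x) y = x ^ y" for x y :: nat by (induction y) auto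
  have "qcomp (\<lambda>e. rec_nat 1 (\<lambda>_ r. r * f e) (g e))"
  proof (rule qcomp_rec[where st = "\<lambda>e _ r. r * f e" and g = "\<lambda>e. (1 + f e) ^ g e"])
    show "ebounded (\<lambda>e. (1 + f e) ^ g e)"
      by (intro ebounded_power ebounded_add ebounded_const qcomp_ebounded assms)
    show "rec_nat 1 (\<lambda>_ r. r * f e) x \<le> (1 + f e) ^ g e" if "x \<le> g e" for e x
      unfolding r by (rule power_mono_both) (use that in auto)
  qed (intro assms qcomp_const qcomp_mult qcomp_var qcomp_shift2[OF assms(1)])+
  then show ?thesis unfolding r .
qed

lemma qcomp_power_const: "qcomp f \<Longrightarrow> qcomp (\<lambda>e. f e ^ c)"
  by (intro qcomp_power qcomp_const eplog_const)

text \<open>\<open>bitlen x\<close> counts the powers of two up to \<open>x\<close>. For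
  \<open>i < x\<close> the power \<open>2 ^ i\<close> itself may be exponential in \<open>x\<close>,
  so it is computed with a cap at \<open>Suc x\<close>, which preserves the comparison with
  \<open>x\<close>.\<close>

lemma qcomp_bitlen:
  assumes "qcomp f"
  shows "qcomp (\<lambda>e. bitlen (f e))"
proof -
  have cap: "rec_nat 1 (\<lambda>_ r. min (2 * r) (Suc x)) y = min (2 ^ y) (Suc x)" for x y :: nat
    by (induction y) (auto simp: min_def)
  have sum: "(\<Sum>i<x. of_bool (min (2 ^ i) (Suc x) \<le> x)) = bitlen x" for x
  proof -
    have "(\<Sum>i<x. of_bool (min (2 ^ i) (Suc x) \<le> x)) = card {i \<in> {..<x}. 2 ^ i \<le> x}"
      by (simp add: sum.inter_filter[symmetric] of_bool_def min_le_iff_disj)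
    also have "{i \<in> {..<x}. 2 ^ i \<le> x} = {..<bitlen x}"
      using bitlen_le_self[of x] by (auto simp: less_bitlen_iff[symmetric])
    finally show ?thesis by simp
  qed
  have "qcomp (\<lambda>e. rec_nat 1 (\<lambda>_ r. min (2 * r) (Suc (e (Suc 0)))) (e 0))"
  proof (rule qcomp_rec[where st = "\<lambda>e _ r. min (2 * r) (Suc (e (Suc 0)))" and g = "\<lambda>e. Suc (e (Suc 0))"])
    show "ebounded (\<lambda>e. Suc (e (Suc 0)))" by (intro qcomp_ebounded qcomp_Suc qcomp_var)
  qed (unfold cap, (intro qcomp_var qcomp_const qcomp_min qcomp_mult qcomp_Suc min.cobounded2)+)
  then have "qcomp (\<lambda>e. min (2 ^ e 0) (Suc (e (Suc 0))))" unfolding cap .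
  then have "qcomp (\<lambda>e. \<Sum>i<e 0. of_bool (min (2 ^ i) (Suc (e 0)) \<le> e 0))"
    by (intro qcomp_sum[where s = "\<lambda>e i. of_bool (min (2 ^ i) (Suc (e 0)) \<le> e 0)"]
        qcomp_of_bool qdec_le qcomp_var)
  then have "qcomp (\<lambda>e. bitlen (e 0))" unfolding sum .
  then show ?thesis using assms by (rule qcomp_comp1)
qed

lemma qcomp_sum_const:
  fixes m :: nat
  assumes "\<And>i. i < m \<Longrightarrow> qcomp (g i)"
  shows "qcomp (\<lambda>e. \<Sum>i<m. g i e)"
  using assms by (induction m) (auto intro: qcomp_zero qcomp_add)

text \<open>An arbitrary \<open>G\<close> is allowed since it is only consulted on finitely many
  argument lists and can be hard-wired. This is how the transition function of a machine
  enters.\<close>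

lemma qcomp_finite:
  assumes "\<And>f. f \<in> set fs \<Longrightarrow> qcomp f" "\<And>f e. f \<in> set fs \<Longrightarrow> f e < B"
  shows "qcomp (\<lambda>e. G (map (\<lambda>f. f e) fs))"
  using assms
proof (induction fs arbitrary: G)
  case Nil
  then show ?case by (simp add: qcomp_const)
next
  case (Cons f fs)
  have "qcomp (\<lambda>e. \<Sum>d<B. of_bool (f e = d) * G (d # map (\<lambda>f. f e) fs))"
    using Cons.prems Cons.IH[of "\<lambda>xs. G (_ # xs)"]
    by (intro qcomp_sum_const qcomp_mult qcomp_of_bool qdec_eq qcomp_const) auto
  moreover have "(\<Sum>d<B. of_bool (f e = d) * G (d # map (\<lambda>f. f e) fs)) = G (map (\<lambda>f. f e) (f # fs))" for e
  proof -
    have "(\<Sum>d<B. of_bool (f e = d) * G (d # map (\<lambda>f. f e) fs)) =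
        (\<Sum>d<B. if f e = d then G (d # map (\<lambda>f. f e) fs) else 0)"
      by (rule sum.cong) auto
    then show ?thesis using Cons.prems(2)[of f e] by simp
  qed
  ultimately show ?case by simp
qed

definition digit :: "nat \<Rightarrow> nat \<Rightarrow> nat \<Rightarrow> nat" where
  "digit b x j = x div b ^ j mod b"

lemma digit_beyond:
  assumes "2 \<le> b" "bitlen x \<le> j"
  shows "x div b ^ j = 0"
proof -
  have "x < 2 ^ bitlen x" by (rule less_bitlen)
  also have "\<dots> \<le> b ^ j" using assms by (intro power_mono_both) auto
  finally show ?thesis by simp
qed

text \<open>Beyond \<open>bitlen x\<close> all digits vanish, so the exponent can be capped there.
  Only the capped power is quasipolynomial for every \<open>j\<close>.\<close>

lemma digit_eq: "2 \<le> b \<Longrightarrow> digit b x j = x div b ^ (min j (bitlen x)) mod b"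
  by (cases "j \<le> bitlen x") (simp_all add: digit_def digit_beyond min_def)

lemma qcomp_digit:
  assumes "qcomp f" "qcomp g" "qcomp j" "\<And>e. 2 \<le> f e"
  shows "qcomp (\<lambda>e. digit (f e) (g e) (j e))"
  unfolding digit_eq[OF assms(4)]
  by (intro qcomp_mod qcomp_div qcomp_power qcomp_min qcomp_bitlen eplog_min eplog_bitlen qcomp_ebounded assms)

lemmas qcomp_intros = qcomp_var qcomp_const qcomp_Suc qcomp_add qcomp_mult qcomp_diff qcomp_div qcomp_mod
  qcomp_bitlen qcomp_of_bool qcomp_if qcomp_min
  qdec_le qdec_less qdec_eq qdec_not qdec_conj qdec_disj

section \<open>Heavy positions\<close>

text \<open>In the application \<open>w X i\<close> counts the reads of position \<open>i\<close> on
  input \<open>X\<close> over all \<open>W\<close> coin sequences. In \<open>hybrid\<close> the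
  differing positions are weighed at \<open>X\<close> alone, since a run on \<open>X\<close> that
  reads none of them is also a run on \<open>Y\<close>.\<close>

locale query_weights =
  fixes U :: "'i set" and w :: "'i set \<Rightarrow> 'i \<Rightarrow> nat" and f :: "'i set \<Rightarrow> bool" and W t :: nat
  assumes finite_U: "finite U" and W_pos: "0 < W"
    and total: "X \<subseteq> U \<Longrightarrow> (\<Sum>i\<in>U. w X i) \<le> t * W"
    and hybrid: "X \<subseteq> U \<Longrightarrow> Y \<subseteq> U \<Longrightarrow> f X \<noteq> f Y \<Longrightarrow> W \<le> 3 * (\<Sum>i\<in>sym_diff X Y. w X i)"
begin

text \<open>The threshold \<open>W / (9 * t)\<close> is \<open>W / 3\<close> shared among the at
  most \<open>3 * t\<close> positions of a minimal sensitive block.\<close>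

definition heavy :: "'i set \<Rightarrow> 'i set" where
  "heavy X = {i \<in> U. W \<le> 9 * t * w X i}"

text \<open>Markov's inequality for the weights.\<close>

lemma card_heavy:
  assumes "X \<subseteq> U"
  shows "card (heavy X) \<le> 9 * t * t"
proof -
  have "card (heavy X) * W = (\<Sum>i\<in>heavy X. W)" by simp
  also have "\<dots> \<le> (\<Sum>i\<in>heavy X. 9 * t * w X i)" by (rule sum_mono) (simp add: heavy_def)
  also have "\<dots> \<le> (\<Sum>i\<in>U. 9 * t * w X i)"
    by (rule sum_mono2) (auto simp: finite_U heavy_def)
  also have "\<dots> = 9 * t * (\<Sum>i\<in>U. w X i)" by (rule sum_distrib_left[symmetric])
  also have "\<dots> \<le> 9 * t * (t * W)" using total[OF assms] by (rule mult_le_mono2)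
  finally have "card (heavy X) * W \<le> (9 * t * t) * W" by (simp add: mult.assoc)
  then show ?thesis using W_pos by simp
qed

text \<open>In a minimal block on which \<open>X\<close> can be changed so that the value of \<open>f\<close> changes,
  every position is sensitive for the changed input, hence has weight at least \<open>W / 3\<close> there.
  So the block has at most \<open>3t\<close> positions, and the hybrid argument at \<open>X\<close> makes
  one of them heavy.\<close>

lemma heavy_certificate:
  assumes "X \<subseteq> U" "Y \<subseteq> U" "heavy X \<inter> sym_diff X Y = {}"
  shows "f X = f Y"
proof (rule ccontr)
  assume "f X \<noteq> f Y"
  define P where "P Z \<longleftrightarrow> f Z \<noteq> f X \<and> sym_diff X Z \<subseteq> sym_diff X Y" for Z
  have "P Y" using \<open>f X \<noteq> f Y\<close> by (auto simp: P_def)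
  obtain Z where Z: "P Z" "\<And>Z'. P Z' \<Longrightarrow> card (sym_diff X Z) \<le> card (sym_diff X Z')"
    using ex_has_least_nat[of P Y "\<lambda>Z. card (sym_diff X Z)"] \<open>P Y\<close> by blast
  define B where "B = sym_diff X Z"
  have ZU: "Z \<subseteq> U" using Z(1) assms(1,2) unfolding P_def by blast
  have BU: "B \<subseteq> U" using assms(1) ZU unfolding B_def by blast
  have finB: "finite B" using BU finite_U finite_subset by blast
  have *: "W \<le> 3 * w Z i" if i: "i \<in> B" for i
  proof -
    \<comment> \<open>Undoing the change at \<open>i\<close> gives a smaller block, on which by
      minimality the value of \<open>f\<close> does not change.\<close>
    define Z' where "Z' = sym_diff Z {i}"
    have d: "sym_diff X Z' = B - {i}" using i by (auto simp: Z'_def B_def)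
    then have "card (sym_diff X Z') < card B" using i finB by (metis card_Diff1_less)
    then have "\<not> P Z'" using Z(2)[of Z'] unfolding B_def by linarith
    moreover have "sym_diff X Z' \<subseteq> sym_diff X Y" using Z(1) unfolding d P_def B_def by blast
    ultimately have "f Z \<noteq> f Z'" using Z(1) unfolding P_def by blast
    moreover have "Z' \<subseteq> U" using ZU i BU by (auto simp: Z'_def)
    ultimately have "W \<le> 3 * (\<Sum>i\<in>sym_diff Z Z'. w Z i)" using hybrid ZU by blast
    moreover have "sym_diff Z Z' = {i}" by (auto simp: Z'_def)
    ultimately show ?thesis by simp
  qed
  have "card B * W = (\<Sum>i\<in>B. W)" by simp
  also have "\<dots> \<le> (\<Sum>i\<in>B. 3 * w Z i)" by (rule sum_mono) (rule *)
  also have "\<dots> \<le> (\<Sum>i\<in>U. 3 * w Z i)" by (rule sum_mono2) (use finite_U BU in auto)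
  also have "\<dots> = 3 * (\<Sum>i\<in>U. w Z i)" by (rule sum_distrib_left[symmetric])
  also have "\<dots> \<le> 3 * (t * W)" using total[OF ZU] by simp
  finally have "card B * W \<le> (3 * t) * W" by (simp add: mult.assoc)
  then have cardB: "card B \<le> 3 * t" using W_pos by simp
  have "f X \<noteq> f Z" using Z(1) unfolding P_def by blast
  then have hyb: "W \<le> 3 * (\<Sum>i\<in>B. w X i)" using hybrid assms(1) ZU unfolding B_def by blast
  have "\<exists>i\<in>B. W \<le> 9 * t * w X i"
  proof (rule ccontr)
    assume "\<not> (\<exists>i\<in>B. W \<le> 9 * t * w X i)"
    then have lt: "9 * t * w X i < W" if "i \<in> B" for i using that by (meson not_le)
    have "B \<noteq> {}" using hyb W_pos by auto
    \<comment> \<open>At most \<open>3 * t\<close> positions of weight below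
      \<open>W / (9 * t)\<close> have total weight below \<open>W / 3\<close>, against
      \<open>hyb\<close>.\<close>
    have "3 * t * W \<le> 3 * t * (3 * (\<Sum>i\<in>B. w X i))" using hyb by (rule mult_le_mono2)
    also have "\<dots> = (\<Sum>i\<in>B. 9 * t * w X i)" by (simp add: sum_distrib_left mult.assoc)
    also have "\<dots> < (\<Sum>i\<in>B. W)" by (rule sum_strict_mono) (use finB \<open>B \<noteq> {}\<close> lt in auto)
    also have "\<dots> \<le> 3 * t * W" using cardB by (simp add: mult_le_mono1 del: mult.assoc)
    finally show False by simp
  qed
  then obtain i where "i \<in> B" "i \<in> heavy X" using BU unfolding heavy_def by blast
  then show False using assms(3) Z(1) unfolding P_def B_def by blast
qed

text \<open>The sets of heavy positions at which \<open>K r\<close> and \<open>Y\<close> differ are disjoint for the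
  rounds in question, and changing \<open>Y\<close> on any one of them changes the value of \<open>f\<close>.
  So each of them has weight at least \<open>W / 3\<close> at \<open>Y\<close>.\<close>

lemma card_bad_rounds:
  fixes K :: "nat \<Rightarrow> 'i set"
  assumes K: "\<And>r r'. r \<le> r' \<Longrightarrow> r' < R \<Longrightarrow> K r \<subseteq> K r'" "\<And>r. r < R \<Longrightarrow> K r \<subseteq> Y"
    and heavy: "\<And>r. Suc r < R \<Longrightarrow> heavy (K r) \<inter> Y \<subseteq> K (Suc r)" and "Y \<subseteq> U"
  shows "card {r. r < R \<and> f (K r) \<noteq> f Y} \<le> 3 * t"
proof -
  define S where "S = {r. r < R \<and> f (K r) \<noteq> f Y}"
  define B where "B r = heavy (K r) \<inter> sym_diff (K r) Y" for r
  have KU: "K r \<subseteq> U" if "r < R" for r using K(2)[OF that] \<open>Y \<subseteq> U\<close> by blast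
  have B: "B r \<subseteq> U" for r by (auto simp: B_def heavy_def)
  have le: "W \<le> 3 * (\<Sum>i\<in>B r. w Y i)" if "r \<in> S" for r
  proof -
    \<comment> \<open>After flipping \<open>B r\<close>, the input agrees with the guess on all
      heavy positions of the guess, so these certify the same value for both.\<close>
    define Y' where "Y' = sym_diff Y (B r)"
    have Y': "Y' \<subseteq> U" using \<open>Y \<subseteq> U\<close> B unfolding Y'_def by blast
    have "heavy (K r) \<inter> sym_diff (K r) Y' = {}" by (auto simp: Y'_def B_def)
    then have "f (K r) = f Y'" using KU Y' that by (intro heavy_certificate) (auto simp: S_def)
    then have "f Y \<noteq> f Y'" using that by (auto simp: S_def)
    moreover have "sym_diff Y Y' = B r" by (auto simp: Y'_def)
    ultimately show ?thesis using hybrid[OF \<open>Y \<subseteq> U\<close> Y'] by simp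
  qed
  \<comment> \<open>The positions in \<open>B r\<close> belong to \<open>Y\<close> but not yet to
    \<open>K r\<close>. They are added in the next round and so belong to all later guesses.\<close>
  have disj: "B r \<inter> B r' = {}" if "r < r'" "r' < R" for r r'
  proof -
    have "heavy (K r) \<inter> Y \<subseteq> K r'" using heavy[of r] K(1)[of "Suc r" r'] that by fastforce
    moreover have "K r' \<subseteq> Y" using K(2) that by blast
    ultimately show ?thesis by (auto simp: B_def)
  qed
  have "card S * W = (\<Sum>r\<in>S. W)" by simp
  also have "\<dots> \<le> (\<Sum>r\<in>S. 3 * (\<Sum>i\<in>B r. w Y i))" by (rule sum_mono) (rule le)
  also have "\<dots> = 3 * (\<Sum>r\<in>S. \<Sum>i\<in>B r. w Y i)" by (rule sum_distrib_left[symmetric])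
  also have "(\<Sum>r\<in>S. \<Sum>i\<in>B r. w Y i) = (\<Sum>i\<in>\<Union>(B ` S). w Y i)"
  proof (rule sum.UNION_disjoint[symmetric])
    show "\<forall>r\<in>S. finite (B r)" using B finite_U finite_subset by blast
    show "\<forall>r\<in>S. \<forall>r'\<in>S. r \<noteq> r' \<longrightarrow> B r \<inter> B r' = {}"
    proof (intro ballI impI)
      fix r r' assume "r \<in> S" "r' \<in> S" "r \<noteq> r'"
      then show "B r \<inter> B r' = {}"
        using disj[of r r'] disj[of r' r] by (cases "r < r'") (auto simp: S_def)
    qed
  qed (simp add: S_def)
  also have "\<dots> \<le> (\<Sum>i\<in>U. w Y i)" by (rule sum_mono2) (use finite_U B in auto)
  also have "\<dots> \<le> t * W" by (rule total[OF \<open>Y \<subseteq> U\<close>])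
  finally have "card S * W \<le> (3 * t) * W" by simp
  then show ?thesis using W_pos unfolding S_def by simp
qed

text \<open>The last guess \<open>K R\<close>, too, contains all earlier guesses and obeys the
  hypotheses of \<open>card_bad_rounds\<close>, which therefore applies once with \<open>Z\<close>
  and once with \<open>K R\<close>.\<close>

lemma rounds_determine:
  fixes K :: "nat \<Rightarrow> 'i set"
  assumes mono: "\<And>r. K r \<subseteq> K (Suc r)" and KZ: "\<And>r. K r \<subseteq> Z" and ZU: "Z \<subseteq> U"
    and heavy: "\<And>r. heavy (K r) \<inter> Z \<subseteq> K (Suc r)" and R: "6 * t < R"
  shows "f (K R) = f Z"
proof (rule ccontr)
  assume "f (K R) \<noteq> f Z"
  have m: "K r \<subseteq> K r'" if "r \<le> r'" for r r' using lift_Suc_mono_le[of K, OF mono that] .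
  \<comment> \<open>As \<open>f\<close> differs on \<open>Z\<close> and \<open>K R\<close>, no
    earlier guess can agree with both, so each of the \<open>R\<close> rounds is bad for one of
    them.\<close>
  have "{..<R} \<subseteq> {r. r < R \<and> f (K r) \<noteq> f Z} \<union> {r. r < R \<and> f (K r) \<noteq> f (K R)}"
    using \<open>f (K R) \<noteq> f Z\<close> by auto
  then have "card {..<R} \<le> card ({r. r < R \<and> f (K r) \<noteq> f Z} \<union> {r. r < R \<and> f (K r) \<noteq> f (K R)})"
    by (intro card_mono) auto
  also have "\<dots> \<le> card {r. r < R \<and> f (K r) \<noteq> f Z} + card {r. r < R \<and> f (K r) \<noteq> f (K R)}"
    by (rule card_Un_le)
  also have "\<dots> \<le> 3 * t + 3 * t"
  proof (rule add_mono)
    show "card {r. r < R \<and> f (K r) \<noteq> f Z} \<le> 3 * t"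
      by (rule card_bad_rounds) (use m KZ ZU heavy in auto)
    show "card {r. r < R \<and> f (K r) \<noteq> f (K R)} \<le> 3 * t"
    proof (rule card_bad_rounds)
      show "heavy (K r) \<inter> K R \<subseteq> K (Suc r)" for r using heavy[of r] KZ[of R] by blast
      show "K R \<subseteq> U" using KZ ZU by blast
    qed (use m in auto)
  qed
  finally show False using R by simp
qed

end

section \<open>Runs with prescribed coin tosses\<close>

primrec coin_run :: "bool ratm \<Rightarrow> bool list list \<Rightarrow> (nat \<Rightarrow> bool) \<Rightarrow> nat \<Rightarrow> config" where
  "coin_run M ws cs 0 = initial M"
| "coin_run M ws cs (Suc t) = step M ws (cs t) (coin_run M ws cs t)"

lemma coin_run_cong:
  "(\<And>s. s < t \<Longrightarrow> cs s = cs' s) \<Longrightarrow> coin_run M ws cs t = coin_run M ws cs' t"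
  by (induction t) auto

lemma rand_run_Suc:
  "rand_run M ws (Suc t) =
     bind_pmf (bernoulli_pmf (1/2)) (\<lambda>c. map_pmf (step M ws c) (rand_run M ws t))"
  unfolding rand_run.simps map_pmf_def by (rule bind_commute_pmf)

lemma prob_rand_run_Suc:
  "measure_pmf.prob (rand_run M ws (Suc t)) {cf. P cf} =
     (measure_pmf.prob (rand_run M ws t) {cf. P (step M ws True cf)} +
      measure_pmf.prob (rand_run M ws t) {cf. P (step M ws False cf)}) / 2"
proof -
  let ?p = "\<lambda>c. measure_pmf.prob (rand_run M ws t) {cf. P (step M ws c cf)}"
  have "ennreal (measure_pmf.prob (rand_run M ws (Suc t)) {cf. P cf}) =
      emeasure (rand_run M ws (Suc t)) {cf. P cf}"
    by (simp add: measure_pmf.emeasure_eq_measure)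
  also have "\<dots> = ennreal (?p True) * inverse 2 + ennreal (?p False) * inverse 2"
    unfolding rand_run_Suc emeasure_bind_pmf
    by (subst nn_integral_bernoulli_pmf)
      (simp_all add: measure_pmf.emeasure_eq_measure vimage_def ennreal_divide_numeral[symmetric])
  also have "\<dots> = ennreal (?p True / 2 + ?p False / 2)"
    by (subst ennreal_plus) (simp_all add: divide_ennreal_def flip: ennreal_divide_numeral)
  finally show ?thesis by (subst (asm) ennreal_inj) (auto simp: add_divide_distrib)
qed

text \<open>The bits of \<open>c\<close> are the coins. The predicate \<open>P\<close> is
  generalized in the induction, so that the last step can be absorbed into it.\<close>

lemma prob_rand_run:
  "measure_pmf.prob (rand_run M ws t) {cf. P cf} * 2 ^ t =
     card {c :: nat. c < 2 ^ t \<and> P (coin_run M ws (bit c) t)}"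
proof (induction t arbitrary: P)
  case 0
  have "{c :: nat. c < 2 ^ 0 \<and> P (coin_run M ws (bit c) 0)} = (if P (initial M) then {0::nat} else {})"
    by auto
  moreover have "card (if b then {0::nat} else {}) = of_bool b" for b by simp
  ultimately show ?case by (simp only:) (simp add: indicator_def)
next
  case (Suc t)
  let ?S = "\<lambda>b. {c. c < 2 ^ t \<and> P (step M ws b (coin_run M ws (bit (c::nat)) t))}"
  have low: "coin_run M ws (bit (c + 2 ^ t)) t = coin_run M ws (bit c) t" for c :: nat
  proof (rule coin_run_cong)
    fix s assume "s < t"
    then have "(2::nat) ^ t = 2 ^ (t - s) * 2 ^ s" by (simp flip: power_add)
    then have "(c + 2 ^ t) div 2 ^ s = c div 2 ^ s + 2 ^ (t - s)" by simp
    then show "bit (c + 2 ^ t) s = bit c s" using \<open>s < t\<close> by (simp add: bit_iff_odd)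
  qed
  \<comment> \<open>The last coin is bit \<open>t\<close>: numbers below \<open>2 ^ t\<close> have
    it 0, and adding \<open>2 ^ t\<close> sets it without affecting the earlier coins.\<close>
  have eq: "{c :: nat. c < 2 ^ Suc t \<and> P (coin_run M ws (bit c) (Suc t))} = ?S False \<union> (\<lambda>c. c + 2 ^ t) ` ?S True"
  proof -
    have hi: "bit (c + 2 ^ t) t" if "c < 2 ^ t" for c :: nat using that by (simp add: bit_iff_odd)
    have lo: "\<not> bit c t" if "c < 2 ^ t" for c :: nat using that by (simp add: bit_iff_odd)
    have "c \<in> ?S False \<union> (\<lambda>c. c + 2 ^ t) ` ?S True"
      if "c < 2 ^ Suc t" "P (coin_run M ws (bit c) (Suc t))" for c :: nat
    proof (cases "c < 2 ^ t")
      case True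
      then show ?thesis using that lo[OF True] by simp
    next
      case False
      define d where "d = c - 2 ^ t"
      have "c = d + 2 ^ t" "d < 2 ^ t" using False that(1) by (auto simp: d_def)
      then show ?thesis using that low hi by auto
    qed
    then show ?thesis using low hi lo by auto
  qed
  have "card {c :: nat. c < 2 ^ Suc t \<and> P (coin_run M ws (bit c) (Suc t))} =
      card (?S False) + card ((\<lambda>c. c + 2 ^ t) ` ?S True)"
    unfolding eq by (rule card_Un_disjoint) auto
  also have "card ((\<lambda>c. c + 2 ^ t) ` ?S True) = card (?S True)"
    by (rule card_image) (simp add: inj_on_def)
  finally show ?case
    using Suc.IH[of "\<lambda>cf. P (step M ws True cf)"] Suc.IH[of "\<lambda>cf. P (step M ws False cf)"]
    unfolding prob_rand_run_Suc by (simp add: field_simps)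
qed

text \<open>Halting states are never left. Hence a run can be prolonged to a more convenient time
  bound without losing probability.\<close>

lemma prob_halted_mono:
  assumes "t \<le> t'" "v = accept \<or> v = reject"
  shows "measure_pmf.prob (rand_run M ws t) {cf. fst cf = v}
    \<le> measure_pmf.prob (rand_run M ws t') {cf. fst cf = v}"
  using assms(1)
proof (induction t' rule: dec_induct)
  case (step t')
  have "measure_pmf.prob (rand_run M ws t') {cf. fst cf = v}
      \<le> measure_pmf.prob (rand_run M ws t') {cf. fst (step M ws c cf) = v}" for c
    using assms(2) by (intro measure_pmf.finite_measure_mono) (auto simp: step_def halted_def)
  from this[of True] this[of False] show ?case
    using step.IH unfolding prob_rand_run_Suc by simp
qed simp

section \<open>Arithmetic simulation of a randomized machine\<close>

lemma digit_below:
  assumes "j < h" "0 < b"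
  shows "digit b (x + b ^ h * z) j = digit b x j"
proof -
  have "b ^ h = b ^ (h - j) * b ^ j" using assms(1) by (simp flip: power_add)
  then have "b ^ h * z = (b ^ (h - j) * z) * b ^ j" by (simp only: ac_simps)
  moreover have "(x + (b ^ (h - j) * z) * b ^ j) div b ^ j = b ^ (h - j) * z + x div b ^ j"
    by (rule div_mult_self1) (use assms(2) in simp)
  ultimately have "(x + b ^ h * z) div b ^ j = b ^ (h - j) * z + x div b ^ j"
    by (simp only:)
  also have "b ^ (h - j) = b * b ^ (h - Suc j)"
    using assms(1) by (simp flip: power_Suc add: Suc_diff_Suc)
  finally show ?thesis by (simp add: digit_def mult.assoc)
qed

lemma digit_above:
  assumes "x < b ^ h" "h \<le> j"
  shows "digit b (x + b ^ h * z) j = digit b z (j - h)"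
proof -
  have "b ^ j = b ^ h * b ^ (j - h)" using assms(2) by (simp flip: power_add)
  then have "(x + b ^ h * z) div b ^ j = (x + b ^ h * z) div b ^ h div b ^ (j - h)"
    by (simp add: div_mult2_eq)
  moreover have "(x + b ^ h * z) div b ^ h = z + x div b ^ h"
    using assms(1) by (intro div_mult_self2) (cases "b = 0"; cases h; auto)
  ultimately show ?thesis using assms(1) by (simp add: digit_def)
qed

text \<open>Splitting \<open>x\<close> into low part, digit \<open>h\<close> and high part shows
  that only that digit changes. On tapes coded by their digits this is the writing of a
  symbol.\<close>

lemma digit_write:
  assumes "a < b"
  shows "digit b (x + a * b ^ h - digit b x h * b ^ h) = (digit b x)(h := a)"
proof -
  define lo d hi where "lo = x mod b ^ h" and "d = digit b x h" and "hi = x div b ^ h div b"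
  have lo: "lo < b ^ h" unfolding lo_def using assms by simp
  have "x div b ^ h = d + b * hi" unfolding d_def hi_def digit_def by simp
  then have x: "x = lo + b ^ h * (d + b * hi)"
    unfolding lo_def by (metis add.commute div_mult_mod_eq mult.commute)
  then have x': "x + a * b ^ h - digit b x h * b ^ h = lo + b ^ h * (a + b * hi)"
    unfolding d_def[symmetric] by (simp add: algebra_simps)
  have d: "d < b" unfolding d_def digit_def using assms by simp
  have "digit b (lo + b ^ h * (a + b * hi)) j = (if j = h then a else digit b (lo + b ^ h * (d + b * hi)) j)" for j
  proof (cases "j < h")
    case True
    then show ?thesis using assms by (simp add: digit_below)
  next
    case False
    have "digit b (y + b * hi) (j - h) = (if j = h then y else digit b hi (j - h - 1))" if "y < b" for y
    proof (cases "j = h")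
      case True
      then show ?thesis using that by (simp add: digit_def)
    next
      case j: False
      then show ?thesis using digit_above[of y b 1 "j - h" hi] that False by simp
    qed
    then show ?thesis using False d assms lo by (simp add: digit_above)
  qed
  then show ?thesis unfolding x' by (auto simp: fun_eq_iff x[symmetric])
qed

lemma digit_less: "0 < b \<Longrightarrow> digit b x j < b"
  by (simp add: digit_def)

lemma digit_0 [simp]: "digit b 0 j = 0"
  by (simp add: digit_def)

lemma digit_zero_beyond: "2 \<le> b \<Longrightarrow> bitlen x \<le> j \<Longrightarrow> digit b x j = 0"
  by (simp add: digit_def digit_beyond)

text \<open>A finite set of numbers below \<open>n\<close> is coded by the list of its elements, in base
  \<open>n + 2\<close> and shifted by one; the digit 0 marks the end of the list.\<close>

definition set_of :: "nat \<Rightarrow> nat \<Rightarrow> nat set" where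
  "set_of n K = {i. \<exists>j<bitlen K. digit (n + 2) K j = Suc i}"

definition add_elem :: "nat \<Rightarrow> nat \<Rightarrow> nat \<Rightarrow> nat" where
  "add_elem n K i = K * (n + 2) + Suc i"

lemma set_of_unbounded: "set_of n K = {i. \<exists>j. digit (n + 2) K j = Suc i}"
proof -
  have "j < bitlen K" if "digit (n + 2) K j = Suc i" for i j
    using digit_zero_beyond[of "n + 2" K j] that by (auto simp: not_less[symmetric])
  then show ?thesis unfolding set_of_def by blast
qed

lemma set_of_0 [simp]: "set_of n 0 = {}"
  by (simp add: set_of_def)

lemma set_of_add_elem:
  assumes "i \<le> n"
  shows "set_of n (add_elem n K i) = insert i (set_of n K)"
proof -
  have d: "digit (n + 2) (add_elem n K i) j = (case j of 0 \<Rightarrow> Suc i | Suc j' \<Rightarrow> digit (n + 2) K j')" for j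
  proof (cases j)
    case 0
    moreover have "(K * (n + 2) + Suc i) mod (n + 2) = Suc i"
      unfolding mod_mult_self3 using assms by simp
    ultimately show ?thesis by (simp only: digit_def add_elem_def) simp
  next
    case (Suc j')
    have "digit (n + 2) (Suc i + (n + 2) ^ 1 * K) j = digit (n + 2) K (j - 1)"
      by (rule digit_above) (use assms Suc in auto)
    then show ?thesis using Suc by (simp add: add_elem_def algebra_simps)
  qed
  show ?thesis unfolding set_of_unbounded
  proof (intro set_eqI iffI)
    fix x assume "x \<in> {i'. \<exists>j. digit (n + 2) (add_elem n K i) j = Suc i'}"
    then show "x \<in> insert i {i. \<exists>j. digit (n + 2) K j = Suc i}"
      unfolding d by (auto split: nat.splits simp: gr0_conv_Suc)
  next
    fix x assume "x \<in> insert i {i. \<exists>j. digit (n + 2) K j = Suc i}"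
    then show "x \<in> {i'. \<exists>j. digit (n + 2) (add_elem n K i) j = Suc i'}"
    proof
      assume "x = i"
      then show ?thesis unfolding d by (auto intro: exI[of _ 0])
    next
      assume "x \<in> {i. \<exists>j. digit (n + 2) K j = Suc i}"
      then obtain j where "digit (n + 2) K j = Suc x" by blast
      then show ?thesis unfolding d by (auto intro: exI[of _ "Suc j"])
    qed
  qed
qed

lemma qdec_set_of:
  assumes "qcomp n" "qcomp K" "qcomp i"
  shows "qdec (\<lambda>e. i e \<in> set_of (n e) (K e))"
proof -
  have "qdec (\<lambda>e. \<exists>j<bitlen (e (Suc 0)). digit (e 0 + 2) (e (Suc 0)) j = Suc (e (Suc (Suc 0))))"
    by (intro qdec_ex[where P = "\<lambda>e j. digit (e 0 + 2) (e (Suc 0)) j = Suc (e (Suc (Suc 0)))"]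
        qcomp_intros qcomp_digit) simp
  then have "qcomp (\<lambda>e. of_bool (e (Suc (Suc 0)) \<in> set_of (e 0) (e (Suc 0))))"
    unfolding qdec_def set_of_def by simp
  from qcomp_comp3[OF this assms] show ?thesis unfolding qdec_def .
qed

lemma address_eq:
  "address tp = (\<Sum>j<(LEAST i. fst tp i \<notin> {1, 2}). of_bool (fst tp j = 2) * 2 ^ j)"
  unfolding address_def tape_word_def horner_sum_eq_sum by (simp add: atLeast0LessThan)

text \<open>The bounded quantifier says that cell \<open>j\<close> lies in the longest prefix of
  bits, which replaces \<open>LEAST\<close> by something computable. The summation may stop at
  \<open>bitlen F\<close> since further cells are blank; \<open>min\<close> leaves the exponent
  unchanged but makes it visibly polylogarithmic.\<close>

definition tape_address :: "nat \<Rightarrow> nat \<Rightarrow> nat" where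
  "tape_address b F = (\<Sum>j<bitlen F. of_bool (digit b F j = 2 \<and>
      (\<forall>i<Suc j. digit b F i = 1 \<or> digit b F i = 2)) * 2 ^ min j (bitlen F))"

lemma tape_address:
  assumes "2 \<le> b"
  shows "address (digit b F, h) = tape_address b F"
proof -
  define p where "p = (LEAST i. digit b F i \<notin> {1, 2})"
  have ex: "digit b F (bitlen F) \<notin> {1, 2}" using digit_zero_beyond[OF assms, of F "bitlen F"] by simp
  then have p: "digit b F p \<notin> {1, 2}" "p \<le> bitlen F" unfolding p_def by (rule LeastI, rule Least_le)
  have iff: "(\<forall>i<Suc j. digit b F i = 1 \<or> digit b F i = 2) \<longleftrightarrow> j < p" for j
  proof
    assume *: "\<forall>i<Suc j. digit b F i = 1 \<or> digit b F i = 2"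
    show "j < p"
    proof (rule ccontr)
      assume "\<not> j < p"
      then show False using * p(1) by auto
    qed
  next
    assume "j < p"
    then show "\<forall>i<Suc j. digit b F i = 1 \<or> digit b F i = 2"
      unfolding p_def using not_less_Least[of _ "\<lambda>i. digit b F i \<notin> {1, 2}"] by (meson less_Suc_eq_le insertE
        empty_iff order.strict_trans1)
  qed
  have "tape_address b F = (\<Sum>j<bitlen F. if j < p then of_bool (digit b F j = 2) * 2 ^ j else 0)"
    unfolding tape_address_def iff by (rule sum.cong) auto
  also have "\<dots> = (\<Sum>j\<in>{j \<in> {..<bitlen F}. j < p}. of_bool (digit b F j = 2) * 2 ^ j)"
    by (rule sum.inter_filter[symmetric]) simp
  also have "{j \<in> {..<bitlen F}. j < p} = {..<p}" using p(2) by auto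
  finally show ?thesis unfolding address_eq p_def by simp
qed

lemma qcomp_tape_address:
  assumes "qcomp F" "2 \<le> b"
  shows "qcomp (\<lambda>e. tape_address b (F e))"
proof -
  have "qcomp (\<lambda>e. tape_address b (e 0))"
    unfolding tape_address_def
    by (intro qcomp_sum[where s = "\<lambda>e j. of_bool (digit b (e 0) j = 2 \<and>
          (\<forall>i<Suc j. digit b (e 0) i = 1 \<or> digit b (e 0) i = 2)) * 2 ^ min j (bitlen (e 0))"]
        qdec_all[where P = "\<lambda>e i. digit b (e (Suc 0)) i = 1 \<or> digit b (e (Suc 0)) i = 2"]
        qcomp_intros qcomp_digit qcomp_power eplog_min eplog_bitlen qcomp_ebounded assms(2))
  then show ?thesis using assms(1) by (rule qcomp_comp1)
qed

definition input_word :: "nat \<Rightarrow> nat set \<Rightarrow> bool list" where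
  "input_word n X = map (\<lambda>i. i \<in> X) [0..<n]"

lemma length_input_word [simp]: "length (input_word n X) = n"
  by (simp add: input_word_def)

lemma fetch_input_word:
  "fetch (input_word n X) tp = (if address tp < n then Some (address tp \<in> X) else None)"
  by (simp add: fetch_def input_word_def)

fun decode_letter :: "nat \<Rightarrow> bool option" where
  "decode_letter 0 = None"
| "decode_letter (Suc r) = Some (r \<noteq> 0)"

fun encode_move :: "move \<Rightarrow> nat" where
  "encode_move Move_Left = 0"
| "encode_move Stay = 1"
| "encode_move Move_Right = 2"

lemma move_head_encode: "move_head d h = h + encode_move d - 1"
  by (cases d) auto

locale randomized_machine =
  fixes M :: "bool ratm" and k0 c0 :: nat
  assumes wf: "well_formed 1 M"
begin

text \<open>An explicit bound takes the place of the given running time, which need not be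
  computable. The final 1 makes it positive.\<close>

definition time :: "nat \<Rightarrow> nat" where
  "time n = bitlen n ^ k0 + c0 + 1"

definition k :: nat where "k = num_tapes M"

text \<open>Large enough for states, tape symbols and the codes 0, 1, 2 of a letter of the input to
  be digits.\<close>

definition base :: nat where "base = num_states M + num_symbols M + 3"

lemma k_pos: "0 < k"
  using wf by (simp add: well_formed_def k_def)

lemma base_gt: "2 < base" "num_states M < base" "num_symbols M < base"
  by (auto simp: base_def)

lemma qcomp_time:
  assumes "qcomp n"
  shows "qcomp (\<lambda>e. time (n e))"
proof -
  have "qcomp (\<lambda>e. time (e 0))" unfolding time_def by (intro qcomp_intros qcomp_power_const)
  then show ?thesis using assms by (rule qcomp_comp1)
qed

lemma eplog_time: "ebounded n \<Longrightarrow> eplog (\<lambda>e. time (n e))"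
  unfolding time_def by (intro eplog_add eplog_power eplog_bitlen eplog_const)

text \<open>Argument lists for the transition function: state, coin, letter of the input, and the
  symbols under the heads.\<close>

definition next_actions :: "nat list \<Rightarrow> nat \<times> (nat \<times> move) list" where
  "next_actions xs =
     (if xs ! 0 = accept \<or> xs ! 0 = reject then (xs ! 0, map (\<lambda>s. (s, Stay)) (drop 3 xs))
      else transition M (xs ! 1 = 1) (xs ! 0) [decode_letter (xs ! 2)] (drop 3 xs))"

text \<open>All entries are to be below \<open>base\<close>, so that \<open>qcomp_finite\<close>
  applies. Reduction modulo \<open>base\<close> ensures this for arbitrary \<open>v\<close> and does
  not alter an actual state.\<close>

definition args :: "nat \<Rightarrow> nat \<Rightarrow> nat \<Rightarrow> nat \<Rightarrow> (nat \<Rightarrow> nat) \<Rightarrow> nat list" where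
  "args n K c s v =
     (v 0 mod base) # digit 2 c s #
     (if tape_address base (v 1) < n then 1 + of_bool (tape_address base (v 1) \<in> set_of n K) else 0) #
     map (\<lambda>j. digit base (v (1 + j)) (v (1 + k + j))) [0..<k]"

text \<open>The cap at \<open>time n\<close> keeps the exponent polylogarithmic for all arguments;
  no head gets further within the time bound. In the last line truncated subtraction makes a head
  stay when it moves left from cell 0.\<close>

definition next_value :: "nat \<Rightarrow> nat \<Rightarrow> nat \<Rightarrow> nat \<Rightarrow> (nat \<Rightarrow> nat) \<Rightarrow> nat \<Rightarrow> nat" where
  "next_value n K c s v i =
     (let a = next_actions (args n K c s v) in
      if i = 0 then fst a
      else if i \<le> k then
        v i + fst (snd a ! (i - 1)) * base ^ min (v (k + i)) (time n)
          - digit base (v i) (v (k + i)) * base ^ min (v (k + i)) (time n)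
      else v i + encode_move (snd (snd a ! (i - 1 - k))) - 1)"

text \<open>Component 0 is the state, components \<open>1, \<dots>, k\<close> code the contents of the tapes and
  components \<open>k + 1, \<dots>, 2 k\<close> are the positions of the heads.\<close>

primrec sim :: "nat \<Rightarrow> nat \<Rightarrow> nat \<Rightarrow> nat \<Rightarrow> nat \<Rightarrow> nat" where
  "sim n K c 0 = (\<lambda>_. 0)"
| "sim n K c (Suc s) = next_value n K c s (sim n K c s)"

text \<open>Besides the coding this contains growth bounds: after \<open>s\<close> steps tape codes
  are below \<open>base ^ s\<close> and heads at most at \<open>s\<close>. They supply the bound
  that \<open>qcomp_vector_rec\<close> asks for.\<close>

definition represents :: "nat \<Rightarrow> (nat \<Rightarrow> nat) \<Rightarrow> config \<Rightarrow> bool" where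
  "represents s v cf \<longleftrightarrow> fst cf = v 0 \<and> v 0 < num_states M \<and> length (snd cf) = k \<and>
     (\<forall>j<k. snd cf ! j = (digit base (v (1 + j)), v (1 + k + j)) \<and> v (1 + j) < base ^ s \<and>
        v (1 + k + j) \<le> s \<and> (\<forall>p. digit base (v (1 + j)) p < num_symbols M))"

definition run_on :: "nat \<Rightarrow> nat set \<Rightarrow> nat \<Rightarrow> nat \<Rightarrow> config" where
  "run_on n X c s = coin_run M [input_word n X] (bit c) s"

lemma bit_iff_digit: "bit c s \<longleftrightarrow> digit 2 c s = (1 :: nat)"
  by (simp add: bit_iff_odd digit_def odd_iff_mod_2_eq_one)

lemma map2_single: "ys \<noteq> [] \<Longrightarrow> map2 g [x] ys = [g x (hd ys)]"
  by (cases ys) auto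

lemma represents_step:
  assumes r: "represents s v cf" and s: "s \<le> time n"
  shows "represents (Suc s) (next_value n K c s v) (step M [input_word n (set_of n K)] (bit c s) cf)"
proof -
  obtain q tps where cf: "cf = (q, tps)" by force
  let ?x = "input_word n (set_of n K)"
  have q: "q = v 0" "q < num_states M" "length tps = k"
    and tps: "\<And>j. j < k \<Longrightarrow> tps ! j = (digit base (v (1 + j)), v (1 + k + j))"
    and F: "\<And>j. j < k \<Longrightarrow> v (1 + j) < base ^ s" and h: "\<And>j. j < k \<Longrightarrow> v (1 + k + j) \<le> s"
    and sym: "\<And>j p. j < k \<Longrightarrow> digit base (v (1 + j)) p < num_symbols M"
    using r unfolding cf represents_def by auto
  define rr where "rr = (if tape_address base (v 1) < n then 1 + of_bool (tape_address base (v 1) \<in> set_of n K) else (0::nat))"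
  define ss where "ss = map (\<lambda>j. digit base (v (1 + j)) (v (1 + k + j))) [0..<k]"
  have ss_eq: "ss = map (\<lambda>(f, h). f h) tps"
    unfolding ss_def by (rule nth_equalityI) (use q tps in auto)
  have ne: "tps \<noteq> []" using q k_pos by auto
  have "address (hd tps) = tape_address base (v 1)"
    using tps[of 0] k_pos ne q base_gt tape_address[of base] by (simp add: hd_conv_nth)
  then have rs: "map2 fetch [?x] tps = [decode_letter rr]"
    unfolding map2_single[OF ne] fetch_input_word rr_def by simp
  have args: "args n K c s v = q # digit 2 c s # rr # ss"
    using q base_gt unfolding args_def rr_def[symmetric] ss_def[symmetric] by simp
  define a where "a = next_actions (args n K c s v)"
  have a: "a = (if q = 1 \<or> q = 2 then (q, map (\<lambda>s. (s, Stay)) ss)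
       else transition M (bit c s) q (map2 fetch [?x] tps) (map (\<lambda>(f, h). f h) tps))"
    unfolding a_def next_actions_def args rs ss_eq[symmetric] by (simp add: bit_iff_digit)
  have st: "step M [?x] (bit c s) cf = (fst a, map2 act (snd a) tps)"
  proof (cases "q = 1 \<or> q = 2")
    case True
    have "map2 act (map (\<lambda>s. (s, Stay)) ss) tps = tps"
      unfolding ss_eq by (rule nth_equalityI) (auto split: prod.splits)
    with True show ?thesis by (auto simp: step_def halted_def cf a)
  next
    case False
    then show ?thesis by (auto simp: step_def halted_def cf a split: prod.splits)
  qed
  have sset: "set ss \<subseteq> {..<num_symbols M}" "length ss = k"
    unfolding ss_def using sym by auto
  have wa: "fst a < num_states M \<and> length (snd a) = k \<and> fst ` set (snd a) \<subseteq> {..<num_symbols M}"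
  proof (cases "q = 1 \<or> q = 2")
    case True
    then show ?thesis using sset q by (auto simp: a)
  next
    case False
    have "let (q', acts) = transition M (bit c s) q [decode_letter rr] ss in q' < num_states M \<and>
        length acts = num_tapes M \<and> fst ` set acts \<subseteq> {..<num_symbols M}"
      using wf sset q unfolding well_formed_def k_def by simp
    then show ?thesis
      using False unfolding a rs ss_eq[symmetric] k_def by (simp add: case_prod_beta)
  qed
  have acts: "fst (snd a ! j) < num_symbols M" if "j < k" for j
    using wa that by (metis imageI lessThan_iff nth_mem subsetD)
  have vF: "next_value n K c s v (1 + j) = v (1 + j) + fst (snd a ! j) * base ^ v (1 + k + j)
      - digit base (v (1 + j)) (v (1 + k + j)) * base ^ v (1 + k + j)" if "j < k" for j
    using that h[OF that] s by (simp add: next_value_def a_def[symmetric] Let_def min_def)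
  have vh: "next_value n K c s v (1 + k + j) = move_head (snd (snd a ! j)) (v (1 + k + j))" if "j < k" for j
    using that by (simp add: next_value_def a_def[symmetric] Let_def move_head_encode)
  have v0: "next_value n K c s v 0 = fst a" by (simp add: next_value_def a_def)
  show ?thesis
    unfolding represents_def st
  proof (intro conjI allI impI)
    fix j assume j: "j < k"
    let ?a = "fst (snd a ! j)" and ?h = "v (1 + k + j)"
    have ab: "?a < base" using acts[OF j] base_gt by simp
    have dig: "digit base (next_value n K c s v (1 + j)) = (digit base (v (1 + j)))(?h := ?a)"
      unfolding vF[OF j] by (rule digit_write[OF ab])
    show "snd (fst a, map2 act (snd a) tps) ! j =
        (digit base (next_value n K c s v (1 + j)), next_value n K c s v (1 + k + j))"
      unfolding dig vh[OF j] using j wa q tps[OF j] by (cases "snd a ! j") simp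
    show "digit base (next_value n K c s v (1 + j)) p < num_symbols M" for p
      unfolding dig using sym[OF j] acts[OF j] by simp
    have "move_head d x \<le> Suc x" for d x by (cases d) auto
    then show "next_value n K c s v (1 + k + j) \<le> Suc s"
      unfolding vh[OF j] using h[OF j] by (meson Suc_le_mono order.trans)
    \<comment> \<open>The head is at most at cell \<open>s\<close>, so the new symbol adds at most
      \<open>(base - 1) * base ^ s\<close>, just enough for the next power of
      \<open>base\<close>.\<close>
    have "next_value n K c s v (1 + j) \<le> v (1 + j) + ?a * base ^ ?h" unfolding vF[OF j] by simp
    also have "?a * base ^ ?h \<le> (base - 1) * base ^ s"
      using ab h[OF j] base_gt by (intro mult_le_mono power_increasing) auto
    also have "v (1 + j) + (base - 1) * base ^ s < base ^ s + (base - 1) * base ^ s"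
      using F[OF j] by simp
    also have "\<dots> = base ^ Suc s" using base_gt by (simp add: algebra_simps)
    finally show "next_value n K c s v (1 + j) < base ^ Suc s" by simp
  qed (use v0 wa q in auto)
qed

lemma represents_sim: "s \<le> time n \<Longrightarrow> represents s (sim n K c s) (run_on n (set_of n K) c s)"
proof (induction s)
  case 0
  have "0 < num_symbols M" "0 < num_states M" using wf by (auto simp: well_formed_def)
  then show ?case by (auto simp: represents_def run_on_def initial_def k_def)
next
  case (Suc s)
  then show ?case using represents_step[of s "sim n K c s" _ n K c] by (simp add: run_on_def)
qed

text \<open>The numbering of variables is that of \<open>pack\<close> with \<open>2 * k + 1\<close>
  values: variable 0 is the step number, then come the components of the configuration, then
  \<open>n\<close>, \<open>K\<close> and \<open>c\<close>.\<close>

lemma qcomp_next_value: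
  assumes "i < 2 * k + 1"
  shows "qcomp (\<lambda>e. next_value (e (2 * k + 2)) (e (2 * k + 3)) (e (2 * k + 4)) (e 0) (\<lambda>i. e (Suc i)) i)"
proof -
  define fs :: "(env \<Rightarrow> nat) list" where "fs = 
     (\<lambda>e. e (Suc 0) mod base) # (\<lambda>e. digit 2 (e (2 * k + 4)) (e 0)) #
     (\<lambda>e. if tape_address base (e (Suc 1)) < e (2 * k + 2)
        then 1 + of_bool (tape_address base (e (Suc 1)) \<in> set_of (e (2 * k + 2)) (e (2 * k + 3))) else 0) #
     map (\<lambda>j e. digit base (e (Suc (1 + j))) (e (Suc (1 + k + j)))) [0..<k]"
  have fs: "args (e (2 * k + 2)) (e (2 * k + 3)) (e (2 * k + 4)) (e 0) (\<lambda>i. e (Suc i)) = map (\<lambda>f. f e) fs" for e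
    by (simp add: args_def fs_def)
  have b2: "2 \<le> base" "0 < base" using base_gt by auto
  have G: "qcomp (\<lambda>e. g (args (e (2 * k + 2)) (e (2 * k + 3)) (e (2 * k + 4)) (e 0) (\<lambda>i. e (Suc i))))" for g
    unfolding fs
  proof (rule qcomp_finite)
    show "qcomp f" if "f \<in> set fs" for f
      using that b2 unfolding fs_def
      by (auto intro!: qcomp_intros qcomp_digit qcomp_tape_address qdec_set_of)
    show "f e < base" if "f \<in> set fs" for f e
      using that base_gt b2 order.strict_trans[OF digit_less[of 2 "e (2 * k + 4)" "e 0"]] unfolding fs_def
      by (auto simp: digit_less)
  qed
  have pw: "qcomp (\<lambda>e. base ^ min (e (Suc (k + i))) (time (e (2 * k + 2))))"
    by (intro qcomp_power qcomp_intros qcomp_time eplog_min eplog_time qcomp_ebounded)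
  consider "i = 0" | "0 < i" "i \<le> k" | "k < i" by linarith
  then show ?thesis
  proof cases
    case 1
    then show ?thesis using G[of "\<lambda>xs. fst (next_actions xs)"] by (simp add: next_value_def)
  next
    case 2
    then show ?thesis
      unfolding next_value_def Let_def
      using G[of "\<lambda>xs. fst (snd (next_actions xs) ! (i - 1))"] pw b2
      by (auto intro!: qcomp_diff qcomp_add qcomp_mult qcomp_var qcomp_digit qcomp_const)
  next
    case 3
    then show ?thesis
      unfolding next_value_def Let_def
      using G[of "\<lambda>xs. encode_move (snd (snd (next_actions xs) ! (i - 1 - k)))"]
      by (auto intro!: qcomp_diff qcomp_add qcomp_var qcomp_const)
  qed
qed

text \<open>Without a cap on the number of steps the tape codes could grow exponentially in
  \<open>s\<close>.\<close>

lemma qcomp_sim: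
  assumes "i0 < 2 * k + 1" "qcomp n" "qcomp K" "qcomp c" "qcomp s"
  shows "qcomp (\<lambda>e. sim (n e) (K e) (c e) (min (s e) (time (n e))) i0)"
proof -
  define g :: "env \<Rightarrow> nat" where "g = (\<lambda>e. base ^ time (e 0) + time (e 0))"
  have "ebounded g" unfolding g_def
    by (intro ebounded_add ebounded_power ebounded_const eplog_ebounded eplog_time qcomp_ebounded qcomp_var)
  then obtain H kH where H: "qbounded H" "\<And>e. g e \<le> H (esum kH e)"
    by (rule ebounded_quasiE) blast
  have "qcomp (\<lambda>e. sim (e 0) (e 1) (e 2) (min (e 3) (time (e 0))) i0)"
  proof (rule qcomp_vector_rec[where R = "\<lambda>e x. sim (e 0) (e 1) (e 2) x" and m = "2 * k + 1"
        and z = "\<lambda>_ _. 0" and H = H and kH = kH and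
        G = "\<lambda>i e. next_value (e (2 * k + 2)) (e (2 * k + 3)) (e (2 * k + 4)) (e 0) (\<lambda>i. e (Suc i)) i"])
    show "qcomp (\<lambda>e. min (e 3) (time (e 0)))" by (intro qcomp_intros qcomp_time)
    fix e :: env and x i assume i: "i < 2 * k + 1"
    have ac: "args n K c s v = args n K c s v'" if "\<And>i. i < 2 * k + 1 \<Longrightarrow> v i = v' i" for n K c s v v'
      using that k_pos by (auto simp: args_def)
    have nc: "next_value n K c s v i = next_value n K c s v' i" if "\<And>i. i < 2 * k + 1 \<Longrightarrow> v i = v' i" for n K c s v v'
      using that i by (auto simp: next_value_def ac[OF that] Let_def)
    show "sim (e 0) (e 1) (e 2) (Suc x) i = next_value (pack (2 * k + 1) e x (sim (e 0) (e 1) (e 2) x) (2 * k + 2))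
       (pack (2 * k + 1) e x (sim (e 0) (e 1) (e 2) x) (2 * k + 3)) (pack (2 * k + 1) e x (sim (e 0) (e 1) (e 2) x) (2 * k + 4))
       (pack (2 * k + 1) e x (sim (e 0) (e 1) (e 2) x) 0) (\<lambda>i. pack (2 * k + 1) e x (sim (e 0) (e 1) (e 2) x) (Suc i)) i"
    proof -
      have p: "pack (2 * k + 1) e x v (2 * k + 2) = e 0" "pack (2 * k + 1) e x v (2 * k + 3) = e 1"
        "pack (2 * k + 1) e x v (2 * k + 4) = e 2" "pack (2 * k + 1) e x v 0 = x" for v
        by (auto simp: pack_def)
      show ?thesis unfolding p sim.simps by (rule nc) (simp add: pack_def)
    qed
    show "sim (e 0) (e 1) (e 2) x i \<le> H (esum kH e)" if "x \<le> min (e 3) (time (e 0))"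
    proof -
      have x: "x \<le> time (e 0)" using that by simp
      note r = represents_sim[OF x, of "e 1" "e 2"]
      have pw: "base ^ x \<le> base ^ time (e 0)" using x base_gt by (intro power_increasing) auto
      have "base ^ 1 \<le> base ^ time (e 0)" using base_gt by (intro power_increasing) (auto simp: time_def)
      consider "i = 0" | j where "j < k" "i = 1 + j" | j where "j < k" "i = 1 + k + j"
      proof (cases "i = 0 \<or> i \<le> k")
        case True
        then show thesis using that(1) that(2)[of "i - 1"] by (cases i) auto
      next
        case False
        then show thesis using that(3)[of "i - 1 - k"] i by auto
      qed
      then have "sim (e 0) (e 1) (e 2) x i \<le> g e"
      proof cases
        case 1
        then have "sim (e 0) (e 1) (e 2) x i < num_states M" using r by (simp add: represents_def)
        then show ?thesis using base_gt \<open>base ^ 1 \<le> _\<close> unfolding g_def by simp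
      next
        case 2
        then have "sim (e 0) (e 1) (e 2) x i < base ^ x" using r by (simp add: represents_def)
        then show ?thesis using pw unfolding g_def by simp
      next
        case 3
        then have "sim (e 0) (e 1) (e 2) x i \<le> x" using r by (simp add: represents_def)
        then show ?thesis using x unfolding g_def by simp
      qed
      then show ?thesis using H(2)[of e] by (rule order.trans)
    qed
  qed (use assms(1) H(1) qcomp_next_value qcomp_zero in auto)
  then have "qcomp (\<lambda>e. sim (e 0) (e (Suc 0)) (e (Suc (Suc 0))) (min (e (Suc (Suc (Suc 0)))) (time (e 0))) i0)"
    by (simp add: numeral_2_eq_2 numeral_3_eq_3)
  from qcomp_comp4[OF this assms(2-5)] show ?thesis .
qed

end

section \<open>Rounds of queries\<close>

context randomized_machine
begin

section \<open>Acceptance counts and weights of positions\<close>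

definition accepting :: "nat \<Rightarrow> nat set \<Rightarrow> bool" where
  "accepting n X \<longleftrightarrow>
     2 * 2 ^ time n \<le> 3 * card {c. c < 2 ^ time n \<and> fst (run_on n X c (time n)) = accept}"

definition weight :: "nat \<Rightarrow> nat set \<Rightarrow> nat \<Rightarrow> nat" where
  "weight n X i =
     (\<Sum>c<2 ^ time n. \<Sum>s<time n. of_bool (address (hd (snd (run_on n X c s))) = i))"

lemma total_weight: "(\<Sum>i<n. weight n X i) \<le> time n * 2 ^ time n"
proof -
  have "(\<Sum>i<n. weight n X i) =
      (\<Sum>c<2 ^ time n. \<Sum>s<time n. \<Sum>i<n. of_bool (address (hd (snd (run_on n X c s))) = i))"
    unfolding weight_def by (subst sum.swap, subst (2) sum.swap) (rule refl)
  also have "\<dots> \<le> (\<Sum>c<2 ^ time n :: nat. \<Sum>s<time n. (1::nat))"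
    by (intro sum_mono) (simp add: of_bool_def sum.delta)
  finally show ?thesis by (simp add: mult.commute)
qed

text \<open>A run depends on the input only through the letters read, and addresses from
  \<open>n\<close> on give \<open>None\<close> in both words.\<close>

lemma run_on_unread:
  assumes "\<And>s. s < t \<Longrightarrow> address (hd (snd (run_on n X c s))) \<notin> sym_diff X Y"
  shows "run_on n Y c t = run_on n X c t"
  using assms
proof (induction t)
  case 0
  then show ?case by (simp add: run_on_def)
next
  case (Suc t)
  let ?cf = "run_on n X c t"
  have "map2 fetch [input_word n Y] (snd ?cf) = map2 fetch [input_word n X] (snd ?cf)"
  proof (cases "snd ?cf = []")
    case False
    then show ?thesis
      using Suc.prems[of t] unfolding map2_single[OF False] fetch_input_word by auto
  qed simp
  then have "step M [input_word n Y] (bit c t) ?cf = step M [input_word n X] (bit c t) ?cf"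
    by (auto simp: step_def split: prod.splits)
  then show ?case using Suc by (simp add: run_on_def)
qed

text \<open>A coin sequence leading to different final states must, by \<open>run_on_unread\<close>,
  read a differing position on \<open>X\<close>, so the right-hand side counts it at least
  once.\<close>

lemma hybrid_weight:
  assumes "X \<subseteq> {..<n}" "Y \<subseteq> {..<n}"
  defines "D \<equiv> {c. c < 2 ^ time n \<and> fst (run_on n X c (time n)) \<noteq> fst (run_on n Y c (time n))}"
  shows "card D \<le> (\<Sum>i\<in>sym_diff X Y. weight n X i)"
proof -
  let ?a = "\<lambda>c s. address (hd (snd (run_on n X c s)))"
  have fin: "finite (sym_diff X Y)" using finite_subset[OF assms(1)] finite_subset[OF assms(2)] by simp
  have "D \<subseteq> {..<2 ^ time n}" by (auto simp: D_def)
  then have "card D = (\<Sum>c<2 ^ time n. of_bool (c \<in> D))"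
    by (simp add: Int_absorb1 flip: Int_def)
  also have "\<dots> \<le> (\<Sum>c<2 ^ time n. \<Sum>s<time n. \<Sum>i\<in>sym_diff X Y. of_bool (?a c s = i))"
  proof (rule sum_mono)
    fix c
    show "of_bool (c \<in> D) \<le> (\<Sum>s<time n. \<Sum>i\<in>sym_diff X Y. of_bool (?a c s = i) :: nat)"
    proof (cases "c \<in> D")
      case True
      then obtain s where s: "s < time n" "?a c s \<in> sym_diff X Y"
        using run_on_unread[of "time n" n X c Y] unfolding D_def by fastforce
      have "1 = (of_bool (?a c s = ?a c s) :: nat)" by simp
      also have "\<dots> \<le> (\<Sum>i\<in>sym_diff X Y. of_bool (?a c s = i))"
        by (rule member_le_sum[where f = "\<lambda>i. of_bool (?a c s = i)"]) (use s fin in auto)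
      also have "\<dots> \<le> (\<Sum>s<time n. \<Sum>i\<in>sym_diff X Y. of_bool (?a c s = i))"
        by (rule member_le_sum[where f = "\<lambda>s. \<Sum>i\<in>sym_diff X Y. of_bool (?a c s = i)"]) (use s in auto)
      finally show ?thesis using True by simp
    qed simp
  qed
  also have "\<dots> = (\<Sum>i\<in>sym_diff X Y. weight n X i)"
    unfolding weight_def by (subst (2) sum.swap, subst sum.swap) (rule refl)
  finally show ?thesis .
qed

section \<open>Heavy positions and guesses in coded form\<close>

definition state_at :: "nat \<Rightarrow> nat \<Rightarrow> nat \<Rightarrow> nat \<Rightarrow> nat \<Rightarrow> nat" where
  "state_at n K c s i = sim n K c (min s (time n)) i"

definition weight_code :: "nat \<Rightarrow> nat \<Rightarrow> nat \<Rightarrow> nat" where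
  "weight_code n K i =
     (\<Sum>c<2 ^ time n. \<Sum>s<time n. of_bool (tape_address base (state_at n K c s 1) = i))"

definition accepting_code :: "nat \<Rightarrow> nat \<Rightarrow> bool" where
  "accepting_code n K \<longleftrightarrow>
     2 * 2 ^ time n \<le> 3 * (\<Sum>c<2 ^ time n. of_bool (state_at n K c (time n) 0 = accept) :: nat)"

definition heavy_code :: "nat \<Rightarrow> nat \<Rightarrow> nat \<Rightarrow> bool" where
  "heavy_code n K i \<longleftrightarrow> i < n \<and> 2 ^ time n \<le> 9 * time n * weight_code n K i"

definition rank_code :: "nat \<Rightarrow> nat \<Rightarrow> nat \<Rightarrow> nat" where
  "rank_code n K i = (\<Sum>i'<i. of_bool (heavy_code n K i'))"

text \<open>The sum has at most one nonzero term; it is 0 if there are at most \<open>j\<close> heavy positions.\<close>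

definition nth_heavy :: "nat \<Rightarrow> nat \<Rightarrow> nat \<Rightarrow> nat" where
  "nth_heavy n K j = (\<Sum>i<n. of_bool (heavy_code n K i \<and> rank_code n K i = j) * i)"

lemma weight_code: "weight_code n K i = weight n (set_of n K) i"
  unfolding weight_code_def weight_def
proof (intro sum.cong refl)
  fix c s assume "s \<in> {..<time n}"
  then have s: "s \<le> time n" by simp
  from represents_sim[OF s, of K c]
  have r: "length (snd (run_on n (set_of n K) c s)) = k"
    "snd (run_on n (set_of n K) c s) ! 0 = (digit base (sim n K c s 1), sim n K c s (1 + k))"
    using k_pos unfolding represents_def by auto
  then have "hd (snd (run_on n (set_of n K) c s)) = (digit base (sim n K c s 1), sim n K c s (1 + k))"
    using k_pos by (metis hd_conv_nth length_0_conv less_numeral_extra(3))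
  then show "of_bool (tape_address base (state_at n K c s 1) = i) =
      of_bool (address (hd (snd (run_on n (set_of n K) c s))) = i)"
    using tape_address[of base "sim n K c s 1"] s base_gt by (simp add: state_at_def min_def)
qed

lemma accepting_code: "accepting_code n K = accepting n (set_of n K)"
proof -
  have "state_at n K c (time n) 0 = fst (run_on n (set_of n K) c (time n))" for c
    using represents_sim[of "time n" n K c] unfolding represents_def state_at_def by simp
  then have "(\<Sum>c<2 ^ time n. of_bool (state_at n K c (time n) 0 = accept) :: nat) =
      card {c. c < 2 ^ time n \<and> fst (run_on n (set_of n K) c (time n)) = accept}"
    by (simp add: lessThan_def Int_def)
  then show ?thesis unfolding accepting_code_def accepting_def by (simp only:)
qed

lemma rank_code_strict:
  assumes "i < i'" "heavy_code n K i"
  shows "rank_code n K i < rank_code n K i'"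
proof -
  have "rank_code n K i < rank_code n K (Suc i)" using assms(2) by (simp add: rank_code_def)
  also have "\<dots> \<le> rank_code n K i'"
    unfolding rank_code_def by (rule sum_mono2) (use assms(1) in auto)
  finally show ?thesis .
qed

lemma nth_heavy_eq:
  assumes "heavy_code n K i"
  shows "nth_heavy n K (rank_code n K i) = i"
proof -
  have "nth_heavy n K (rank_code n K i) = (\<Sum>i'<n. if i' = i then i else 0)"
    unfolding nth_heavy_def
  proof (intro sum.cong refl)
    fix i'
    show "of_bool (heavy_code n K i' \<and> rank_code n K i' = rank_code n K i) * i' = (if i' = i then i else 0)"
      using rank_code_strict[of i i' n K] rank_code_strict[of i' i n K] assms
      by (cases i i' rule: linorder_cases) auto
  qed
  then show ?thesis using assms by (simp add: heavy_code_def)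
qed

lemma nth_heavy_cases: "nth_heavy n K j = 0 \<or> nth_heavy n K j < n"
proof (cases "\<exists>i. heavy_code n K i \<and> rank_code n K i = j")
  case True
  then show ?thesis using nth_heavy_eq[of n K] by (auto simp: heavy_code_def)
next
  case False
  then have "nth_heavy n K j = 0" unfolding nth_heavy_def by (intro sum.neutral) auto
  then show ?thesis by simp
qed

lemma nth_heavy_le: "nth_heavy n K j \<le> n"
  using nth_heavy_cases[of n K j] by auto

lemma rank_code_less:
  assumes "heavy_code n K i"
  shows "rank_code n K i < card {i. heavy_code n K i}"
proof -
  have fin: "finite {i. heavy_code n K i}" by (rule finite_subset[of _ "{..<n}"]) (auto simp: heavy_code_def)
  have "rank_code n K i = card {i'. i' < i \<and> heavy_code n K i'}"
    unfolding rank_code_def by (simp add: lessThan_def Int_def)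
  also have "\<dots> < card {i. heavy_code n K i}"
    by (rule psubset_card_mono[OF fin]) (use assms in auto)
  finally show ?thesis .
qed

text \<open>\<open>9 * time n * time n\<close> is the bound of \<open>card_heavy\<close>. The factor
  \<open>bitlen n\<close> is at least 1 for positive \<open>n\<close> and suppresses all queries for
  \<open>n = 0\<close>, where there is no position to ask for.\<close>

definition queries :: "nat \<Rightarrow> nat" where
  "queries n = 9 * time n * time n * bitlen n"

definition rounds :: "nat \<Rightarrow> nat" where
  "rounds n = 6 * time n + 1"

text \<open>The queries of a round refer to the guess \<open>K\<close> at its beginning, not to the
  growing one.\<close>

primrec collect :: "nat \<Rightarrow> nat \<Rightarrow> (nat \<Rightarrow> bool) \<Rightarrow> nat \<Rightarrow> nat" where
  "collect n K \<alpha> 0 = K"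
| "collect n K \<alpha> (Suc j) =
     (if \<alpha> j then add_elem n (collect n K \<alpha> j) (nth_heavy n K j) else collect n K \<alpha> j)"

text \<open>This replays the rounds from a mere sequence of answers, as preprocessing without an
  input must do; \<open>true_known\<close> below is the guess for the actual answers.\<close>

primrec known :: "nat \<Rightarrow> (nat \<Rightarrow> bool) \<Rightarrow> nat \<Rightarrow> nat" where
  "known n \<alpha> 0 = 0"
| "known n \<alpha> (Suc r) = collect n (known n \<alpha> r) (\<lambda>j. \<alpha> (r * queries n + j)) (queries n)"

primrec true_known :: "nat \<Rightarrow> nat set \<Rightarrow> nat \<Rightarrow> nat" where
  "true_known n X 0 = 0"
| "true_known n X (Suc r) =
     collect n (true_known n X r) (\<lambda>j. nth_heavy n (true_known n X r) j \<in> X) (queries n)"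

definition true_query :: "nat \<Rightarrow> nat set \<Rightarrow> nat \<Rightarrow> nat" where
  "true_query n X q = nth_heavy n (true_known n X (q div queries n)) (q mod queries n)"

lemma collect_cong: "(\<And>i. i < j \<Longrightarrow> \<alpha> i = \<beta> i) \<Longrightarrow> collect n K \<alpha> j = collect n K \<beta> j"
  by (induction j) auto

lemma known_eq_true_known:
  assumes "\<And>q. q < r * queries n \<Longrightarrow> \<alpha> q \<longleftrightarrow> true_query n X q \<in> X"
  shows "known n \<alpha> r = true_known n X r"
  using assms
proof (induction r)
  case (Suc r)
  have IH: "known n \<alpha> r = true_known n X r" by (rule Suc.IH) (use Suc.prems in auto)
  have "\<alpha> (r * queries n + j) \<longleftrightarrow> nth_heavy n (true_known n X r) j \<in> X" if "j < queries n" for j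
    using Suc.prems[of "r * queries n + j"] that by (simp add: true_query_def)
  then show ?case unfolding known.simps true_known.simps IH by (rule collect_cong)
qed simp

text \<open>Only members of \<open>X\<close> enter the guess, so surplus queries to the default
  position 0 do no harm.\<close>

lemma set_of_collect:
  "set_of n (collect n K (\<lambda>j. nth_heavy n K j \<in> X) m) =
     set_of n K \<union> (nth_heavy n K ` {..<m} \<inter> X)"
  by (induction m) (auto simp: set_of_add_elem nth_heavy_le less_Suc_eq)

end

section \<open>Correctness of the last guess\<close>

locale deciding_machine = randomized_machine +
  fixes L :: "bool list set" and T :: "nat \<Rightarrow> nat"
  assumes decides: "rand_decides M T L" and T_le: "T n \<le> time n"
begin

definition verdict_count :: "nat \<Rightarrow> nat set \<Rightarrow> nat \<Rightarrow> nat" where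
  "verdict_count n X v = card {c. c < 2 ^ time n \<and> fst (run_on n X c (time n)) = v}"

lemma verdict_count_ge: "2 * 2 ^ time n \<le> 3 * verdict_count n X (verdict L (input_word n X))"
proof -
  let ?x = "input_word n X" and ?p = "\<lambda>t. measure_pmf.prob (rand_run M [input_word n X] t) {cf. fst cf = verdict L (input_word n X)}"
  have "2/3 \<le> ?p (T n)" using decides unfolding rand_decides_def by (metis length_input_word)
  also have "\<dots> \<le> ?p (time n)" by (rule prob_halted_mono[OF T_le]) (simp add: verdict_def)
  finally have "2/3 * 2 ^ time n \<le> ?p (time n) * 2 ^ time n" by (rule mult_right_mono) simp
  also have "\<dots> = real (verdict_count n X (verdict L ?x))"
    unfolding prob_rand_run verdict_count_def run_on_def ..
  finally have "real (2 * 2 ^ time n) \<le> real (3 * verdict_count n X (verdict L ?x))" by simp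
  then show ?thesis by (simp only: of_nat_le_iff)
qed

lemma verdict_count_sum: "verdict_count n X accept + verdict_count n X reject \<le> 2 ^ time n"
proof -
  have "verdict_count n X accept + verdict_count n X reject =
    card ({c. c < 2 ^ time n \<and> fst (run_on n X c (time n)) = accept} \<union>
          {c. c < 2 ^ time n \<and> fst (run_on n X c (time n)) = reject})"
    unfolding verdict_count_def by (rule card_Un_disjoint[symmetric]) auto
  also have "\<dots> \<le> card {..<2 ^ time n :: nat}" by (rule card_mono) auto
  finally show ?thesis by simp
qed

text \<open>The error bound holds on every input, so the fraction of accepting coin sequences never
  lies strictly between 1/3 and 2/3.\<close>

lemma accepting_cases:
  "accepting n X \<and> input_word n X \<in> L \<and> 2 * 2 ^ time n \<le> 3 * verdict_count n X accept \<or>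
   \<not> accepting n X \<and> input_word n X \<notin> L \<and> 3 * verdict_count n X accept \<le> 2 ^ time n"
proof -
  have a: "accepting n X \<longleftrightarrow> 2 * 2 ^ time n \<le> 3 * verdict_count n X accept"
    by (simp add: accepting_def verdict_count_def)
  have p: "(0::nat) < 2 ^ time n" by simp
  show ?thesis
  proof (cases "input_word n X \<in> L")
    case True
    then show ?thesis using a verdict_count_ge[of n X] by (simp add: verdict_def)
  next
    case False
    then have "2 * 2 ^ time n \<le> 3 * verdict_count n X reject"
      using verdict_count_ge[of n X] by (simp add: verdict_def)
    then have "3 * verdict_count n X accept \<le> 2 ^ time n"
      using verdict_count_sum[of n X] by linarith
    then show ?thesis using a False p by linarith
  qed
qed

lemma verdict_count_diff:
  assumes "X \<subseteq> {..<n}" "Y \<subseteq> {..<n}"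
  defines "D \<equiv> {c. c < 2 ^ time n \<and> fst (run_on n X c (time n)) \<noteq> fst (run_on n Y c (time n))}"
  shows "verdict_count n X v \<le> verdict_count n Y v + card D"
    "verdict_count n Y v \<le> verdict_count n X v + card D"
proof -
  have "verdict_count n X v \<le> card ({c. c < 2 ^ time n \<and> fst (run_on n Y c (time n)) = v} \<union> D)"
    unfolding verdict_count_def D_def by (rule card_mono) auto
  also have "\<dots> \<le> verdict_count n Y v + card D" unfolding verdict_count_def by (rule card_Un_le)
  finally show "verdict_count n X v \<le> verdict_count n Y v + card D" .
  have "verdict_count n Y v \<le> card ({c. c < 2 ^ time n \<and> fst (run_on n X c (time n)) = v} \<union> D)"
    unfolding verdict_count_def D_def by (rule card_mono) auto
  also have "\<dots> \<le> verdict_count n X v + card D" unfolding verdict_count_def by (rule card_Un_le)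
  finally show "verdict_count n Y v \<le> verdict_count n X v + card D" .
qed

lemma query_weights: "query_weights {..<n} (weight n) (accepting n) (2 ^ time n) (time n)"
proof
  fix X assume "X \<subseteq> {..<n}"
  show "(\<Sum>i<n. weight n X i) \<le> time n * 2 ^ time n" by (rule total_weight)
next
  fix X Y assume XY: "X \<subseteq> {..<n}" "Y \<subseteq> {..<n}" "accepting n X \<noteq> accepting n Y"
  \<comment> \<open>The acceptance counts of \<open>X\<close> and \<open>Y\<close> differ by at
    least a third of \<open>2 ^ time n\<close>, but by no more than the number of coin sequences
    with different final states.\<close>
  show "2 ^ time n \<le> 3 * (\<Sum>i\<in>sym_diff X Y. weight n X i)"
    using hybrid_weight[OF XY(1,2)] verdict_count_diff[OF XY(1,2), of accept] XY(3)
      accepting_cases[of n X] accepting_cases[of n Y] by linarith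
qed (auto)

lemma true_known_correct:
  assumes "X \<subseteq> {..<n}"
  shows "accepting_code n (true_known n X (rounds n)) \<longleftrightarrow> input_word n X \<in> L"
proof -
  interpret qw: query_weights "{..<n}" "weight n" "accepting n" "2 ^ time n" "time n"
    by (rule query_weights)
  define K where "K r = set_of n (true_known n X r)" for r
  have Suc: "K (Suc r) = K r \<union> (nth_heavy n (true_known n X r) ` {..<queries n} \<inter> X)" for r
    unfolding K_def by (simp add: set_of_collect)
  have KX: "K r \<subseteq> X" for r by (induction r) (auto simp: Suc, simp add: K_def)
  have heavy: "qw.heavy (K r) = {i. heavy_code n (true_known n X r) i}" for r
    unfolding qw.heavy_def heavy_code_def weight_code K_def by auto
  \<comment> \<open>There are at most \<open>queries n\<close> heavy positions, so the rank of each
    of them is among the indices asked for in a round.\<close>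
  have sub: "qw.heavy (K r) \<subseteq> nth_heavy n (true_known n X r) ` {..<queries n}" for r
  proof
    fix i assume i: "i \<in> qw.heavy (K r)"
    then have h: "heavy_code n (true_known n X r) i" unfolding heavy by simp
    then have "0 < n" by (auto simp: heavy_code_def)
    then have "0 < bitlen n" by (simp add: less_bitlen_iff Suc_le_eq)
    then have "9 * time n * time n * 1 \<le> queries n" unfolding queries_def by (intro mult_le_mono2) simp
    moreover have "card (qw.heavy (K r)) \<le> 9 * time n * time n"
      by (rule qw.card_heavy) (use KX assms in blast)
    ultimately have "rank_code n (true_known n X r) i < queries n"
      using rank_code_less[OF h] unfolding heavy by linarith
    then show "i \<in> nth_heavy n (true_known n X r) ` {..<queries n}"
      using nth_heavy_eq[OF h] by (intro image_eqI[of _ _ "rank_code n (true_known n X r) i"]) auto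
  qed
  have "accepting n (K (rounds n)) = accepting n X"
  proof (rule qw.rounds_determine)
    show "qw.heavy (K r) \<inter> X \<subseteq> K (Suc r)" for r using sub[of r] unfolding Suc by blast
  qed (use KX assms Suc in \<open>auto simp: rounds_def\<close>)
  then show ?thesis using accepting_cases[of n X] unfolding accepting_code K_def by blast
qed

end

section \<open>The table and its computability\<close>

context randomized_machine
begin

text \<open>A position of the table is a numeral whose bits, the leading one excluded, record the past
  of the computation of the deterministic machine.  For each query there are \<open>2 l\<close> bits that
  carry no information, followed by the answer, where \<open>l\<close> is the number of bits of
  the queried position.\<close>

definition block :: "nat \<Rightarrow> nat" where
  "block n = 2 * bitlen n + 1"

definition answer :: "nat \<Rightarrow> nat \<Rightarrow> nat \<Rightarrow> bool" where
  "answer n m q \<longleftrightarrow> digit 2 m (block n * q + 2 * bitlen n) = 1"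

definition total_queries :: "nat \<Rightarrow> nat" where
  "total_queries n = rounds n * queries n"

text \<open>The cap at \<open>rounds n\<close> keeps the code quasipolynomial for every
  \<open>r\<close>.\<close>

definition known_code :: "nat \<Rightarrow> nat \<Rightarrow> nat \<Rightarrow> nat" where
  "known_code n m r = known n (answer n m) (min r (rounds n))"

text \<open>The out-of-range query to position \<open>n\<close> tells the deterministic machine to stop.\<close>

definition query_code :: "nat \<Rightarrow> nat \<Rightarrow> nat \<Rightarrow> nat" where
  "query_code n m q =
     (if q < total_queries n then nth_heavy n (known_code n m (q div queries n)) (q mod queries n) else n)"

text \<open>The leading bit makes the length of the past, \<open>bitlen m - 1\<close>, recoverable;
  \<open>q\<close> is the number of the current query and \<open>j\<close> the place within its
  block. At even \<open>j\<close> the entry says whether another address bit follows, at odd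
  \<open>j\<close> it is that bit. After the block of the stopping query the entry is the
  verdict.\<close>

definition table :: "nat \<Rightarrow> nat \<Rightarrow> nat" where
  "table n m =
     (let q = (bitlen m - 1) div block n; j = (bitlen m - 1) mod block n in
      if q \<le> total_queries n then
        if j = 2 * bitlen n then 0
        else if j mod 2 = 0 then 1
        else digit 2 (query_code n m q) (j div 2)
      else of_bool (accepting_code n (known_code n m (rounds n))))"

definition table_size :: "nat \<Rightarrow> nat" where
  "table_size n = 2 ^ (block n * (total_queries n + 1) + 1)"

lemma qcomp_state_at:
  assumes "i0 < 2 * k + 1" "qcomp n" "qcomp K" "qcomp c" "qcomp s"
  shows "qcomp (\<lambda>e. state_at (n e) (K e) (c e) (s e) i0)"
  unfolding state_at_def by (rule qcomp_sim[OF assms])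

lemma qcomp_pow2_time: "qcomp n \<Longrightarrow> qcomp (\<lambda>e. 2 ^ time (n e))"
  by (intro qcomp_power qcomp_const qcomp_time eplog_time qcomp_ebounded)

lemma qcomp_weight_code:
  assumes "qcomp n" "qcomp K" "qcomp i"
  shows "qcomp (\<lambda>e. weight_code (n e) (K e) (i e))"
proof (rule qcomp_comp3[OF _ assms])
  show "qcomp (\<lambda>e. weight_code (e 0) (e (Suc 0)) (e (Suc (Suc 0))))"
    unfolding weight_code_def
    apply (rule qcomp_sum[where s = "\<lambda>e c. \<Sum>s<time (e 0). of_bool (tape_address base (state_at (e 0) (e (Suc 0)) c s 1) = e (Suc (Suc 0)))"])
     apply (intro qcomp_pow2_time qcomp_var)
    apply (rule qcomp_sum[where s = "\<lambda>e s. of_bool (tape_address base (state_at (e (Suc 0)) (e (Suc (Suc 0))) (e 0) s 1) = e (Suc (Suc (Suc 0))))"])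
    using base_gt k_pos by (intro qcomp_time qcomp_intros qcomp_tape_address qcomp_state_at; simp)+
qed

lemma qdec_accepting_code:
  assumes "qcomp n" "qcomp K"
  shows "qdec (\<lambda>e. accepting_code (n e) (K e))"
proof -
  have "qdec (\<lambda>e. accepting_code (e 0) (e (Suc 0)))"
    unfolding accepting_code_def
    by (intro qdec_le qcomp_mult qcomp_const qcomp_pow2_time qcomp_var
      qcomp_sum[where s = "\<lambda>e c. of_bool (state_at (e 0) (e (Suc 0)) c (time (e 0)) 0 = accept)"]
      qcomp_of_bool qdec_eq qcomp_state_at qcomp_time) simp
  then show ?thesis
    unfolding qdec_def by (rule qcomp_comp2[where F = "\<lambda>n K. of_bool (accepting_code n K)", OF _ assms])
qed

lemma qdec_heavy_code:
  assumes "qcomp n" "qcomp K" "qcomp i"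
  shows "qdec (\<lambda>e. heavy_code (n e) (K e) (i e))"
  unfolding heavy_code_def
  by (intro qdec_conj qdec_less qdec_le qcomp_mult qcomp_const qcomp_pow2_time qcomp_time qcomp_weight_code assms)

lemma qcomp_rank_code:
  assumes "qcomp n" "qcomp K" "qcomp i"
  shows "qcomp (\<lambda>e. rank_code (n e) (K e) (i e))"
proof (rule qcomp_comp3[OF _ assms])
  show "qcomp (\<lambda>e. rank_code (e 0) (e (Suc 0)) (e (Suc (Suc 0))))"
    unfolding rank_code_def
    by (intro qcomp_sum[where s = "\<lambda>e i. of_bool (heavy_code (e 0) (e (Suc 0)) i)"]
        qcomp_of_bool qdec_heavy_code qcomp_var)
qed

lemma qcomp_nth_heavy:
  assumes "qcomp n" "qcomp K" "qcomp j"
  shows "qcomp (\<lambda>e. nth_heavy (n e) (K e) (j e))"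
proof (rule qcomp_comp3[OF _ assms])
  show "qcomp (\<lambda>e. nth_heavy (e 0) (e (Suc 0)) (e (Suc (Suc 0))))"
    unfolding nth_heavy_def
    by (intro qcomp_sum[where s = "\<lambda>e i. of_bool (heavy_code (e 0) (e (Suc 0)) i \<and>
          rank_code (e 0) (e (Suc 0)) i = e (Suc (Suc 0))) * i"]
        qcomp_mult qcomp_of_bool qdec_conj qdec_eq qdec_heavy_code qcomp_rank_code qcomp_var)
qed

lemma qcomp_queries: "qcomp n \<Longrightarrow> qcomp (\<lambda>e. queries (n e))"
  unfolding queries_def by (intro qcomp_mult qcomp_const qcomp_time qcomp_bitlen)

lemma qcomp_rounds: "qcomp n \<Longrightarrow> qcomp (\<lambda>e. rounds (n e))"
  unfolding rounds_def by (intro qcomp_add qcomp_mult qcomp_const qcomp_time)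

lemma eplog_queries: "ebounded n \<Longrightarrow> eplog (\<lambda>e. queries (n e))"
  unfolding queries_def by (intro eplog_mult eplog_const eplog_time eplog_bitlen)

lemma eplog_rounds: "ebounded n \<Longrightarrow> eplog (\<lambda>e. rounds (n e))"
  unfolding rounds_def by (intro eplog_add eplog_mult eplog_const eplog_time)

lemma qdec_answer:
  assumes "qcomp n" "qcomp m" "qcomp q"
  shows "qdec (\<lambda>e. answer (n e) (m e) (q e))"
  unfolding answer_def block_def by (intro qcomp_intros qcomp_digit assms) simp

text \<open>With \<open>Suc\<close> on both sides the bound becomes multiplicative: appending a
  digit at most \<open>n + 1\<close> multiplies the successor by at most
  \<open>n + 2\<close>.\<close>

lemma collect_le: "Suc (collect n K \<alpha> j) \<le> Suc K * (n + 2) ^ j"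
proof (induction j)
  case (Suc j)
  have "Suc (collect n K \<alpha> (Suc j)) \<le> Suc (collect n K \<alpha> j) * (n + 2)"
    using nth_heavy_le[of n K j] by (auto simp: add_elem_def)
  also have "\<dots> \<le> Suc K * (n + 2) ^ j * (n + 2)" by (rule mult_le_mono1[OF Suc.IH])
  finally show ?case by (simp only: power_Suc ac_simps)
qed simp

lemma known_le: "Suc (known n \<alpha> r) \<le> (n + 2) ^ (r * queries n)"
proof (induction r)
  case (Suc r)
  have "Suc (known n \<alpha> (Suc r)) \<le> Suc (known n \<alpha> r) * (n + 2) ^ queries n"
    unfolding known.simps by (rule collect_le)
  also have "\<dots> \<le> (n + 2) ^ (r * queries n) * (n + 2) ^ queries n" by (rule mult_le_mono1[OF Suc.IH])
  finally show ?case by (simp only: power_add[symmetric] mult_Suc ac_simps)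
qed simp

lemma collect_rec:
  "collect n K \<alpha> j = rec_nat K (\<lambda>j x. if \<alpha> j then add_elem n x (nth_heavy n K j) else x) j"
  by (induction j) auto

lemma known_rec:
  "known n \<alpha> r = rec_nat 0 (\<lambda>r x. collect n x (\<lambda>j. \<alpha> (r * queries n + j)) (queries n)) r"
  by (induction r) auto

lemma qcomp_collect:
  assumes "qcomp n" "qcomp K" "qcomp m" "qcomp r"
  shows "qcomp (\<lambda>e. collect (n e) (K e) (\<lambda>j. answer (n e) (m e) (r e * queries (n e) + j)) (queries (n e)))"
proof (rule qcomp_comp4[where F = "\<lambda>n K m r. collect n K (\<lambda>j. answer n m (r * queries n + j)) (queries n)",
      OF _ assms])
  let ?st = "\<lambda>e j x. if answer (e 0) (e (Suc (Suc 0))) (e (Suc (Suc (Suc 0))) * queries (e 0) + j)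
      then add_elem (e 0) x (nth_heavy (e 0) (e (Suc 0)) j) else x"
  have "qcomp (\<lambda>e. rec_nat (e (Suc 0)) (?st e) (queries (e 0)))"
  proof (rule qcomp_rec[where st = ?st and g = "\<lambda>e. Suc (e (Suc 0)) * (e 0 + 2) ^ queries (e 0)"])
    show "qcomp (\<lambda>e. ?st (\<lambda>j. e (Suc (Suc j))) (e 0) (e (Suc 0)))"
      unfolding add_elem_def
      by (intro qcomp_if qdec_answer qcomp_add qcomp_mult qcomp_Suc qcomp_const qcomp_var qcomp_queries qcomp_nth_heavy)
    show "ebounded (\<lambda>e. Suc (e (Suc 0)) * (e 0 + 2) ^ queries (e 0))"
      by (intro ebounded_mult ebounded_power eplog_queries qcomp_ebounded qcomp_intros)
    show "rec_nat (e (Suc 0)) (?st e) x \<le> Suc (e (Suc 0)) * (e 0 + 2) ^ queries (e 0)"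
      if "x \<le> queries (e 0)" for e x
    proof -
      have "Suc (rec_nat (e (Suc 0)) (?st e) x) \<le> Suc (e (Suc 0)) * (e 0 + 2) ^ x"
        using collect_le[of "e 0" "e (Suc 0)" "\<lambda>j. answer (e 0) (e (Suc (Suc 0))) (e (Suc (Suc (Suc 0))) * queries (e 0) + j)" x]
        unfolding collect_rec .
      also have "\<dots> \<le> Suc (e (Suc 0)) * (e 0 + 2) ^ queries (e 0)"
        using that by (intro mult_le_mono2 power_increasing) auto
      finally show ?thesis by simp
    qed
  qed (intro qcomp_var qcomp_queries)+
  then show "qcomp (\<lambda>e. collect (e 0) (e (Suc 0)) (\<lambda>j. answer (e 0) (e (Suc (Suc 0)))
      (e (Suc (Suc (Suc 0))) * queries (e 0) + j)) (queries (e 0)))"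
    unfolding collect_rec .
qed

lemma qcomp_known_code:
  assumes "qcomp n" "qcomp m" "qcomp r"
  shows "qcomp (\<lambda>e. known_code (n e) (m e) (r e))"
proof (rule qcomp_comp3[OF _ assms])
  let ?st = "\<lambda>e r x. collect (e 0) x (\<lambda>j. answer (e 0) (e (Suc 0)) (r * queries (e 0) + j)) (queries (e 0))"
  have "qcomp (\<lambda>e. rec_nat 0 (?st e) (min (e (Suc (Suc 0))) (rounds (e 0))))"
  proof (rule qcomp_rec[where st = ?st and g = "\<lambda>e. (e 0 + 2) ^ (rounds (e 0) * queries (e 0))"])
    show "qcomp (\<lambda>e. ?st (\<lambda>j. e (Suc (Suc j))) (e 0) (e (Suc 0)))"
      by (intro qcomp_collect qcomp_var)
    show "ebounded (\<lambda>e. (e 0 + 2) ^ (rounds (e 0) * queries (e 0)))"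
      by (intro ebounded_power eplog_mult eplog_rounds eplog_queries qcomp_ebounded qcomp_intros)
    show "rec_nat 0 (?st e) x \<le> (e 0 + 2) ^ (rounds (e 0) * queries (e 0))"
      if "x \<le> min (e (Suc (Suc 0))) (rounds (e 0))" for e x
    proof -
      have "Suc (rec_nat 0 (?st e) x) \<le> (e 0 + 2) ^ (x * queries (e 0))"
        using known_le[of "e 0" "answer (e 0) (e (Suc 0))" x] unfolding known_rec .
      also have "\<dots> \<le> (e 0 + 2) ^ (rounds (e 0) * queries (e 0))"
        using that by (intro power_increasing mult_le_mono1) auto
      finally show ?thesis by simp
    qed
  qed (intro qcomp_min qcomp_rounds qcomp_var qcomp_zero)+
  then show "qcomp (\<lambda>e. known_code (e 0) (e (Suc 0)) (e (Suc (Suc 0))))"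
    unfolding known_code_def known_rec .
qed

lemma qcomp_query_code:
  assumes "qcomp n" "qcomp m" "qcomp q"
  shows "qcomp (\<lambda>e. query_code (n e) (m e) (q e))"
  unfolding query_code_def total_queries_def
  by (intro qcomp_intros qcomp_nth_heavy qcomp_known_code qcomp_rounds qcomp_queries assms)

lemma qcomp_table:
  assumes "qcomp n" "qcomp m"
  shows "qcomp (\<lambda>e. table (n e) (m e))"
  unfolding table_def Let_def total_queries_def block_def
  by (intro qcomp_intros qcomp_digit qcomp_query_code qcomp_rounds qcomp_queries
      qdec_accepting_code qcomp_known_code assms) simp

lemma qcomp_table_size:
  assumes "qcomp n"
  shows "qcomp (\<lambda>e. table_size (n e))"
  unfolding table_size_def total_queries_def block_def
  by (intro qcomp_power qcomp_intros qcomp_rounds qcomp_queries eplog_add eplog_mult eplog_const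
      eplog_rounds eplog_queries eplog_bitlen qcomp_ebounded assms)

end

section \<open>The preprocessing machine\<close>

definition bits_tape :: "bool list \<Rightarrow> nat \<Rightarrow> tape" where
  "bits_tape w h = ((\<lambda>i. if i < length w then if w ! i then 2 else 1 else 0), h)"

abbreviation "symbol b \<equiv> (if b then 2 else 1 :: nat)"

lemma tape_word_bits_tape [simp]: "tape_word (bits_tape w h) = w"
proof -
  have "(LEAST i. fst (bits_tape w h) i \<notin> {1, 2}) = length w"
    by (rule Least_equality) (auto simp: bits_tape_def split: if_splits intro: leI)
  then show ?thesis unfolding tape_word_def by (auto simp: bits_tape_def intro: nth_equalityI)
qed

lemma address_bits_tape: "address (bits_tape w h) = horner_sum of_bool 2 w"
  by (simp add: address_def)

lemma act_bits_tape:
  "h < length w \<Longrightarrow> act (symbol b, d) (bits_tape w h) = bits_tape (w[h := b]) (move_head d h)"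
  by (auto simp: bits_tape_def fun_eq_iff nth_list_update)

lemma act_bits_tape_append:
  "act (symbol b, d) (bits_tape w (length w)) = bits_tape (w @ [b]) (move_head d (length w))"
  by (auto simp: bits_tape_def fun_eq_iff nth_append)

lemma act_bits_tape_move:
  "act (case bits_tape w h of (f, h) \<Rightarrow> f h, d) (bits_tape w h) = bits_tape w (move_head d h)"
  by (auto simp: bits_tape_def fun_eq_iff)

lemma map2_act_update:
  "length as = length tps \<Longrightarrow> j < length tps \<Longrightarrow>
     map2 act (as[j := a]) tps = (map2 act as tps)[j := act a (tps ! j)]"
  by (rule nth_equalityI) (auto simp: nth_list_update)

lemma length_move_counter [simp]: "length (move_counter d r v) = length (snd v)"
  by (simp add: move_counter_def)

lemma counters_0 [simp]: "counters K tp s tp' ! 0 = tp" "(counters K tp s tp')[0 := x] = counters K x s tp'"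
  by (simp_all add: counters_def)

lemma counters_last [simp]:
  "counters K tp s tp' ! Suc K = tp'" "(counters K tp s tp')[Suc K := x] = counters K tp s x"
  by (simp_all add: counters_def nth_append list_update_append)

lemma fetch_counters:
  "fst (view_of [w] (counters K tp s tp')) ! 0 = fetch w tp"
  by (simp add: view_of_def counters_def)

lemma symbol_counters: "snd (view_of ws (counters K tp s tp')) ! 0 = (case tp of (f, h) \<Rightarrow> f h)"
  by (simp add: view_counters)

lemma valid_update:
  assumes "length as = k \<and> fst ` set as \<subseteq> {..<3}" "a < 3"
  shows "length (as[j := (a, d)]) = k \<and> fst ` set (as[j := (a, d)]) \<subseteq> {..<3::nat}"
proof -
  have "fst ` set (as[j := (a, d)]) \<subseteq> fst ` insert (a, d) (set as)"
    by (rule image_mono) (rule set_update_subset_insert)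
  then show ?thesis using assms by fastforce
qed

lemma valid_move_counter:
  assumes "length ss = k" "set ss \<subseteq> {..<3}" "r + 1 < k"
  shows "length (move_counter d r (rs, ss)) = k \<and> fst ` set (move_counter d r (rs, ss)) \<subseteq> {..<3}"
proof -
  have "ss ! (r + 1) \<in> set ss" using assms by (intro nth_mem) simp
  then have "ss ! (r + 1) < 3" using assms by blast
  then show ?thesis unfolding move_counter_def using assms by (intro valid_update idle_valid) auto
qed

definition mark_counters :: prog where
  "mark_counters = Act (\<lambda>(rs, ss). map (\<lambda>j. (if 0 < j \<and> j + 1 < length ss then 1 else 0, Stay)) [0..<length ss])"

definition write_one :: prog where
  "write_one = Act (\<lambda>v. (move_counter Move_Right 1 v)[0 := (2, Move_Right)])"

definition step_back :: prog where
  "step_back = Act (\<lambda>v. (move_counter Move_Left 1 v)[0 := (snd v ! 0, Move_Left)])"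

definition write_zero :: prog where
  "write_zero = Act (\<lambda>v. (idle v)[0 := (1, Stay)])"

definition double :: prog where
  "double = transfer 0 2 ;; While (nonzero 2) (Dec 2 ;; Inc 0 ;; Inc 0)"

definition set_bit :: prog where
  "set_bit = Act (\<lambda>v. (move_counter Move_Right 0 v)[0 := (2, Stay)])"

text \<open>The length \<open>n\<close> of the input is found by binary search for the first address beyond its
  end.  When \<open>j\<close> bits remain to be determined, these are all 1 on the address tape and
  counter 0 holds \<open>n div 2 ^ j\<close>.\<close>

definition read_length :: prog where
  "read_length = While (\<lambda>v. fst v ! 0 \<noteq> None) write_one ;;
     While (nonzero 1) (step_back ;; write_zero ;; double ;;
       If_then_else (\<lambda>v. fst v ! 0 = None) Skip set_bit)"

lemma bitlen_pos: "0 < n \<Longrightarrow> 0 < bitlen n"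
  by (simp add: less_bitlen_iff Suc_le_eq)

lemma valid_mark_counters: "valid_prog k mark_counters"
  unfolding mark_counters_def by auto

lemma valid_tape0_acts:
  assumes "4 \<le> k"
  shows "valid_prog k write_one" "valid_prog k step_back" "valid_prog k write_zero" "valid_prog k set_bit"
proof -
  have s: "ss ! 0 < 3" if "length ss = k" "set ss \<subseteq> {..<3}" for ss :: "nat list"
    using that assms nth_mem[of 0 ss] by (metis lessThan_iff subset_code(1) less_le_trans zero_less_numeral)
  show "valid_prog k write_one" "valid_prog k write_zero" "valid_prog k set_bit"
    unfolding write_one_def write_zero_def set_bit_def valid_prog.simps using assms
    by (intro allI impI valid_update valid_move_counter idle_valid; simp)+
  show "valid_prog k step_back"
    unfolding step_back_def valid_prog.simps using assms s
    by (intro allI impI valid_update valid_move_counter; simp)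
qed

lemma valid_read_length: "3 \<le> K \<Longrightarrow> valid_prog (K + 2) read_length"
  unfolding read_length_def double_def
  using valid_tape0_acts[of "K + 2"] cvalid_macros(1)[of 0 3 2] cvalid_move_counter[of 2 3] cvalid_move_counter[of 0 3]
  by (simp add: cvalid_def)

lemma exec_mark_counters:
  "exec ws mark_counters 1 (replicate (K + 2) (\<lambda>_. 0, 0))
     (counters K (bits_tape [] 0) (\<lambda>_. 0) (bits_tape [] 0))"
  unfolding mark_counters_def
proof (rule exec_Act, rule nth_equalityI)
  fix j assume "j < length (map2 act (case view_of ws (replicate (K + 2) (\<lambda>_. 0, 0)) of (rs, ss) \<Rightarrow>
      map (\<lambda>j. (if 0 < j \<and> j + 1 < length ss then 1 else 0, Stay)) [0..<length ss]) (replicate (K + 2) (\<lambda>_. 0, 0)))"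
  then have j: "j < K + 2" by (simp add: view_of_def)
  then consider "j = 0" | j' where "j = Suc j'" "j' < K" | "j = Suc K" by (cases j) (auto simp: less_Suc_eq)
  then show "map2 act (case view_of ws (replicate (K + 2) (\<lambda>_. 0, 0)) of (rs, ss) \<Rightarrow>
      map (\<lambda>j. (if 0 < j \<and> j + 1 < length ss then 1 else 0, Stay)) [0..<length ss]) (replicate (K + 2) (\<lambda>_. 0, 0)) ! j
      = counters K (bits_tape [] 0) (\<lambda>_. 0) (bits_tape [] 0) ! j"
    by cases (auto simp: view_of_def nth_counters counter_def bits_tape_def fun_eq_iff simp del: replicate.simps upt_Suc)
qed (simp add: view_of_def)

lemma cexec_double:
  assumes "s 2 = 0" "s 0 = x"
  shows "cexec 3 double (13 * x + 3) s (s(0 := 2 * x))"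
proof -
  have 1: "cexec 3 (transfer 0 2) (5 * x + 1) s (s(0 := 0, 2 := x))"
    using cexec_transfer[of 0 3 2 s x] assms by simp
  define \<sigma> where "\<sigma> j = s(0 := 2 * j, 2 := x - j)" for j
  have "cexec 3 (While (nonzero 2) (Dec 2 ;; Inc 0 ;; Inc 0)) (x * (5 + 2) + 1) (\<sigma> 0) (\<sigma> x)"
  proof (rule cexec_While)
    fix j assume j: "j < x"
    define a where "a = (\<sigma> j)(2 := \<sigma> j 2 - 1)"
    define b where "b = a(0 := Suc (a 0))"
    have "cexec 3 (Dec 2 ;; Inc 0 ;; Inc 0) (1 + (1 + 1 + 1) + 1) (\<sigma> j) (b(0 := Suc (b 0)))"
      unfolding b_def a_def by (rule cexec_Seq[OF cexec_Dec cexec_Seq[OF cexec_Inc cexec_Inc]]) auto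
    also have "b(0 := Suc (b 0)) = \<sigma> (Suc j)"
      using j by (auto simp: \<sigma>_def a_def b_def fun_eq_iff)
    finally show "cexec 3 (Dec 2 ;; Inc 0 ;; Inc 0) 5 (\<sigma> j) (\<sigma> (Suc j))" by (simp add: eval_nat_numeral)
  qed (auto simp: \<sigma>_def)
  moreover have "\<sigma> 0 = s(0 := 0, 2 := x)" "\<sigma> x = s(0 := 2 * x)"
    using assms by (auto simp: \<sigma>_def fun_eq_iff)
  ultimately have "cexec 3 (While (nonzero 2) (Dec 2 ;; Inc 0 ;; Inc 0)) (x * (5 + 2) + 1)
      (s(0 := 0, 2 := x)) (s(0 := 2 * x))" by (simp only:)
  from cexec_Seq[OF 1 this] show ?thesis unfolding double_def by (rule cexec_mono) auto
qed

text \<open>Adding 1 carries through the \<open>j\<close> low ones. So with all undetermined bits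
  set to 1, the search compares \<open>n\<close> with a multiple of \<open>2 ^ j\<close>.\<close>

lemma horner_ones: "Suc (horner_sum of_bool 2 (replicate j True @ w)) = 2 ^ j * Suc (horner_sum of_bool 2 w)"
  by (induction j) (auto simp: algebra_simps)

lemma horner_bits:
  fixes n :: nat
  assumes "n < 2 ^ l" "j \<le> l"
  shows "horner_sum of_bool 2 (map (bit n) [j..<l]) = n div 2 ^ j"
proof -
  have "map (bit n) [j..<l] = map (bit (n div 2 ^ j)) [0..<l - j]"
    by (rule nth_equalityI) (auto simp: bit_iff_odd div_mult2_eq power_add)
  also have "horner_sum of_bool 2 \<dots> = take_bit (l - j) (n div 2 ^ j)"
    by (rule horner_sum_bit_eq_take_bit)
  also have "n div 2 ^ j < 2 ^ (l - j)"
    using assms by (simp add: div_less_iff_less_mult flip: power_add)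
  then have "take_bit (l - j) (n div 2 ^ j) = n div 2 ^ j" by (simp add: take_bit_nat_def)
  finally show ?thesis .
qed

text \<open>Each bit costs the doubling of a unary counter, linear in \<open>n\<close>. As
  \<open>bitlen n \<le> n\<close>, a quadratic bound results.\<close>

lemma exec_read_length:
  assumes "3 \<le> K"
  shows "\<exists>tp. exec [replicate n True] read_length (100 * (n + 1) * (n + 1))
     (counters K (bits_tape [] 0) (\<lambda>_. 0) tp') (counters K tp ((\<lambda>_. 0)(0 := n)) tp')"
proof -
  define l where "l = bitlen n"
  let ?x = "replicate n True"
  have n: "n < 2 ^ l" unfolding l_def by (rule less_bitlen)
  have f: "fetch ?x (bits_tape w h) = None \<longleftrightarrow> n < Suc (horner_sum of_bool 2 w)" for w h
    by (auto simp: fetch_def address_bits_tape)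
  define \<sigma> where "\<sigma> j = counters K (bits_tape (replicate j True) j) ((\<lambda>_. 0)(1 := j)) tp'" for j
  \<comment> \<open>The address consisting of \<open>j\<close> ones is \<open>2 ^ j - 1\<close>; it
    first lies beyond the end of the input at \<open>j = bitlen n\<close>.\<close>
  have 1: "exec [?x] (While (\<lambda>v. fst v ! 0 \<noteq> None) write_one) (l * (1 + 2) + 1) (\<sigma> 0) (\<sigma> l)"
  proof (rule exec_While)
    have *: "fst (view_of [?x] (\<sigma> j)) ! 0 = None \<longleftrightarrow> l \<le> j" for j
      unfolding \<sigma>_def fetch_counters f using horner_ones[of j "[]"]
      by (simp add: l_def bitlen_le_iff)
    show "fst (view_of [?x] (\<sigma> j)) ! 0 \<noteq> None" if "j < l" for j using * that by simp
    show "\<not> fst (view_of [?x] (\<sigma> l)) ! 0 \<noteq> None" using * by simp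
    show "exec [?x] write_one 1 (\<sigma> j) (\<sigma> (Suc j))" if "j < l" for j
      unfolding write_one_def
    proof (rule exec_Act)
      have "act (symbol True, Move_Right) (bits_tape (replicate j True) (length (replicate j True))) =
          bits_tape (replicate (Suc j) True) (Suc j)"
        unfolding act_bits_tape_append by (simp add: replicate_append_same)
      then show "map2 act ((move_counter Move_Right 1 (view_of [?x] (\<sigma> j)))[0 := (2, Move_Right)]) (\<sigma> j) = \<sigma> (Suc j)"
        using assms unfolding \<sigma>_def
        by (subst map2_act_update) (simp_all add: move_counter_counters)
    qed
  qed
  \<comment> \<open>The low \<open>j\<close> bits are still ones, the others are already those of
    \<open>n\<close>.\<close>
  define w where "w j = replicate j True @ map (bit n) [j..<l]" for j
  define \<tau> where "\<tau> i = counters K (bits_tape (w (l - i)) (l - i))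
      ((\<lambda>_. 0)(0 := n div 2 ^ (l - i), 1 := l - i)) tp'" for i
  have lenw: "length (w j) = l" if "j \<le> l" for j using that by (simp add: w_def)
  have val: "Suc (horner_sum of_bool 2 (replicate j True @ False # map (bit n) [Suc j..<l])) =
      2 ^ j * Suc (2 * (n div 2 ^ Suc j))" if "j < l" for j
    unfolding horner_ones using horner_bits[OF n, of "Suc j"] that by simp
  have 2: "exec [?x] (While (nonzero 1) (step_back ;; write_zero ;; double ;;
       If_then_else (\<lambda>v. fst v ! 0 = None) Skip set_bit)) (l * ((13 * n + 10) + 2) + 1) (\<tau> 0) (\<tau> l)"
  proof (rule exec_While)
    fix i assume i: "i < l"
    define j where "j = l - Suc i"
    have j: "l - i = Suc j" "j < l" using i by (auto simp: j_def)
    define X where "X = n div 2 ^ Suc j"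
    let ?s = "\<lambda>a b. (\<lambda>_. 0::nat)(0 := a, 1 := b)"
    let ?u = "replicate j True @ False # map (bit n) [Suc j..<l]"
    have t0: "\<tau> i = counters K (bits_tape (w (Suc j)) (Suc j)) (?s X (Suc j)) tp'"
      unfolding \<tau>_def j X_def ..
    have e1: "exec [?x] step_back 1 (\<tau> i) (counters K (bits_tape (w (Suc j)) j) (?s X j) tp')"
      unfolding step_back_def t0
    proof (rule exec_Act)
      show "map2 act ((move_counter Move_Left 1 (view_of [?x] (counters K (bits_tape (w (Suc j)) (Suc j)) (?s X (Suc j)) tp')))
          [0 := (snd (view_of [?x] (counters K (bits_tape (w (Suc j)) (Suc j)) (?s X (Suc j)) tp')) ! 0, Move_Left)])
          (counters K (bits_tape (w (Suc j)) (Suc j)) (?s X (Suc j)) tp') = counters K (bits_tape (w (Suc j)) j) (?s X j) tp'"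
        using assms
        by (subst map2_act_update)
          (simp_all add: move_counter_counters symbol_counters act_bits_tape_move fun_upd_twist)
    qed
    have u: "(w (Suc j))[j := False] = ?u"
    proof -
      have "w (Suc j) = replicate j True @ True # map (bit n) [Suc j..<l]"
        by (simp add: w_def replicate_app_Cons_same)
      then show ?thesis by (simp add: list_update_append)
    qed
    have e2: "exec [?x] write_zero 1 (counters K (bits_tape (w (Suc j)) j) (?s X j) tp')
        (counters K (bits_tape ?u j) (?s X j) tp')"
      unfolding write_zero_def
    proof (rule exec_Act)
      have "act (symbol False, Stay) (bits_tape (w (Suc j)) j) = bits_tape ?u j"
        using j lenw[of "Suc j"] by (subst act_bits_tape) (simp_all add: u)
      then show "map2 act ((idle (view_of [?x] (counters K (bits_tape (w (Suc j)) j) (?s X j) tp')))[0 := (1, Stay)])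
          (counters K (bits_tape (w (Suc j)) j) (?s X j) tp') = counters K (bits_tape ?u j) (?s X j) tp'"
        by (subst act_update) simp_all
    qed
    have "cexec 3 double (13 * X + 3) (?s X j) (?s (2 * X) j)"
      using cexec_double[of "?s X j" X] by (simp add: fun_upd_twist)
    from cexecD[OF this assms]
    have e3: "exec [?x] double (13 * X + 3) (counters K (bits_tape ?u j) (?s X j) tp')
        (counters K (bits_tape ?u j) (?s (2 * X) j) tp')" .
    \<comment> \<open>With bit \<open>j\<close> tentatively 0, the address is
      \<open>2 ^ j * (2 * X + 1) - 1\<close>. It is beyond the end exactly if
      \<open>n div 2 ^ j\<close> is at most \<open>2 * X\<close>, that is, if bit \<open>j\<close>
      of \<open>n\<close> is 0.\<close>
    have None_iff: "fetch ?x (bits_tape ?u j) = None \<longleftrightarrow> \<not> bit n j"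
    proof -
      have "n div 2 ^ j = 2 * X + of_bool (bit n j)"
        unfolding X_def bit_iff_odd by (simp add: div_mult2_eq power_Suc2 del: power_Suc)
      moreover have "fetch ?x (bits_tape ?u j) = None \<longleftrightarrow> n div 2 ^ j < Suc (2 * X)"
        unfolding f val[OF j(2)] X_def[symmetric] by (simp add: div_less_iff_less_mult mult.commute)
      ultimately show ?thesis by simp
    qed
    have wj: "w j = replicate j True @ bit n j # map (bit n) [Suc j..<l]"
      unfolding w_def using j by (simp add: upt_conv_Cons)
    have Xj: "n div 2 ^ j = 2 * X + of_bool (bit n j)"
      unfolding X_def bit_iff_odd by (simp add: div_mult2_eq power_Suc2 del: power_Suc)
    have tS: "\<tau> (Suc i) = counters K (bits_tape (w j) j) (?s (n div 2 ^ j) j) tp'"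
      unfolding \<tau>_def j_def ..
    have e4: "exec [?x] (If_then_else (\<lambda>v. fst v ! 0 = None) Skip set_bit) (1 + 1)
        (counters K (bits_tape ?u j) (?s (2 * X) j) tp') (\<tau> (Suc i))"
    proof (rule exec_If)
      show "exec [?x] (if fst (view_of [?x] (counters K (bits_tape ?u j) (?s (2 * X) j) tp')) ! 0 = None then Skip else set_bit)
        1 (counters K (bits_tape ?u j) (?s (2 * X) j) tp') (\<tau> (Suc i))"
      proof (cases "bit n j")
        case False
        then show ?thesis
          unfolding fetch_counters None_iff tS Xj wj by (simp add: exec_Skip)
      next
        case True
        have "act (symbol True, Stay) (bits_tape ?u j) = bits_tape (w j) j"
          using j True by (subst act_bits_tape) (simp_all add: wj list_update_append)
        then have "exec [?x] set_bit 1 (counters K (bits_tape ?u j) (?s (2 * X) j) tp') (\<tau> (Suc i))"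
          unfolding set_bit_def tS Xj using True assms
          by (intro exec_Act) (subst map2_act_update, simp_all add: move_counter_counters fun_upd_twist)
        then show ?thesis using True unfolding fetch_counters None_iff by simp
      qed
    qed
    have "13 * X + 3 \<le> 13 * n + 3" unfolding X_def by (simp add: div_le_dividend)
    then show "exec [?x] (step_back ;; write_zero ;; double ;;
       If_then_else (\<lambda>v. fst v ! 0 = None) Skip set_bit) (13 * n + 10) (\<tau> i) (\<tau> (Suc i))"
      by (intro exec_mono[OF exec_Seq[OF e1 exec_Seq[OF e2 exec_Seq[OF e3 e4]]]]) simp
  qed (use assms in \<open>auto simp: \<tau>_def\<close>)
  have "\<sigma> 0 = counters K (bits_tape [] 0) (\<lambda>_. 0) tp'" by (simp add: \<sigma>_def fun_upd_idem)
  moreover have "\<sigma> l = \<tau> 0"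
    using n by (simp add: \<sigma>_def \<tau>_def w_def fun_upd_twist fun_upd_idem)
  moreover have "\<tau> l = counters K (bits_tape (w 0) 0) ((\<lambda>_. 0)(0 := n)) tp'"
    by (simp add: \<tau>_def fun_upd_idem)
  ultimately have ex: "exec [?x] read_length (l * (1 + 2) + 1 + (l * ((13 * n + 10) + 2) + 1) + 1)
     (counters K (bits_tape [] 0) (\<lambda>_. 0) tp') (counters K (bits_tape (w 0) 0) ((\<lambda>_. 0)(0 := n)) tp')"
    unfolding read_length_def using exec_Seq[OF 1] 2 by metis
  have "l * (1 + 2) + 1 + (l * ((13 * n + 10) + 2) + 1) + 1 \<le> 100 * (n + 1) * (n + 1)"
  proof -
    have "l \<le> n" unfolding l_def by (rule bitlen_le_self)
    then have "l * (13 * n + 15) \<le> n * (13 * n + 15)" by (rule mult_le_mono1)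
    then show ?thesis by (simp add: algebra_simps)
  qed
  with ex show ?thesis by (blast intro: exec_mono)
qed

definition print_counter :: "nat \<Rightarrow> prog" where
  "print_counter r = Act (\<lambda>v. (idle v)[length (snd v) - 1 := (symbol (nonzero r v), Move_Right)])"

lemma valid_print_counter: "valid_prog k (print_counter r)"
  unfolding print_counter_def valid_prog.simps
  by (intro allI impI valid_update idle_valid) auto

lemma exec_print_counter:
  assumes "r < K"
  shows "exec ws (print_counter r) 1 (counters K tp s (bits_tape w (length w)))
    (counters K tp s (bits_tape (w @ [s r \<noteq> 0]) (Suc (length w))))"
  unfolding print_counter_def
proof (rule exec_Act)
  show "map2 act ((idle (view_of ws (counters K tp s (bits_tape w (length w)))))
      [length (snd (view_of ws (counters K tp s (bits_tape w (length w))))) - 1 :=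
        (symbol (nonzero r (view_of ws (counters K tp s (bits_tape w (length w))))), Move_Right)])
      (counters K tp s (bits_tape w (length w))) =
    counters K tp s (bits_tape (w @ [s r \<noteq> 0]) (Suc (length w)))"
    using act_bits_tape_append[of "s r \<noteq> 0" Move_Right w] assms
    by (subst act_update) (simp_all split: if_splits)
qed

lemma realizable_program:
  assumes "realizable k C f" "\<And>i. i < k \<Longrightarrow> \<rho> i < b"
  obtains p h where "cvalid h p" "\<And>s. (\<And>r. r \<ge> b \<Longrightarrow> s r = 0) \<Longrightarrow>
    cexec h p (quasi C (esum k (s \<circ> \<rho>))) s (s(b := f (s \<circ> \<rho>)))"
proof -
  have "computes k (quasi C) f \<rho> b" using assms unfolding realizable_def by blast
  then obtain p h where p: "cvalid h p" "\<forall>s. (\<forall>r\<ge>b. s r = 0) \<longrightarrow>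
    cexec h p (quasi C (esum k (s \<circ> \<rho>))) s (s(b := f (s \<circ> \<rho>)))"
    unfolding computes_def by blast
  show thesis by (rule that[OF p(1)]) (use p(2) in simp)
qed

text \<open>Counter 0 holds \<open>n\<close>, counter 1 the number of entries left, counter 2 the
  index of the entry, and counter 3 its value, which is cleared after its bit has been printed. The
  number of entries is itself quasipolynomial, so unary counting is affordable.\<close>

lemma preprocessing_machine:
  assumes "qcomp (\<lambda>e. N (e 0))" "qcomp (\<lambda>e. f (e 0) (e (Suc 0)))"
  shows "\<exists>P S. well_formed 1 P \<and> qbounded S \<and>
    preprocesses P S (\<lambda>n. map (\<lambda>m. f n m \<noteq> 0) [0..<N n])"
proof -
  obtain kN CN where rN: "realizable kN CN (\<lambda>e. N (e 0))" using assms(1) unfolding qcomp_def by blast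
  obtain kf Cf where rf: "realizable kf Cf (\<lambda>e. f (e 0) (e (Suc 0)))" using assms(2) unfolding qcomp_def by blast
  obtain pN hN where pN: "cvalid hN pN" "\<And>s. (\<And>r. r \<ge> 1 \<Longrightarrow> s r = 0) \<Longrightarrow>
      cexec hN pN (quasi CN (esum kN (s \<circ> (\<lambda>_. 0)))) s (s(1 := N ((s \<circ> (\<lambda>_. 0)) 0)))"
    by (rule realizable_program[OF rN, of "\<lambda>_. 0" 1], simp, erule that, simp)
  define \<rho> where "\<rho> = (\<lambda>i::nat. if i = 0 then 0 else 2::nat)"
  obtain pf hf where pf: "cvalid hf pf" "\<And>s. (\<And>r. r \<ge> 3 \<Longrightarrow> s r = 0) \<Longrightarrow>
      cexec hf pf (quasi Cf (esum kf (s \<circ> \<rho>))) s (s(3 := f ((s \<circ> \<rho>) 0) ((s \<circ> \<rho>) (Suc 0))))"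
    by (rule realizable_program[OF rf, of \<rho> 3], simp add: \<rho>_def, erule that, simp)
  have Nle: "N n \<le> quasi CN (kN * n)" for n
  proof -
    have "N n \<le> quasi CN (esum kN (\<lambda>_. n))"
      using rN[unfolded realizable_def, THEN conjunct2, THEN conjunct1, rule_format, of "\<lambda>_. n"] .
    then show ?thesis by (simp add: esum_def)
  qed
  have fle: "f n m \<le> quasi Cf (kf * (n + m))" for n m
  proof -
    let ?e = "\<lambda>i::nat. if i = 0 then n else m"
    have "f (?e 0) (?e (Suc 0)) \<le> quasi Cf (esum kf ?e)"
      using rf[unfolded realizable_def, THEN conjunct2, THEN conjunct1, rule_format, of ?e] .
    also have "\<dots> \<le> quasi Cf (kf * (n + m))" by (intro quasi_mono esum_le) auto
    finally show ?thesis by simp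
  qed
  define K where "K = hN + hf + 4"
  define body where "body = Dec 1 ;; pf ;; print_counter 3 ;; clear 3 ;; Inc 2"
  define prg where "prg = mark_counters ;; read_length ;; pN ;; While (nonzero 1) body"
  define B where "B n = quasi Cf (kf * (n + quasi CN (kN * n)))" for n
  define S where "S n = 1 + 100 * (n + 1) * (n + 1) + quasi CN (kN * n) +
    (quasi CN (kN * n) * (4 * B n + 10) + 1) + 4" for n
  have vc: "valid_prog (K + 2) p" if "cvalid h p" "h \<le> K" for h p
    using that unfolding cvalid_def by blast
  have valid: "valid_prog (K + 2) prg"
    unfolding prg_def body_def
    using valid_mark_counters valid_read_length[of K] valid_print_counter vc[OF pN(1)] vc[OF pf(1)]
      vc[of 4 "clear 3"] vc[of 2 "Dec 1"] vc[of 3 "Inc 2"]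
    by (simp add: K_def)
  define P where "P = compile (K + 2) prg (\<lambda>_. True)"
  have "well_formed 1 P" unfolding P_def by (rule well_formed_compile[OF valid]) auto
  moreover have "qbounded S"
    unfolding S_def B_def
    by (intro qbounded_add qbounded_mult qbounded_const qbounded_id qbounded_quasi
        qbounded_comp[OF qbounded_quasi[of CN]] qbounded_comp[OF qbounded_quasi[of Cf]])
  moreover have "preprocesses P S (\<lambda>n. map (\<lambda>m. f n m \<noteq> 0) [0..<N n])"
    unfolding preprocesses_def Let_def
  proof (intro allI)
    fix n
    let ?ws = "[replicate n True]"
    let ?o = "\<lambda>m. bits_tape (map (\<lambda>m. f n m \<noteq> 0) [0..<m]) m"
    let ?s = "\<lambda>a b. (\<lambda>_. 0::nat)(0 := n, 1 := a, 2 := b)"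
    obtain tp where 2: "exec ?ws read_length (100 * (n + 1) * (n + 1))
        (counters K (bits_tape [] 0) (\<lambda>_. 0) (?o 0)) (counters K tp ((\<lambda>_. 0)(0 := n)) (?o 0))"
      using exec_read_length[of K n "?o 0"] by (auto simp: K_def)
    have 1: "exec ?ws mark_counters 1 (replicate (K + 2) (\<lambda>_. 0, 0)) (counters K (bits_tape [] 0) (\<lambda>_. 0) (?o 0))"
      using exec_mark_counters[of ?ws K] by simp
    have "cexec hN pN (quasi CN (kN * n)) ((\<lambda>_. 0)(0 := n)) (?s (N n) 0)"
      using pN(2)[of "(\<lambda>_. 0)(0 := n)"] by (simp add: esum_def comp_def fun_upd_idem)
    then have 3: "exec ?ws pN (quasi CN (kN * n)) (counters K tp ((\<lambda>_. 0)(0 := n)) (?o 0)) (counters K tp (?s (N n) 0) (?o 0))"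
      by (rule cexecD) (simp add: K_def)
    define \<sigma> where "\<sigma> m = counters K tp (?s (N n - m) m) (?o m)" for m
    have "exec ?ws (While (nonzero 1) body) (N n * ((4 * B n + 8) + 2) + 1) (\<sigma> 0) (\<sigma> (N n))"
    proof (rule exec_While)
      fix m assume m: "m < N n"
      let ?t = "\<lambda>a b c. (\<lambda>_. 0::nat)(0 := n, 1 := a, 2 := b, 3 := c)"
      have mB: "quasi Cf (kf * (n + m)) \<le> B n"
        unfolding B_def using m Nle[of n] by (intro quasi_mono mult_le_mono2) auto
      have "cexec 4 (Dec 1) 1 (?s (N n - m) m) (?t (N n - Suc m) m 0)"
        using cexec_Dec[of 1 4 "?s (N n - m) m"] by (simp add: fun_upd_twist fun_upd_idem)
      then have e1: "exec ?ws (Dec 1) 1 (\<sigma> m) (counters K tp (?t (N n - Suc m) m 0) (?o m))"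
        unfolding \<sigma>_def by (rule cexecD) (simp add: K_def)
      have "esum kf (?t (N n - Suc m) m 0 \<circ> \<rho>) \<le> kf * (n + m)"
        by (rule esum_le) (auto simp: \<rho>_def)
      then have le: "quasi Cf (esum kf (?t (N n - Suc m) m 0 \<circ> \<rho>)) \<le> B n"
        using quasi_mono[OF order_refl] mB order.trans by blast
      have "cexec hf pf (quasi Cf (esum kf (?t (N n - Suc m) m 0 \<circ> \<rho>))) (?t (N n - Suc m) m 0)
          (?t (N n - Suc m) m (f n m))"
        using pf(2)[of "?t (N n - Suc m) m 0"] by (simp add: \<rho>_def)
      then have "cexec hf pf (B n) (?t (N n - Suc m) m 0) (?t (N n - Suc m) m (f n m))"
        by (rule cexec_mono[OF _ order_refl le])
      then have e2: "exec ?ws pf (B n) (counters K tp (?t (N n - Suc m) m 0) (?o m))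
          (counters K tp (?t (N n - Suc m) m (f n m)) (?o m))"
        by (rule cexecD) (simp add: K_def)
      have e3: "exec ?ws (print_counter 3) 1 (counters K tp (?t (N n - Suc m) m (f n m)) (?o m))
          (counters K tp (?t (N n - Suc m) m (f n m)) (?o (Suc m)))"
        using exec_print_counter[of 3 K ?ws tp "?t (N n - Suc m) m (f n m)" "map (\<lambda>m. f n m \<noteq> 0) [0..<m]"]
        by (simp add: K_def)
      have "cexec 4 (clear 3) (3 * B n + 1) (?t (N n - Suc m) m (f n m)) (?t (N n - Suc m) m 0)"
        using cexec_clear[of 3 4 "?t (N n - Suc m) m (f n m)" "B n"] order.trans[OF fle mB] by simp
      then have e4: "exec ?ws (clear 3) (3 * B n + 1) (counters K tp (?t (N n - Suc m) m (f n m)) (?o (Suc m)))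
          (counters K tp (?t (N n - Suc m) m 0) (?o (Suc m)))"
        by (rule cexecD) (simp add: K_def)
      have "cexec 4 (Inc 2) 1 (?t (N n - Suc m) m 0) (?s (N n - Suc m) (Suc m))"
        using cexec_Inc[of 2 4 "?t (N n - Suc m) m 0"] by (simp add: fun_upd_twist fun_upd_idem)
      then have e5: "exec ?ws (Inc 2) 1 (counters K tp (?t (N n - Suc m) m 0) (?o (Suc m))) (\<sigma> (Suc m))"
        unfolding \<sigma>_def by (rule cexecD) (simp add: K_def)
      show "exec ?ws body (4 * B n + 8) (\<sigma> m) (\<sigma> (Suc m))"
        unfolding body_def
        by (rule exec_mono[OF exec_Seq[OF e1 exec_Seq[OF e2 exec_Seq[OF e3 exec_Seq[OF e4 e5]]]]]) simp
    qed (auto simp: \<sigma>_def K_def)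
    then have 4: "exec ?ws (While (nonzero 1) body) (quasi CN (kN * n) * (4 * B n + 10) + 1) (\<sigma> 0) (\<sigma> (N n))"
      by (rule exec_mono) (use mult_le_mono1[OF Nle[of n], of "4 * B n + 10"] in \<open>simp add: add.commute\<close>)
    have "\<sigma> 0 = counters K tp (?s (N n) 0) (?o 0)" by (simp add: \<sigma>_def)
    with 4 have "exec ?ws (While (nonzero 1) body) (quasi CN (kN * n) * (4 * B n + 10) + 1)
        (counters K tp (?s (N n) 0) (?o 0)) (\<sigma> (N n))" by simp
    from exec_Seq[OF 1 exec_Seq[OF 2 exec_Seq[OF 3 this]]]
    have "exec ?ws prg (S n - 1) (replicate (K + 2) (\<lambda>_. 0, 0)) (\<sigma> (N n))"
      unfolding prg_def S_def by (rule exec_mono) simp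
    then have "det_run P ?ws (S n - 1 + 1) = (accept, \<sigma> (N n))"
      unfolding P_def by (subst det_run_compile) (simp_all add: initial_def compile_def)
    moreover have "S n - 1 + 1 = S n" by (simp add: S_def)
    ultimately have "det_run P ?ws (S n) = (accept, \<sigma> (N n))" by (simp only:)
    moreover have "last (\<sigma> (N n)) = ?o (N n)" by (simp add: \<sigma>_def counters_def)
    ultimately show "halted (det_run P ?ws (S n)) \<and>
        map (\<lambda>m. f n m \<noteq> 0) [0..<N n] = tape_word (last (snd (det_run P ?ws (S n))))"
      by (simp add: halted_def)
  qed
  ultimately show ?thesis by blast
qed

section \<open>The deterministic machine\<close>

text \<open>Tape 0 holds an address into the input and tape 1 the position in the table, whose leading
  bit 1 is under the head.  Tape 2 is a counter for the length of the word on tape 0, so that the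
  machine notices when it has erased that word.\<close>

definition walk :: "bool list \<Rightarrow> bool list \<Rightarrow> tape list" where
  "walk w u = [bits_tape w (length w), bits_tape (u @ [True]) (length u), counter (length w)]"

definition lead :: prog where
  "lead = Act (\<lambda>v. (idle v)[1 := (2, Stay)])"

text \<open>The path grows at its most significant end: the leading 1 is overwritten by the new bit,
  and \<open>lead\<close> writes a new one behind it. Earlier bits keep their places.\<close>

definition push :: "(view \<Rightarrow> bool) \<Rightarrow> prog" where
  "push f = Act (\<lambda>v. (idle v)[1 := (symbol (f v), Move_Right)]) ;; lead"

definition start :: prog where
  "start = Act (\<lambda>v. (idle v)[1 := (2, Stay), 2 := (1, Stay)])"

text \<open>The table bit is appended to the address, while the path gets an uninformative 0, which
  only marks progress.\<close>

definition emit :: prog where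
  "emit = Act (\<lambda>v. (idle v)[0 := (symbol (fst v ! 1 = Some True), Move_Right), 1 := (1, Move_Right),
     2 := (snd v ! 2, Move_Right)]) ;; lead"

text \<open>Two lookups per address bit: a flag that another bit follows, then the bit
  itself.\<close>

definition write_address :: prog where
  "write_address = While (\<lambda>v. fst v ! 1 = Some True) (push (\<lambda>_. False) ;; emit)"

definition rewind :: prog where
  "rewind = While (\<lambda>v. snd v ! 2 = 0)
     (Act (\<lambda>v. (idle v)[0 := (snd v ! 0, Move_Left), 2 := (snd v ! 2, Move_Left)]) ;;
      Act (\<lambda>v. (idle v)[0 := (0, Stay)]))"

text \<open>No bound is built into the machine: addresses end by a flag in the table, and the main
  loop ends when an address lies beyond the input. The last \<open>push\<close> completes the block
  of that query and leads to the verdict entry.\<close>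

definition walker :: prog where
  "walker = start ;; write_address ;;
     While (\<lambda>v. fst v ! 0 \<noteq> None) (push (\<lambda>v. fst v ! 0 = Some True) ;; rewind ;; write_address) ;;
     push (\<lambda>_. False)"

definition position :: "bool list \<Rightarrow> nat" where
  "position u = horner_sum of_bool 2 (u @ [True])"

lemma view_walk:
  "view_of [x, A] (walk w u) =
     ([fetch x (bits_tape w (length w)), if position u < length A then Some (A ! position u) else None],
      [0, 2, if w = [] then 1 else 0])"
  by (simp add: view_of_def walk_def fetch_def address_bits_tape position_def)
    (simp add: bits_tape_def counter_def)

lemma act_explicit:
  "map2 act ((idle (view_of ws [t0, t1, t2]))[1 := a]) [t0, t1, t2] = [t0, act a t1, t2]"
  "map2 act ((idle (view_of ws [t0, t1, t2]))[0 := a]) [t0, t1, t2] = [act a t0, t1, t2]"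
  "map2 act ((idle (view_of ws [t0, t1, t2]))[1 := a, 2 := b]) [t0, t1, t2] = [t0, act a t1, act b t2]"
  "map2 act ((idle (view_of ws [t0, t1, t2]))[0 := a, 2 := b]) [t0, t1, t2] = [act a t0, t1, act b t2]"
  "map2 act ((idle (view_of ws [t0, t1, t2]))[0 := a, 1 := b, 2 := c]) [t0, t1, t2] = [act a t0, act b t1, act c t2]"
  by (simp_all add: map2_act_update)

lemma act_counter:
  "act (if c = 0 then 1 else 0, d) (counter c) = counter (move_head d c)"
  by (auto simp: counter_def fun_eq_iff)

lemma exec_lead:
  "exec ws lead 1 [t0, bits_tape u (length u), t2] [t0, bits_tape (u @ [True]) (length u), t2]"
  unfolding lead_def
proof (rule exec_Act)
  show "map2 act ((idle (view_of ws [t0, bits_tape u (length u), t2]))[1 := (2, Stay)])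
      [t0, bits_tape u (length u), t2] = [t0, bits_tape (u @ [True]) (length u), t2]"
    unfolding act_explicit using act_bits_tape_append[of True Stay u] by simp
qed

lemma act_path:
  "act (symbol b, Move_Right) (bits_tape (u @ [True]) (length u)) = bits_tape (u @ [b]) (length (u @ [b]))"
  by (subst act_bits_tape) simp_all

lemma exec_push:
  assumes "f (view_of ws (walk w u)) = b"
  shows "exec ws (push f) 3 (walk w u) (walk w (u @ [b]))"
proof -
  have "exec ws (Act (\<lambda>v. (idle v)[1 := (symbol (f v), Move_Right)])) 1 (walk w u)
      [bits_tape w (length w), bits_tape (u @ [b]) (length (u @ [b])), counter (length w)]"
    by (rule exec_Act) (unfold assms, unfold walk_def act_explicit act_path, rule refl)
  from exec_Seq[OF this exec_lead] show ?thesis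
    unfolding push_def walk_def by (simp add: numeral_3_eq_3)
qed

lemma exec_start: "exec ws start 1 (replicate 3 (\<lambda>_. 0, 0)) (walk [] [])"
proof -
  have "replicate 3 (\<lambda>_. 0, 0) = [(\<lambda>_. 0, 0), (\<lambda>_. 0, 0), (\<lambda>_. 0, 0) :: tape]"
    by (simp add: numeral_3_eq_3)
  moreover have "act (2, Stay) (\<lambda>_. 0, 0) = bits_tape [True] 0" "act (1, Stay) (\<lambda>_. 0, 0) = counter 0"
    by (auto simp: bits_tape_def counter_def fun_eq_iff)
  moreover have "(\<lambda>_. 0, 0) = bits_tape [] 0" by (simp add: bits_tape_def)
  ultimately show ?thesis
    unfolding start_def by (intro exec_Act) (simp only: act_explicit walk_def list.size append_Nil)
qed

lemma exec_emit:
  assumes "position u < length A" "A ! position u = b"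
  shows "exec [x, A] emit 3 (walk w u) (walk (w @ [b]) (u @ [False]))"
proof -
  let ?v = "view_of [x, A] (walk w u)"
  have b: "(fst ?v ! 1 = Some True) = b" using assms by (simp add: view_walk)
  have c: "snd ?v ! 2 = (if length w = 0 then 1 else 0)" by (simp add: view_walk)
  have "exec [x, A] (Act (\<lambda>v. (idle v)[0 := (symbol (fst v ! 1 = Some True), Move_Right), 1 := (1, Move_Right),
     2 := (snd v ! 2, Move_Right)])) 1 (walk w u)
     [bits_tape (w @ [b]) (length (w @ [b])), bits_tape (u @ [False]) (length (u @ [False])), counter (length (w @ [b]))]"
  proof (rule exec_Act)
    have "map2 act ((idle ?v)[0 := (symbol b, Move_Right), 1 := (symbol False, Move_Right),
         2 := (if length w = 0 then 1 else 0, Move_Right)]) (walk w u) =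
       [bits_tape (w @ [b]) (length (w @ [b])), bits_tape (u @ [False]) (length (u @ [False])), counter (length (w @ [b]))]"
      unfolding walk_def act_explicit act_path act_counter act_bits_tape_append by simp
    then show "map2 act ((idle ?v)[0 := (symbol (fst ?v ! 1 = Some True), Move_Right), 1 := (1, Move_Right),
         2 := (snd ?v ! 2, Move_Right)]) (walk w u) =
       [bits_tape (w @ [b]) (length (w @ [b])), bits_tape (u @ [False]) (length (u @ [False])), counter (length (w @ [b]))]"
      unfolding b c by simp
  qed
  from exec_Seq[OF this exec_lead] show ?thesis
    unfolding emit_def walk_def by (simp add: numeral_3_eq_3)
qed

lemma exec_rewind: "exec ws rewind (length w * 5 + 1) (walk w u) (walk [] u)"
proof -
  define l where "l = length w"
  define \<sigma> where "\<sigma> j = walk (take (l - j) w) u" for j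
  have sym: "snd (view_of ws (walk w u)) ! 2 = (if w = [] then 1 else 0)" for w
    by (simp add: view_of_def walk_def counter_def)
  have "exec ws rewind (l * (3 + 2) + 1) (\<sigma> 0) (\<sigma> l)"
    unfolding rewind_def
  proof (rule exec_While)
    fix j assume j: "j < l"
    define v where "v = take (l - Suc j) w"
    define b where "b = w ! (l - Suc j)"
    have w: "take (l - j) w = v @ [b]"
      using j unfolding v_def b_def l_def by (metis Suc_diff_Suc diff_Suc_less length_greater_0_conv
          less_nat_zero_code list.size(3) take_Suc_conv_app_nth)
    show "snd (view_of ws (\<sigma> j)) ! 2 = 0" unfolding \<sigma>_def sym w by simp
    let ?t = "walk (v @ [b]) u"
    have s0: "snd (view_of ws ?t) ! 0 = (case bits_tape (v @ [b]) (length (v @ [b])) of (f, h) \<Rightarrow> f h)"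
      by (simp add: view_of_def walk_def)
    have s2: "snd (view_of ws ?t) ! 2 = (if length (v @ [b]) = 0 then 1 else 0)"
      by (simp add: sym)
    have e1: "exec ws (Act (\<lambda>v. (idle v)[0 := (snd v ! 0, Move_Left), 2 := (snd v ! 2, Move_Left)])) 1 ?t
        [bits_tape (v @ [b]) (length v), bits_tape (u @ [True]) (length u), counter (length v)]"
    proof (rule exec_Act)
      show "map2 act ((idle (view_of ws ?t))[0 := (snd (view_of ws ?t) ! 0, Move_Left),
          2 := (snd (view_of ws ?t) ! 2, Move_Left)]) ?t =
        [bits_tape (v @ [b]) (length v), bits_tape (u @ [True]) (length u), counter (length v)]"
        unfolding s0 s2 unfolding walk_def act_explicit act_bits_tape_move act_counter by simp
    qed
    have "act (0, Stay) (bits_tape (v @ [b]) (length v)) = bits_tape v (length v)"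
      by (auto simp: bits_tape_def fun_eq_iff nth_append)
    then have e2: "exec ws (Act (\<lambda>v. (idle v)[0 := (0, Stay)])) 1
        [bits_tape (v @ [b]) (length v), bits_tape (u @ [True]) (length u), counter (length v)] (walk v u)"
      by (intro exec_Act) (unfold act_explicit walk_def, simp)
    show "exec ws (Act (\<lambda>v. (idle v)[0 := (snd v ! 0, Move_Left), 2 := (snd v ! 2, Move_Left)]) ;;
        Act (\<lambda>v. (idle v)[0 := (0, Stay)])) 3 (\<sigma> j) (\<sigma> (Suc j))"
      using exec_Seq[OF e1 e2] unfolding \<sigma>_def w v_def by (simp add: numeral_3_eq_3)
  qed (simp add: \<sigma>_def sym)
  then show ?thesis by (simp add: \<sigma>_def l_def)
qed

lemma exec_write_address:
  assumes flag: "\<And>j. j < l \<Longrightarrow> position (u @ replicate (2 * j) False) < length A \<and>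
      A ! position (u @ replicate (2 * j) False)"
    and bit: "\<And>j. j < l \<Longrightarrow> position (u @ replicate (2 * j + 1) False) < length A \<and>
      A ! position (u @ replicate (2 * j + 1) False) = b j"
    and stop: "position (u @ replicate (2 * l) False) < length A" "\<not> A ! position (u @ replicate (2 * l) False)"
  shows "exec [x, A] write_address (l * 9 + 1) (walk [] u) (walk (map b [0..<l]) (u @ replicate (2 * l) False))"
proof -
  define \<sigma> where "\<sigma> j = walk (map b [0..<j]) (u @ replicate (2 * j) False)" for j
  have "exec [x, A] write_address (l * (7 + 2) + 1) (\<sigma> 0) (\<sigma> l)"
    unfolding write_address_def
  proof (rule exec_While)
    fix j assume j: "j < l"
    show "fst (view_of [x, A] (\<sigma> j)) ! 1 = Some True"
      using flag[OF j] by (simp add: \<sigma>_def view_walk)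
    have r: "replicate (2 * j) False @ [False] = replicate (2 * j + 1) False"
      "replicate (2 * j + 1) False @ [False] = replicate (2 * Suc j) False"
      by (simp_all add: replicate_append_same)
    have e1: "exec [x, A] (push (\<lambda>_. False)) 3 (\<sigma> j) (walk (map b [0..<j]) (u @ replicate (2 * j + 1) False))"
      using exec_push[of "\<lambda>_. False" "[x, A]" "map b [0..<j]" "u @ replicate (2 * j) False" False]
      unfolding \<sigma>_def append_assoc r by simp
    have e2: "exec [x, A] emit 3 (walk (map b [0..<j]) (u @ replicate (2 * j + 1) False)) (\<sigma> (Suc j))"
      using exec_emit[of "u @ replicate (2 * j + 1) False" A "b j" x "map b [0..<j]"] bit[OF j]
      unfolding \<sigma>_def append_assoc r by simp
    show "exec [x, A] (push (\<lambda>_. False) ;; emit) 7 (\<sigma> j) (\<sigma> (Suc j))"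
      using exec_Seq[OF e1 e2] by simp
  qed (use stop in \<open>simp add: \<sigma>_def view_walk\<close>)
  then show ?thesis by (simp add: \<sigma>_def)
qed

lemma valid_walker: "valid_prog 3 walker"
proof -
  have lead: "valid_prog 3 lead"
    unfolding lead_def valid_prog.simps by (intro allI impI valid_update idle_valid; simp)
  have push: "valid_prog 3 (push f)" for f
    unfolding push_def valid_prog.simps using lead
    by (intro conjI allI impI valid_update idle_valid) auto
  have lt: "ss ! j < 3" if "length ss = 3 \<and> set ss \<subseteq> {..<3}" "j < 3" for ss :: "nat list" and j
  proof -
    have "ss ! j \<in> set ss" using that by (intro nth_mem) simp
    then show ?thesis using that by blast
  qed
  have emit: "valid_prog 3 emit"
    unfolding emit_def valid_prog.simps using lead
    by (intro conjI allI impI valid_update idle_valid) (auto intro: lt)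
  have start: "valid_prog 3 start"
    unfolding start_def valid_prog.simps by (intro allI impI valid_update idle_valid; simp)
  have rewind: "valid_prog 3 rewind"
    unfolding rewind_def valid_prog.simps
    by (intro conjI allI impI valid_update idle_valid) (auto intro: lt)
  show ?thesis
    unfolding walker_def write_address_def using push emit start rewind by simp
qed

lemma position_bounds: "2 ^ length u \<le> position u" "position u < 2 ^ Suc (length u)"
proof -
  have "position u = horner_sum of_bool 2 u + 2 ^ length u"
    unfolding position_def by (simp add: horner_sum_append)
  moreover have "horner_sum of_bool 2 u < (2::nat) ^ length u"
    using horner_sum_of_bool_2_less[of u] by simp
  ultimately show "2 ^ length u \<le> position u" "position u < 2 ^ Suc (length u)" by simp_all
qed

lemma bitlen_position: "bitlen (position u) = Suc (length u)"
  using position_bounds[of u] by (intro antisym) (simp_all add: bitlen_le_iff Suc_le_eq less_bitlen_iff)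

lemma digit_position: "i < length u \<Longrightarrow> digit 2 (position u) i = of_bool (u ! i)"
proof -
  assume i: "i < length u"
  have "bit (position u) i = u ! i"
    unfolding position_def bit_horner_sum_bit_iff using i by (simp add: nth_append)
  then show ?thesis by (simp add: digit_def bit_iff_odd mod_2_eq_odd)
qed

context deciding_machine
begin

definition word_table :: "nat \<Rightarrow> bool list" where
  "word_table n = map (\<lambda>m. table n m \<noteq> 0) [0..<table_size n]"

text \<open>Per query, \<open>9 * bitlen n\<close> accounts for writing the address and
  \<open>5 * bitlen n\<close> for erasing it.\<close>

definition walk_time :: "nat \<Rightarrow> nat" where
  "walk_time n = total_queries n * (14 * bitlen n + 9) + 9 * bitlen n + 12"

definition records :: "nat \<Rightarrow> nat set \<Rightarrow> nat \<Rightarrow> bool list \<Rightarrow> bool" where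
  "records n X q u \<longleftrightarrow> block n * q \<le> length u \<and>
     (\<forall>q'<q. u ! (block n * q' + 2 * bitlen n) \<longleftrightarrow> true_query n X q' \<in> X)"

lemma block_less: "q' < q \<Longrightarrow> block n * q' + 2 * bitlen n < block n * q"
proof -
  assume "q' < q"
  then have "block n * Suc q' \<le> block n * q" by (intro mult_le_mono2) simp
  then show ?thesis by (simp add: block_def)
qed

lemma records_append: "records n X q u \<Longrightarrow> records n X q (u @ u')"
  unfolding records_def
proof (intro conjI allI impI; elim conjE)
  fix q' assume *: "block n * q \<le> length u" "q' < q"
    "\<forall>q'<q. u ! (block n * q' + 2 * bitlen n) \<longleftrightarrow> true_query n X q' \<in> X"
  have "block n * q' + 2 * bitlen n < length u" using block_less[OF *(2), of n] *(1) by linarith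
  then show "(u @ u') ! (block n * q' + 2 * bitlen n) \<longleftrightarrow> true_query n X q' \<in> X"
    using * by (simp add: nth_append)
qed simp

lemma records_answer:
  assumes "records n X q u" "q' < q"
  shows "answer n (position u) q' \<longleftrightarrow> true_query n X q' \<in> X"
proof -
  have "block n * q' + 2 * bitlen n < length u"
    using assms block_less[OF assms(2), of n] unfolding records_def by linarith
  then show ?thesis
    unfolding answer_def using assms unfolding records_def by (simp add: digit_position)
qed

lemma records_known_code:
  assumes "records n X q u" "r * queries n \<le> q" "r \<le> rounds n"
  shows "known_code n (position u) r = true_known n X r"
  unfolding known_code_def min_absorb1[OF assms(3)]
  by (rule known_eq_true_known) (use records_answer[OF assms(1)] assms(2) in auto)

lemma word_table_path:
  assumes "length u \<le> block n * (total_queries n + 1)"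
  shows "position u < length (word_table n)"
    "word_table n ! position u \<longleftrightarrow> table n (position u) \<noteq> 0"
proof -
  have "position u < 2 ^ Suc (length u)" by (rule position_bounds)
  also have "\<dots> \<le> table_size n" unfolding table_size_def using assms by (intro power_increasing) auto
  finally have "position u < table_size n" .
  then show "position u < length (word_table n)" "word_table n ! position u \<longleftrightarrow> table n (position u) \<noteq> 0"
    unfolding word_table_def by simp_all
qed

lemma table_path:
  assumes "length u = block n * q + j" "j \<le> 2 * bitlen n" "q \<le> total_queries n"
  shows "table n (position u) = (if j = 2 * bitlen n then 0 else if j mod 2 = 0 then 1
     else digit 2 (query_code n (position u) q) (j div 2))"
proof -
  have "j < block n" using assms(2) by (simp add: block_def)
  then have "(bitlen (position u) - 1) div block n = q" "(bitlen (position u) - 1) mod block n = j"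
    unfolding bitlen_position assms(1) by simp_all
  then show ?thesis using assms(3) unfolding table_def Let_def by simp
qed

definition queried :: "nat \<Rightarrow> nat set \<Rightarrow> nat \<Rightarrow> nat" where
  "queried n X q = (if q < total_queries n then true_query n X q else n)"

lemma queried_le: "queried n X q \<le> n"
  unfolding queried_def true_query_def by (simp add: nth_heavy_le)

lemma queried_less:
  assumes "q < total_queries n"
  shows "queried n X q < n"
proof -
  \<comment> \<open>For \<open>n = 0\<close> the factor \<open>bitlen n\<close> leaves no
    queries.\<close>
  have "n \<noteq> 0" using assms unfolding total_queries_def queries_def by (auto intro: ccontr)
  then show ?thesis
    using assms nth_heavy_cases[of n] unfolding queried_def true_query_def by (metis neq0_conv)
qed

text \<open>Query \<open>q\<close> depends only on the answers of completed rounds, which all come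
  before it and are therefore recorded.\<close>

lemma query_code_path:
  assumes "records n X q u" "q \<le> total_queries n"
  shows "query_code n (position u) q = queried n X q"
proof (cases "q < total_queries n")
  case True
  then have "queries n > 0" by (auto simp: total_queries_def intro: ccontr)
  then have "q div queries n < rounds n"
    using True unfolding total_queries_def by (simp add: div_less_iff_less_mult)
  moreover have "q div queries n * queries n \<le> q" by simp
  ultimately show ?thesis
    using True records_known_code[OF assms(1), of "q div queries n"]
    unfolding query_code_def queried_def true_query_def by simp
qed (simp add: query_code_def queried_def)

lemma exec_address:
  assumes "records n X q u" "length u = block n * q" "q \<le> total_queries n"
  shows "exec [x, word_table n] write_address (bitlen n * 9 + 1) (walk [] u)
    (walk (map (bit (queried n X q)) [0..<bitlen n]) (u @ replicate (2 * bitlen n) False))"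
proof (rule exec_write_address)
  \<comment> \<open>Appending zeros within the block preserves the recorded answers, so all lookups
    of the block refer to the same query.\<close>
  have t: "position (u @ replicate j False) < length (word_table n) \<and>
     (word_table n ! position (u @ replicate j False) \<longleftrightarrow>
      (if j = 2 * bitlen n then False else if j mod 2 = 0 then True else bit (queried n X q) (j div 2)))"
    if "j \<le> 2 * bitlen n" for j
  proof -
    let ?u = "u @ replicate j False"
    have len: "length ?u = block n * q + j" using assms(2) by simp
    have "block n * q + j \<le> block n * (q + 1)" using that by (simp add: block_def)
    also have "\<dots> \<le> block n * (total_queries n + 1)" using assms(3) by (intro mult_le_mono2) simp
    finally have "length ?u \<le> block n * (total_queries n + 1)" using len by simp
    note w = word_table_path[OF this]
    have "query_code n (position ?u) q = queried n X q"
      by (rule query_code_path[OF records_append[OF assms(1)] assms(3)])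
    then show ?thesis
      using w table_path[OF len that assms(3)] by (simp add: digit_def bit_iff_odd mod_2_eq_odd)
  qed
  fix j assume j: "j < bitlen n"
  then show "position (u @ replicate (2 * j) False) < length (word_table n) \<and>
      word_table n ! position (u @ replicate (2 * j) False)"
    using t[of "2 * j"] by simp
  have "2 * j + 1 \<noteq> 2 * bitlen n" "2 * j + 1 \<le> 2 * bitlen n" "(2 * j + 1) mod 2 \<noteq> 0" "(2 * j + 1) div 2 = j"
    using j by presburger+
  then show "position (u @ replicate (2 * j + 1) False) < length (word_table n) \<and>
      word_table n ! position (u @ replicate (2 * j + 1) False) = bit (queried n X q) j"
    using t[of "2 * j + 1"] by (simp only: if_False)
next
  show "position (u @ replicate (2 * bitlen n) False) < length (word_table n)"
    using word_table_path(1)[of "u @ replicate (2 * bitlen n) False" n] assms(2)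
      mult_le_mono2[of "q + 1" "total_queries n + 1" "block n"] assms(3) by (simp add: block_def)
  show "\<not> word_table n ! position (u @ replicate (2 * bitlen n) False)"
    using word_table_path(2)[of "u @ replicate (2 * bitlen n) False" n] assms(2)
      mult_le_mono2[of "q + 1" "total_queries n + 1" "block n"] assms(3)
      table_path[of "u @ replicate (2 * bitlen n) False" n q "2 * bitlen n"] by (simp add: block_def)
qed

text \<open>\<open>bitlen n\<close> bits suffice even for the stopping position \<open>n\<close>,
  which lies just beyond the input and yields \<open>None\<close>.\<close>

lemma fetch_queried:
  "fetch (input_word n X) (bits_tape (map (bit (queried n X q)) [0..<bitlen n]) h) =
     (if q < total_queries n then Some (true_query n X q \<in> X) else None)"
proof -
  have "queried n X q < 2 ^ bitlen n" using queried_le[of n X q] less_bitlen[of n] by linarith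
  then have "address (bits_tape (map (bit (queried n X q)) [0..<bitlen n]) h) = queried n X q"
    unfolding address_bits_tape horner_sum_bit_eq_take_bit by (simp add: take_bit_nat_def)
  then show ?thesis
    unfolding fetch_input_word using queried_less[of q n X] by (auto simp: queried_def)
qed

lemma walker_decides:
  assumes "X \<subseteq> {..<n}"
  shows "fst (det_run (compile 3 walker (\<lambda>v. fst v ! 1 = Some True)) [input_word n X, word_table n] (walk_time n + 1)) =
    verdict L (input_word n X)"
proof -
  let ?ws = "[input_word n X, word_table n]"
  define l where "l = bitlen n"
  define Q where "Q = total_queries n"
  define a where "a q \<longleftrightarrow> true_query n X q \<in> X" for q
  \<comment> \<open>The true path: for each query \<open>2 * l\<close> zeros followed by the true
    answer.\<close>
  define path where "path q = concat (map (\<lambda>i. replicate (2 * l) False @ [a i]) [0..<q])" for q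
  have path_Suc: "path (Suc q) = path q @ replicate (2 * l) False @ [a q]" for q by (simp add: path_def)
  have len: "length (path q) = block n * q" for q
    by (induction q) (simp add: path_def, simp add: path_Suc block_def l_def)
  have rec: "records n X q (path q)" for q
  proof (induction q)
    case (Suc q)
    have "path (Suc q) ! (block n * q + 2 * bitlen n) = a q"
      unfolding path_Suc using len[of q] by (simp add: nth_append l_def)
    moreover have "records n X q (path (Suc q))" unfolding path_Suc by (rule records_append[OF Suc])
    ultimately show ?case
      using len[of "Suc q"] unfolding records_def a_def by (auto simp: less_Suc_eq)
  qed (simp add: records_def)
  define w where "w q = map (bit (queried n X q)) [0..<l]" for q
  define \<sigma> where "\<sigma> q = walk (w q) (path q @ replicate (2 * l) False)" for q
  have addr: "exec ?ws write_address (l * 9 + 1) (walk [] (path q)) (\<sigma> q)" if "q \<le> Q" for q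
    unfolding \<sigma>_def w_def l_def by (rule exec_address) (use rec len that in \<open>auto simp: Q_def\<close>)
  have view0: "fst (view_of ?ws (\<sigma> q)) ! 0 = (if q < Q then Some (a q) else None)" for q
    unfolding \<sigma>_def view_walk a_def Q_def w_def l_def by (simp add: fetch_queried)
  have loop: "exec ?ws (While (\<lambda>v. fst v ! 0 \<noteq> None) (push (\<lambda>v. fst v ! 0 = Some True) ;; rewind ;; write_address))
     (Q * ((14 * l + 7) + 2) + 1) (\<sigma> 0) (\<sigma> Q)"
  proof (rule exec_While)
    fix q assume q: "q < Q"
    show "fst (view_of ?ws (\<sigma> q)) ! 0 \<noteq> None" unfolding view0 using q by simp
    have e1: "exec ?ws (push (\<lambda>v. fst v ! 0 = Some True)) 3 (\<sigma> q) (walk (w q) (path (Suc q)))"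
    proof -
      have "(fst (view_of ?ws (walk (w q) (path q @ replicate (2 * l) False))) ! 0 = Some True) = a q"
        using view0[of q] q unfolding \<sigma>_def by simp
      from exec_push[of "\<lambda>v. fst v ! 0 = Some True", OF this] show ?thesis
        unfolding \<sigma>_def path_Suc by simp
    qed
    have e2: "exec ?ws rewind (l * 5 + 1) (walk (w q) (path (Suc q))) (walk [] (path (Suc q)))"
      using exec_rewind[of ?ws "w q"] by (simp add: w_def)
    have e3: "exec ?ws write_address (l * 9 + 1) (walk [] (path (Suc q))) (\<sigma> (Suc q))"
      by (rule addr) (use q in simp)
    show "exec ?ws (push (\<lambda>v. fst v ! 0 = Some True) ;; rewind ;; write_address) (14 * l + 7) (\<sigma> q) (\<sigma> (Suc q))"
      using exec_Seq[OF e1 exec_Seq[OF e2 e3]] by (rule exec_mono) simp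
  qed (simp add: view0)
  \<comment> \<open>The stopping query gets the dummy answer \<open>False\<close>. The path then has
    \<open>Q + 1\<close> full blocks, so its quotient exceeds \<open>total_queries n\<close> and
    selects the verdict.\<close>
  define u where "u = path Q @ replicate (2 * l) False @ [False]"
  have last: "exec ?ws (push (\<lambda>_. False)) 3 (\<sigma> Q) (walk (w Q) u)"
    using exec_push[of "\<lambda>_. False" ?ws "w Q" "path Q @ replicate (2 * l) False" False]
    unfolding \<sigma>_def u_def by simp
  have "path 0 = []" by (simp add: path_def)
  then have start: "exec ?ws start 1 (replicate 3 (\<lambda>_. 0, 0)) (walk [] (path 0))"
    using exec_start by simp
  have "exec ?ws walker (walk_time n) (replicate 3 (\<lambda>_. 0, 0)) (walk (w Q) u)"
    unfolding walker_def
    by (rule exec_mono[OF exec_Seq[OF start exec_Seq[OF addr[of 0] exec_Seq[OF loop last]]]])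
      (simp_all add: walk_time_def l_def Q_def algebra_simps)
  then have run: "det_run (compile 3 walker (\<lambda>v. fst v ! 1 = Some True)) ?ws (walk_time n + 1) =
      (if fst (view_of ?ws (walk (w Q) u)) ! 1 = Some True then accept else reject, walk (w Q) u)"
    by (intro det_run_compile) (simp add: initial_def compile_def)
  have lu: "length u = block n * (Q + 1)" unfolding u_def using len[of Q] by (simp add: block_def l_def)
  have "block n > 0" by (simp add: block_def)
  then have d: "(bitlen (position u) - 1) div block n = Q + 1"
    unfolding bitlen_position lu by simp
  have "records n X Q u" unfolding u_def by (rule records_append[OF rec])
  then have "known_code n (position u) (rounds n) = true_known n X (rounds n)"
    by (rule records_known_code) (simp_all add: Q_def total_queries_def)
  then have "table n (position u) = of_bool (input_word n X \<in> L)"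
    unfolding table_def Let_def d using true_known_correct[OF assms] by (simp add: Q_def)
  then have "fst (view_of ?ws (walk (w Q) u)) ! 1 = Some (input_word n X \<in> L)"
    unfolding view_walk using word_table_path[of u n] lu by (simp add: Q_def)
  then show ?thesis unfolding run verdict_def by simp
qed

lemma det_decides: "det_decides_with (compile 3 walker (\<lambda>v. fst v ! 1 = Some True)) word_table (\<lambda>n. walk_time n + 1) L"
  unfolding det_decides_with_def
proof
  fix x :: "bool list"
  define X where "X = {i. i < length x \<and> x ! i}"
  have "input_word (length x) X = x"
    unfolding input_word_def X_def by (rule nth_equalityI) auto
  moreover have "X \<subseteq> {..<length x}" by (auto simp: X_def)
  ultimately show "fst (det_run (compile 3 walker (\<lambda>v. fst v ! 1 = Some True)) [x, word_table (length x)]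
      (walk_time (length x) + 1)) = verdict L x"
    using walker_decides[of X "length x"] by simp
qed

lemma plog_walk_time: "plog (\<lambda>n. walk_time n + 1)"
  unfolding walk_time_def total_queries_def rounds_def queries_def time_def
  by (intro plog_add plog_mult plog_power plog_const plog_bitlen)

end

section \<open>Asymptotics\<close>

lemma log2_le_bitlen: "0 < n \<Longrightarrow> log 2 (real n) \<le> real (bitlen n)"
proof -
  assume n: "0 < n"
  have "real n \<le> real (2 ^ bitlen n)" using less_bitlen[of n] by (intro of_nat_mono) simp
  then have "log 2 (real n) \<le> log 2 (2 ^ bitlen n)" using n by (intro log_mono) simp_all
  then show ?thesis by simp
qed

lemma bitlen_le_log2: "0 < n \<Longrightarrow> real (bitlen n) \<le> log 2 (real n) + 1"
proof -
  assume n: "0 < n"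
  define b where "b = bitlen n - 1"
  have b: "bitlen n = Suc b" using bitlen_pos[OF n] by (simp add: b_def)
  then have "2 ^ b \<le> n" using less_bitlen_iff[of b n] by simp
  then have "real (2 ^ b) \<le> real n" by (rule of_nat_mono)
  then have "log 2 (2 ^ b) \<le> log 2 (real n)" using n by (intro log_mono) simp_all
  then show ?thesis using b by simp
qed

lemma plog_polylog:
  assumes "plog h"
  shows "polylog h"
proof -
  obtain C where C: "\<And>x. h x \<le> (C + bitlen x) ^ C" using assms unfolding plog_def by blast
  have "eventually (\<lambda>n. real (h n) \<le> log 2 (real n) ^ (2 * C)) sequentially"
  proof (rule eventually_sequentiallyI)
    \<comment> \<open>Then \<open>C + 2\<close> is at most the logarithm y of \<open>n\<close>, so
      \<open>C + bitlen n\<close> is at most C + 1 + y, hence at most 2 y and at most y^2. This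
      turns the additive constant into the exponent \<open>2 * C\<close>.\<close>
    fix n :: nat assume n: "2 ^ (C + 2) \<le> n"
    then have "0 < n" by (metis gr0I le_zero_eq power_not_zero zero_neq_numeral)
    have "real (2 ^ (C + 2)) \<le> real n" using n by (rule of_nat_mono)
    then have "log 2 (2 ^ (C + 2)) \<le> log 2 (real n)"
      using \<open>0 < n\<close> by (intro log_mono) (simp_all only: of_nat_power of_nat_numeral, simp_all)
    then have "real (C + 2) \<le> log 2 (real n)" by (subst (asm) log_pow_cancel) simp_all
    then have y: "real C + 2 \<le> log 2 (real n)" by simp
    have "real (C + bitlen n) \<le> 2 * log 2 (real n)" using bitlen_le_log2[OF \<open>0 < n\<close>] y by simp
    also have "\<dots> \<le> log 2 (real n) * log 2 (real n)" using y by (intro mult_right_mono) auto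
    finally have "real (C + bitlen n) \<le> log 2 (real n) ^ 2" by (simp add: power2_eq_square)
    then have "real (C + bitlen n) ^ C \<le> (log 2 (real n) ^ 2) ^ C" by (intro power_mono) auto
    moreover have "real (h n) \<le> real (C + bitlen n) ^ C"
      using of_nat_mono[OF C[of n], where 'a = real] by simp
    ultimately show "real (h n) \<le> log 2 (real n) ^ (2 * C)" by (simp add: power_mult)
  qed
  then show ?thesis unfolding polylog_def by blast
qed

text \<open>\<open>polylog\<close> only speaks about large \<open>n\<close>; the constant
  \<open>c\<close> is the sum of the finitely many remaining values. The result has the form of
  \<open>time\<close>.\<close>

lemma polylog_bounded:
  assumes "polylog T"
  shows "\<exists>k c. \<forall>n. T n \<le> bitlen n ^ k + c + 1"
proof -
  obtain k N where k: "\<And>n. n \<ge> N \<Longrightarrow> real (T n) \<le> log 2 (real n) ^ k"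
    using assms unfolding polylog_def eventually_sequentially by blast
  define c where "c = (\<Sum>i<Suc N. T i)"
  have "T n \<le> bitlen n ^ k + c + 1" for n
  proof (cases "n < Suc N")
    case True
    then have "T n \<le> c" unfolding c_def by (intro member_le_sum[where f = T]) auto
    then show ?thesis by simp
  next
    case False
    then have n: "0 < n" "N \<le> n" by auto
    have "real (T n) \<le> log 2 (real n) ^ k" using k n by simp
    also have "\<dots> \<le> real (bitlen n) ^ k" using log2_le_bitlen[of n] n by (intro power_mono) auto
    finally have "real (T n) \<le> real (bitlen n ^ k)" by simp
    then show ?thesis by (simp only: of_nat_le_iff)
  qed
  then show ?thesis by blast
qed

theorem corollary2p2:
  fixes L :: "bool list set"
  assumes "\<exists>M T. well_formed 1 M \<and> polylog T \<and> rand_decides M T L"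
  shows "\<exists>P S A D T. well_formed 1 P \<and> quasipoly S \<and> preprocesses P S A \<and>
           well_formed 2 D \<and> polylog T \<and> det_decides_with D A T L"
proof -
  obtain M T where M: "well_formed 1 M" "polylog T" "rand_decides M T L" using assms by blast
  obtain k c where T: "\<And>n. T n \<le> bitlen n ^ k + c + 1" using polylog_bounded[OF M(2)] by blast
  interpret randomized_machine M k c by unfold_locales (rule M(1))
  interpret deciding_machine M k c L T
    by unfold_locales (use M(3) T in \<open>auto simp: time_def\<close>)
  have "qcomp (\<lambda>e. table_size (e 0))" "qcomp (\<lambda>e. table (e 0) (e (Suc 0)))"
    by (intro qcomp_table_size qcomp_table qcomp_var)+
  from preprocessing_machine[OF this] obtain P S where P: "well_formed 1 P" "qbounded S"
    "preprocesses P S word_table"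
    unfolding word_table_def by blast
  have "quasipoly S"
    using P(2) plog_polylog unfolding qbounded_iff quasipoly_def by blast
  moreover have "well_formed 2 (compile 3 walker (\<lambda>v. fst v ! 1 = Some True))"
    by (rule well_formed_compile[OF valid_walker]) auto
  ultimately show ?thesis using P det_decides plog_polylog[OF plog_walk_time] by blast
qed

end
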